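(* Let $\lambda>1$ be real and $n\ge1$ an integer, and let $M_{\lambda,n}=M^{(\lambda,\underline\mu)}$ with $\mu_k=\frac{(k!)^2}{(\lambda-1)_{2k}}$, $0\le k<n$. Then $M_{\lambda,n}$ is a completely non-unitary contraction, and its characteristic function coincides with $\theta_{\lambda,n}:\mathbb D\to\mathcal B(\mathcal H^{(\lambda+2n-1)},\mathcal H^{(\lambda-1)})$, $$\theta_{\lambda,n}(z)=\frac1{\sqrt{(\lambda-1)_{2n}}}D^+_{\lambda-1}(\varphi_z)^*(\partial^n)^*D^+_{\lambda+2n-1}(\varphi_z)=\theta_\lambda(z)\theta_{\lambda+2}(z)\cdots\theta_{\lambda+2n-2}(z),\qquad z\in\mathbb D,$$ where for $\nu>1$, $\theta_\nu(z)=\frac1{\sqrt{\nu(\nu-1)}}D^+_{\nu-1}(\varphi_z)^*\partial^*D^+_{\nu+1}(\varphi_z):\mathcal H^{(\nu+1)}\to\mathcal H^{(\nu-1)}$.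
   Context: $\varphi_z(w)=\frac{z-w}{1-\bar zw}$. $(x)_p=\prod_{0\le i<p}(x+i)$. For $\lambda>0$, $\mathcal H^{(\lambda)}$ is the Hilbert space of holomorphic functions on $\mathbb D$ with reproducing kernel $(1-z\bar w)^{-\lambda}$; $D^+_\lambda$ is the projective unitary representation of the Möbius group on it, $(D_\lambda^+(\varphi^{-1})f)(z)=(\varphi'(z))^{\lambda/2}f(\varphi(z))$ (branch Borel in $\varphi$, analytic in $z$). For $r\ge0$, $\lambda'\ge\lambda+2r$, $\partial^r:\mathcal H^{(\lambda)}\to\mathcal H^{(\lambda')}$ is $r$-fold differentiation. $\mathcal H_n^{(\lambda)}=\bigoplus_{i<n}\mathcal H^{(\lambda+2i)}$; for $\underline\mu\in\mathbb R^n_{>0}$, $\Gamma^{(\lambda,\underline\mu)}(\oplus_jf_j)_\ell=\sum_{j\le\ell}\frac{\sqrt{\mu_j}\binom\ell j}{(\lambda+2j)_{\ell-j}}f_j^{(\ell-j)}$ is injective into $\mathrm{Hol}(\mathbb D,\mathbb C^n)$; $\mathcal H^{(\lambda,\underline\mu)}$ is its image with transported inner product; $M^{(\lambda,\underline\mu)}$ is multiplication by $z$ on it. A contraction is completely non-unitary if it has no nonzero reducing subspace on which it is unitary. For a contraction $T$ with defect spaces $\mathcal D,\mathcal D_*$ (closures of ranges of $(I-T^*T)^{1/2},(I-TT^* )^{1/2}$) and defect operators $D,D_*$, the characteristic function is $\theta_T(z)\in\mathcal B(\mathcal D,\mathcal D_* )$ with $\theta_T(z)D=D_*(I-zT^*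 )^{-1}(zI-T)$. Two such functions coincide if they agree after composing with unitaries $v_*$ on the left and $v^{-1}$ on the right: $v_*\theta_1(z)=\theta_2(z)v$ for all $z$. *)

theory Defs
  imports "HOL-Analysis.Analysis" "HOL-Library.Function_Algebras"
begin

class cscale =
  fixes cscale :: "complex \<Rightarrow> 'a \<Rightarrow> 'a"

instantiation complex :: cscale
begin
definition cscale_complex :: "complex \<Rightarrow> complex \<Rightarrow> complex" where
  "cscale_complex c x = c * x"
instance ..
end

instantiation "fun" :: (type, cscale) cscale
begin
definition cscale_fun :: "complex \<Rightarrow> ('a \<Rightarrow> 'b) \<Rightarrow> 'a \<Rightarrow> 'b" where
  "cscale_fun c f = (\<lambda>x. cscale c (f x))"
instance ..
end

section \<open>Generic operator notions on a (pre-)Hilbert space given as carrier H with inner product ip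
  (ip linear in the first, conjugate-linear in the second argument)\<close>

definition nrm :: "('a \<Rightarrow> 'a \<Rightarrow> complex) \<Rightarrow> 'a \<Rightarrow> real" where
  "nrm ip x = sqrt (Re (ip x x))"

definition linear_on :: "'a::{ab_group_add,cscale} set \<Rightarrow> ('a \<Rightarrow> 'b::{ab_group_add,cscale}) \<Rightarrow> bool" where
  "linear_on H T \<longleftrightarrow> (\<forall>x\<in>H. \<forall>y\<in>H. T (x + y) = T x + T y) \<and> (\<forall>x\<in>H. \<forall>c. T (cscale c x) = cscale c (T x))"

definition adjoint :: "'a set \<Rightarrow> ('a \<Rightarrow> 'a \<Rightarrow> complex) \<Rightarrow> 'b set \<Rightarrow> ('b \<Rightarrow> 'b \<Rightarrow> complex)
    \<Rightarrow> ('a \<Rightarrow> 'b) \<Rightarrow> 'b \<Rightarrow> 'a" where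
  "adjoint H1 ip1 H2 ip2 T y = (THE x. x \<in> H1 \<and> (\<forall>u\<in>H1. ip2 (T u) y = ip1 u x))"

text \<open>Positive square root of a (positive) operator A on H (made unique by vanishing off H).\<close>
definition psqrt :: "'a::{ab_group_add,cscale} set \<Rightarrow> ('a \<Rightarrow> 'a \<Rightarrow> complex) \<Rightarrow> ('a \<Rightarrow> 'a) \<Rightarrow> 'a \<Rightarrow> 'a" where
  "psqrt H ip A = (THE B. (\<forall>x. x \<notin> H \<longrightarrow> B x = 0) \<and> (\<forall>x\<in>H. B x \<in> H) \<and> linear_on H B
      \<and> (\<forall>x\<in>H. \<forall>y\<in>H. ip (B x) y = ip x (B y)) \<and> (\<forall>x\<in>H. 0 \<le> Re (ip (B x) x))
      \<and> (\<forall>x\<in>H. B (B x) = A x))"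

definition clos :: "'a::ab_group_add set \<Rightarrow> ('a \<Rightarrow> 'a \<Rightarrow> complex) \<Rightarrow> 'a set \<Rightarrow> 'a set" where
  "clos H ip S = {x \<in> H. \<forall>e>0. \<exists>y\<in>S. nrm ip (x - y) < e}"

definition closed_subspace :: "'a::{ab_group_add,cscale} set \<Rightarrow> ('a \<Rightarrow> 'a \<Rightarrow> complex) \<Rightarrow> 'a set \<Rightarrow> bool" where
  "closed_subspace H ip K \<longleftrightarrow> K \<subseteq> H \<and> 0 \<in> K \<and> (\<forall>x\<in>K. \<forall>y\<in>K. x + y \<in> K)
     \<and> (\<forall>x\<in>K. \<forall>c. cscale c x \<in> K) \<and> clos H ip K = K"

definition is_contraction :: "'a::{ab_group_add,cscale} set \<Rightarrow> ('a \<Rightarrow> 'a \<Rightarrow> complex) \<Rightarrow> ('a \<Rightarrow> 'a) \<Rightarrow> bool" where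
  "is_contraction H ip T \<longleftrightarrow> (\<forall>x\<in>H. T x \<in> H) \<and> linear_on H T \<and> (\<forall>x\<in>H. nrm ip (T x) \<le> nrm ip x)"

definition completely_non_unitary :: "'a::{ab_group_add,cscale} set \<Rightarrow> ('a \<Rightarrow> 'a \<Rightarrow> complex) \<Rightarrow> ('a \<Rightarrow> 'a) \<Rightarrow> bool" where
  "completely_non_unitary H ip T \<longleftrightarrow>
     \<not> (\<exists>K. closed_subspace H ip K \<and> K \<noteq> {0} \<and> T ` K \<subseteq> K \<and> adjoint H ip H ip T ` K \<subseteq> K
            \<and> T ` K = K \<and> (\<forall>x\<in>K. nrm ip (T x) = nrm ip x))"

definition unitary_betw :: "'a::{ab_group_add,cscale} set \<Rightarrow> ('a \<Rightarrow> 'a \<Rightarrow> complex)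
    \<Rightarrow> 'b::{ab_group_add,cscale} set \<Rightarrow> ('b \<Rightarrow> 'b \<Rightarrow> complex) \<Rightarrow> ('a \<Rightarrow> 'b) \<Rightarrow> bool" where
  "unitary_betw K1 ip1 K2 ip2 v \<longleftrightarrow> linear_on K1 v \<and> v ` K1 = K2 \<and> (\<forall>x\<in>K1. \<forall>y\<in>K1. ip2 (v x) (v y) = ip1 x y)"

definition resolv :: "'a::{ab_group_add,cscale} set \<Rightarrow> ('a \<Rightarrow> 'a \<Rightarrow> complex) \<Rightarrow> ('a \<Rightarrow> 'a) \<Rightarrow> complex \<Rightarrow> 'a \<Rightarrow> 'a" where
  "resolv H ip T z y = (THE x. x \<in> H \<and> x - cscale z (adjoint H ip H ip T x) = y)"

definition defect_op :: "'a::{ab_group_add,cscale} set \<Rightarrow> ('a \<Rightarrow> 'a \<Rightarrow> complex) \<Rightarrow> ('a \<Rightarrow> 'a) \<Rightarrow> 'a \<Rightarrow> 'a" where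
  "defect_op H ip T = psqrt H ip (\<lambda>x. x - adjoint H ip H ip T (T x))"

definition defect_op_star :: "'a::{ab_group_add,cscale} set \<Rightarrow> ('a \<Rightarrow> 'a \<Rightarrow> complex) \<Rightarrow> ('a \<Rightarrow> 'a) \<Rightarrow> 'a \<Rightarrow> 'a" where
  "defect_op_star H ip T = psqrt H ip (\<lambda>x. x - T (adjoint H ip H ip T x))"

text \<open>The characteristic function of T coincides with Theta : D \<rightarrow> B(K1, K2):
  there are unitaries v : \<D> \<rightarrow> K1 and v_* : \<D>_* \<rightarrow> K2 with v_* \<theta>_T(z) = Theta(z) v, where
  \<theta>_T(z) is determined by its defining relation \<theta>_T(z) D = D_* (I - z T^*)^{-1} (z I - T).\<close>
definition char_fun_coincides :: "'a::{ab_group_add,cscale} set \<Rightarrow> ('a \<Rightarrow> 'a \<Rightarrow> complex) \<Rightarrow> ('a \<Rightarrow> 'a)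
    \<Rightarrow> 'b::{ab_group_add,cscale} set \<Rightarrow> ('b \<Rightarrow> 'b \<Rightarrow> complex)
    \<Rightarrow> 'c::{ab_group_add,cscale} set \<Rightarrow> ('c \<Rightarrow> 'c \<Rightarrow> complex)
    \<Rightarrow> (complex \<Rightarrow> 'b \<Rightarrow> 'c) \<Rightarrow> bool" where
  "char_fun_coincides H ip T K1 ip1 K2 ip2 Theta \<longleftrightarrow>
     (\<exists>v vs. unitary_betw (clos H ip (defect_op H ip T ` H)) ip K1 ip1 v
          \<and> unitary_betw (clos H ip (defect_op_star H ip T ` H)) ip K2 ip2 vs
          \<and> (\<forall>z\<in>ball 0 1. \<forall>x\<in>H.
               vs (defect_op_star H ip T (resolv H ip T z (cscale z x - T x)))
                 = Theta z (v (defect_op H ip T x))))"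

text \<open>Functions on the disc are normalised to vanish off the disc.\<close>
definition dres :: "(complex \<Rightarrow> 'a::zero) \<Rightarrow> complex \<Rightarrow> 'a" where
  "dres f = (\<lambda>w. if w \<in> ball 0 1 then f w else 0)"

definition tcoef :: "(complex \<Rightarrow> complex) \<Rightarrow> nat \<Rightarrow> complex" where
  "tcoef f k = (deriv ^^ k) f 0 / of_nat (fact k)"

text \<open>Since (1 - z conj w)^(-lambda) = sum (lambda)_k/k! z^k conj(w)^k, the RKHS has orthogonal
  basis z^k with squared norms k!/(lambda)_k.\<close>
definition Hs :: "real \<Rightarrow> (complex \<Rightarrow> complex) set" where
  "Hs lam = {f. f holomorphic_on ball 0 1 \<and> (\<forall>w. w \<notin> ball 0 1 \<longrightarrow> f w = 0)
      \<and> summable (\<lambda>k. (cmod (tcoef f k))\<^sup>2 * fact k / pochhammer lam k)}"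

definition Hip :: "real \<Rightarrow> (complex \<Rightarrow> complex) \<Rightarrow> (complex \<Rightarrow> complex) \<Rightarrow> complex" where
  "Hip lam f g = (\<Sum>k. tcoef f k * cnj (tcoef g k) * complex_of_real (fact k / pochhammer lam k))"

definition mobius :: "complex \<Rightarrow> complex \<Rightarrow> complex" where
  "mobius z w = (z - w) / (1 - cnj z * w)"

text \<open>(D^+_nu(phi_z) f)(w) = (phi_z'(w))^(nu/2) f(phi_z(w)) (phi_z is an involution), with the
  branch (phi_z'(w))^(nu/2) = e^(i pi nu/2) (1-|z|^2)^(nu/2) (1 - conj z w)^(-nu).\<close>
definition Dplus :: "real \<Rightarrow> complex \<Rightarrow> (complex \<Rightarrow> complex) \<Rightarrow> complex \<Rightarrow> complex" where
  "Dplus nu z f = dres (\<lambda>w. cis (pi * nu / 2) * complex_of_real ((1 - (cmod z)\<^sup>2) powr (nu / 2))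
       * exp (- complex_of_real nu * Ln (1 - cnj z * w)) * f (mobius z w))"

definition dop :: "nat \<Rightarrow> (complex \<Rightarrow> complex) \<Rightarrow> complex \<Rightarrow> complex" where
  "dop r f = dres ((deriv ^^ r) f)"

definition theta1 :: "real \<Rightarrow> complex \<Rightarrow> (complex \<Rightarrow> complex) \<Rightarrow> complex \<Rightarrow> complex" where
  "theta1 nu z g = cscale (complex_of_real (1 / sqrt (nu * (nu - 1))))
     (adjoint (Hs (nu - 1)) (Hip (nu - 1)) (Hs (nu - 1)) (Hip (nu - 1)) (Dplus (nu - 1) z)
       (adjoint (Hs (nu - 1)) (Hip (nu - 1)) (Hs (nu + 1)) (Hip (nu + 1)) (dop 1)
         (Dplus (nu + 1) z g)))"

definition theta_n :: "real \<Rightarrow> nat \<Rightarrow> complex \<Rightarrow> (complex \<Rightarrow> complex) \<Rightarrow> complex \<Rightarrow> complex" where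
  "theta_n lam n z g = cscale (complex_of_real (1 / sqrt (pochhammer (lam - 1) (2 * n))))
     (adjoint (Hs (lam - 1)) (Hip (lam - 1)) (Hs (lam - 1)) (Hip (lam - 1)) (Dplus (lam - 1) z)
       (adjoint (Hs (lam - 1)) (Hip (lam - 1)) (Hs (lam + 2 * real n - 1)) (Hip (lam + 2 * real n - 1)) (dop n)
         (Dplus (lam + 2 * real n - 1) z g)))"

fun theta_prod :: "real \<Rightarrow> nat \<Rightarrow> complex \<Rightarrow> (complex \<Rightarrow> complex) \<Rightarrow> complex \<Rightarrow> complex" where
  "theta_prod lam 0 z = id"
| "theta_prod lam (Suc n) z = theta_prod lam n z \<circ> theta1 (lam + 2 * real n) z"

definition Hn :: "real \<Rightarrow> nat \<Rightarrow> (nat \<Rightarrow> complex \<Rightarrow> complex) set" where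
  "Hn lam n = {f. (\<forall>j<n. f j \<in> Hs (lam + 2 * real j)) \<and> (\<forall>j\<ge>n. f j = (\<lambda>_. 0))}"

text \<open>Gamma^(lambda,mu); values in Hol(D, C^n), C^n encoded as nat \<Rightarrow> complex with entries \<ge> n zero.\<close>
definition Gamma_op :: "real \<Rightarrow> (nat \<Rightarrow> real) \<Rightarrow> nat \<Rightarrow> (nat \<Rightarrow> complex \<Rightarrow> complex) \<Rightarrow> complex \<Rightarrow> nat \<Rightarrow> complex" where
  "Gamma_op lam mu n f = (\<lambda>w l. if l < n \<and> w \<in> ball 0 1 then
      (\<Sum>j\<le>l. complex_of_real (sqrt (mu j) * real (l choose j) / pochhammer (lam + 2 * real j) (l - j))
               * (deriv ^^ (l - j)) (f j) w)
    else 0)"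

definition HV :: "real \<Rightarrow> (nat \<Rightarrow> real) \<Rightarrow> nat \<Rightarrow> (complex \<Rightarrow> nat \<Rightarrow> complex) set" where
  "HV lam mu n = Gamma_op lam mu n ` Hn lam n"

definition Gamma_inv :: "real \<Rightarrow> (nat \<Rightarrow> real) \<Rightarrow> nat \<Rightarrow> (complex \<Rightarrow> nat \<Rightarrow> complex) \<Rightarrow> nat \<Rightarrow> complex \<Rightarrow> complex" where
  "Gamma_inv lam mu n F = (THE f. f \<in> Hn lam n \<and> Gamma_op lam mu n f = F)"

definition ipV :: "real \<Rightarrow> (nat \<Rightarrow> real) \<Rightarrow> nat \<Rightarrow> (complex \<Rightarrow> nat \<Rightarrow> complex) \<Rightarrow> (complex \<Rightarrow> nat \<Rightarrow> complex) \<Rightarrow> complex" where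
  "ipV lam mu n F G = (\<Sum>j<n. Hip (lam + 2 * real j) (Gamma_inv lam mu n F j) (Gamma_inv lam mu n G j))"

definition Mz :: "(complex \<Rightarrow> nat \<Rightarrow> complex) \<Rightarrow> complex \<Rightarrow> nat \<Rightarrow> complex" where
  "Mz F = (\<lambda>w l. w * F w l)"

end

theory Submission
  imports Defs "HOL-Complex_Analysis.Complex_Analysis"
begin

text \<open>Multiplication by the coordinate on a single weighted space is the state operator of an
  explicit unitary colligation, with the neighbouring weights as input and output spaces, inclusions
  and a multiple of \<open>\<partial>\<close> as the remaining blocks, and \<open>theta1\<close> as its transfer function; this last fact
  rests on the failure of \<open>\<partial>\<close> to intertwine the two representations being multiplication by
  \<open>1 / (1 - cnj z w)\<close>. Connecting the colligations of the weights \<open>lam + 2 l\<close>, \<open>l < n\<close>, in series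
  gives a unitary colligation whose transfer function is the product of the factors. Its state operator
  is carried by \<open>Gamma_op\<close>, for the special \<open>mu\<close> of the theorem, to multiplication by the coordinate,
  because of a telescoping sum. In a unitary colligation the defect operators are the moduli of the
  output block and of the adjoint of the input block; when both have dense range, polar decomposition
  identifies the characteristic function with the transfer function. Complete non-unitarity holds
  because a subspace mapped onto itself consists of functions vanishing at \<open>0\<close> to infinite order.\<close>

section \<open>Inner product spaces on carrier sets\<close>

text \<open>The blocks of the one-weight colligation send monomials to multiples of monomials, so
  its unitarity reduces to scalar identities in the degree; the constant sqrt (\<nu> (\<nu>-1)) of
  \<open>theta1\<close> is the one for which they hold. At z = 0 \<open>theta1\<close> is simply the
  feedthrough block. Consecutive weights differ by 2, so the output exponent \<nu>+1 of one stage is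
  the input exponent (\<nu>+2)-1 of the next. For the same reason the adjoint of D^+ in one factor
  cancels the D^+ of its neighbour, and the product collapses to a single adjoint of \<partial>^n.
  An obstacle is that adjoint, square root, resolvent and \<open>Gamma_inv\<close> are definite
  descriptions, which acquire values only through existence and uniqueness. Hence the binomial
  series for sqrt (1 - X), the Neumann series, and Taylor coefficients as coordinates in which
  adjoints can be written down. The transfer function is never expressed by an inverse: it is given
  by a state that solves the feedback equation. Unitarity of D^+ is not visible in Taylor
  coefficients either; it is obtained on reproducing kernels and extended by density.\<close>

class cvec = ab_group_add + cscale +
  assumes cscale_add_right: "cscale a (x + y) = cscale a x + cscale a y"
    and cscale_add_left: "cscale (a + b) x = cscale a x + cscale b x"
    and cscale_cscale: "cscale a (cscale b x) = cscale (a * b) x"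
    and cscale_one: "cscale 1 x = x"
begin

lemma cscale_zero_right [simp]: "cscale a 0 = 0"
  using cscale_add_right[of a 0 0] by simp

lemma cscale_zero_left [simp]: "cscale 0 x = 0"
  using cscale_add_left[of 0 0 x] by simp

lemma cscale_minus_left: "cscale (- a) x = - cscale a x"
  using cscale_add_left[of a "- a" x] by (simp add: eq_neg_iff_add_eq_0 add.commute)

lemma cscale_minus_right: "cscale a (- x) = - cscale a x"
  using cscale_add_right[of a x "- x"] by (simp add: eq_neg_iff_add_eq_0 add.commute)

lemma cscale_diff_right: "cscale a (x - y) = cscale a x - cscale a y"
  using cscale_add_right[of a x "- y"] by (simp add: cscale_minus_right)

lemma cscale_neg_one: "cscale (- 1) x = - x"
  by (simp add: cscale_minus_left cscale_one)

end

instance complex :: cvec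
  by standard (simp_all add: cscale_complex_def algebra_simps)

instance "fun" :: (type, cvec) cvec
  by standard (simp_all add: cscale_fun_def cscale_add_right cscale_add_left cscale_cscale cscale_one fun_eq_iff)

text \<open>No definiteness, so that Cauchy--Schwarz is also available for the form \<open>\<langle>B x, y\<rangle>\<close> of a
  positive operator.\<close>
locale semi_inner =
  fixes H :: "'a::cvec set" and ip :: "'a \<Rightarrow> 'a \<Rightarrow> complex"
  assumes zero_mem: "0 \<in> H"
    and add_mem: "x \<in> H \<Longrightarrow> y \<in> H \<Longrightarrow> x + y \<in> H"
    and scale_mem: "x \<in> H \<Longrightarrow> cscale c x \<in> H"
    and ip_add_left: "x \<in> H \<Longrightarrow> y \<in> H \<Longrightarrow> u \<in> H \<Longrightarrow> ip (x + y) u = ip x u + ip y u"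
    and ip_scale_left: "x \<in> H \<Longrightarrow> y \<in> H \<Longrightarrow> ip (cscale c x) y = c * ip x y"
    and ip_sym: "x \<in> H \<Longrightarrow> y \<in> H \<Longrightarrow> ip y x = cnj (ip x y)"
    and ip_nonneg: "x \<in> H \<Longrightarrow> 0 \<le> Re (ip x x)"
begin

lemma minus_mem: "x \<in> H \<Longrightarrow> - x \<in> H"
  using scale_mem[of x "-1"] by (simp add: cscale_neg_one)

lemma diff_mem: "x \<in> H \<Longrightarrow> y \<in> H \<Longrightarrow> x - y \<in> H"
  using add_mem[of x "- y"] minus_mem by simp

lemma sum_mem: "(\<And>i. i \<in> I \<Longrightarrow> f i \<in> H) \<Longrightarrow> sum f I \<in> H"
  by (induction I rule: infinite_finite_induct) (auto intro: zero_mem add_mem)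

lemma ip_minus_left: "x \<in> H \<Longrightarrow> y \<in> H \<Longrightarrow> ip (- x) y = - ip x y"
  using ip_scale_left[of x y "-1"] by (simp add: cscale_neg_one)

lemma ip_diff_left: "x \<in> H \<Longrightarrow> y \<in> H \<Longrightarrow> u \<in> H \<Longrightarrow> ip (x - y) u = ip x u - ip y u"
  using ip_add_left[of x "- y" u] minus_mem ip_minus_left by simp

lemma ip_add_right: "x \<in> H \<Longrightarrow> y \<in> H \<Longrightarrow> u \<in> H \<Longrightarrow> ip u (x + y) = ip u x + ip u y"
  using ip_sym[of "x + y" u] ip_sym[of x u] ip_sym[of y u] ip_add_left add_mem by simp

lemma ip_scale_right: "x \<in> H \<Longrightarrow> y \<in> H \<Longrightarrow> ip x (cscale c y) = cnj c * ip x y"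
  using ip_sym[of "cscale c y" x] ip_sym[of y x] ip_scale_left scale_mem by simp

lemma ip_minus_right: "x \<in> H \<Longrightarrow> y \<in> H \<Longrightarrow> ip x (- y) = - ip x y"
  using ip_scale_right[of x y "-1"] by (simp add: cscale_neg_one)

lemma ip_diff_right: "x \<in> H \<Longrightarrow> y \<in> H \<Longrightarrow> u \<in> H \<Longrightarrow> ip u (x - y) = ip u x - ip u y"
  using ip_add_right[of x "- y" u] minus_mem ip_minus_right by simp

lemma ip_zero_left [simp]: "x \<in> H \<Longrightarrow> ip 0 x = 0"
  using ip_scale_left[of x x 0] by simp

lemma ip_zero_right [simp]: "x \<in> H \<Longrightarrow> ip x 0 = 0"
  using ip_scale_right[of x x 0] by simp

lemma ip_sum_left: "(\<And>i. i \<in> I \<Longrightarrow> f i \<in> H) \<Longrightarrow> x \<in> H \<Longrightarrow> ip (sum f I) x = (\<Sum>i\<in>I. ip (f i) x)"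
  by (induction I rule: infinite_finite_induct) (auto simp: ip_add_left sum_mem)

lemma ip_self_real: "x \<in> H \<Longrightarrow> ip x x = of_real (Re (ip x x))"
  using ip_sym[of x x] by (simp add: complex_eq_iff)

lemma nrm_nonneg [simp]: "x \<in> H \<Longrightarrow> 0 \<le> nrm ip x"
  by (simp add: nrm_def ip_nonneg)

lemma nrm_sq: "x \<in> H \<Longrightarrow> (nrm ip x)\<^sup>2 = Re (ip x x)"
  by (simp add: nrm_def ip_nonneg)

lemma ip_self: "x \<in> H \<Longrightarrow> ip x x = of_real ((nrm ip x)\<^sup>2)"
  using ip_self_real nrm_sq by simp

lemma nrm_zero [simp]: "nrm ip 0 = 0"
  using ip_zero_left[OF zero_mem] by (simp add: nrm_def)

lemma nrm_scale: "x \<in> H \<Longrightarrow> nrm ip (cscale c x) = cmod c * nrm ip x"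
proof -
  assume x: "x \<in> H"
  have "ip (cscale c x) (cscale c x) = (c * cnj c) * ip x x"
    using x scale_mem[OF x] by (simp add: ip_scale_left ip_scale_right)
  also have "\<dots> = of_real ((cmod c)\<^sup>2 * (nrm ip x)\<^sup>2)"
    using x by (simp add: ip_self complex_norm_square[symmetric])
  finally have "ip (cscale c x) (cscale c x) = of_real ((cmod c)\<^sup>2 * (nrm ip x)\<^sup>2)" .
  then have "Re (ip (cscale c x) (cscale c x)) = (cmod c * nrm ip x)\<^sup>2"
    by (simp add: power_mult_distrib)
  then show ?thesis using x by (simp add: nrm_def[of ip "cscale c x"])
qed

lemma nrm_minus: "x \<in> H \<Longrightarrow> nrm ip (- x) = nrm ip x"
  using nrm_scale[of x "-1"] by (simp add: cscale_neg_one)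

lemma nrm_diff_commute: "x \<in> H \<Longrightarrow> y \<in> H \<Longrightarrow> nrm ip (x - y) = nrm ip (y - x)"
  using nrm_minus[of "y - x"] diff_mem by simp

text \<open>A degenerate \<open>y\<close> with \<open>nrm ip y = 0\<close> is allowed. The test
  vector x + t c y has cross term 2 t |c|^2, leaving a real quadratic in t that is never negative:
  it is read at its minimiser -1/b, or, when b = 0, at a point where an affine function of nonzero
  slope would be negative.\<close>

lemma cauchy_schwarz:
  assumes x: "x \<in> H" and y: "y \<in> H"
  shows "cmod (ip x y) \<le> nrm ip x * nrm ip y"
proof -
  define a where "a = (nrm ip x)\<^sup>2"
  define b where "b = (nrm ip y)\<^sup>2"
  define c where "c = ip x y"
  have pos: "0 \<le> a + 2 * t * (cmod c)\<^sup>2 + t\<^sup>2 * (cmod c)\<^sup>2 * b" for t :: real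
  proof -
    let ?v = "x + cscale (of_real t * c) y"
    have "ip ?v ?v = of_real (a + 2 * t * (cmod c)\<^sup>2 + t\<^sup>2 * (cmod c)\<^sup>2 * b)"
      using x y scale_mem add_mem ip_sym[OF x y] unfolding of_real_mult of_real_add complex_norm_square
      by (simp add: ip_add_left ip_add_right ip_scale_left ip_scale_right ip_self[OF x] ip_self[OF y] a_def b_def c_def
          algebra_simps power2_eq_square)
    then show ?thesis using ip_nonneg[of ?v] x y scale_mem add_mem by simp
  qed
  have ab: "0 \<le> a" "0 \<le> b" by (simp_all add: a_def b_def)
  have "(cmod c)\<^sup>2 \<le> a * b"
  proof (cases "c = 0")
    case True
    then show ?thesis using ab by simp
  next
    case False
    then have c0: "(cmod c)\<^sup>2 > 0" by simp
    show ?thesis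
    proof (cases "b = 0")
      case True
      have "0 \<le> a + 2 * (- (a + 1) / (cmod c)\<^sup>2) * (cmod c)\<^sup>2" using pos[of "- (a + 1) / (cmod c)\<^sup>2"] True by simp
      then have False using c0 ab by simp
      then show ?thesis ..
    next
      case False
      then have b: "b > 0" using ab by simp
      have "0 \<le> a + 2 * (- 1 / b) * (cmod c)\<^sup>2 + (- 1 / b)\<^sup>2 * (cmod c)\<^sup>2 * b" by (rule pos)
      also have "\<dots> = a - (cmod c)\<^sup>2 / b" using b by (simp add: field_simps power2_eq_square)
      finally show ?thesis using b by (simp add: field_simps)
    qed
  qed
  then have "(cmod c)\<^sup>2 \<le> (nrm ip x * nrm ip y)\<^sup>2" by (simp add: a_def b_def power_mult_distrib)
  then show ?thesis using x y by (simp add: c_def abs_le_square_iff[symmetric])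
qed

lemma nrm_triangle:
  assumes x: "x \<in> H" and y: "y \<in> H"
  shows "nrm ip (x + y) \<le> nrm ip x + nrm ip y"
proof -
  have "(nrm ip (x + y))\<^sup>2 = (nrm ip x)\<^sup>2 + (nrm ip y)\<^sup>2 + 2 * Re (ip x y)"
    using x y ip_sym[OF x y] by (simp add: nrm_sq add_mem ip_add_left ip_add_right)
  also have "\<dots> \<le> (nrm ip x)\<^sup>2 + (nrm ip y)\<^sup>2 + 2 * (nrm ip x * nrm ip y)"
    using cauchy_schwarz[OF x y] complex_Re_le_cmod[of "ip x y"] by linarith
  also have "\<dots> = (nrm ip x + nrm ip y)\<^sup>2" by (simp add: power2_sum)
  finally show ?thesis using x y by (simp add: power2_le_iff_abs_le)
qed

lemma nrm_triangle_diff: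
  assumes "x \<in> H" "y \<in> H" "u \<in> H"
  shows "nrm ip (x - u) \<le> nrm ip (x - y) + nrm ip (y - u)"
  using nrm_triangle[of "x - y" "y - u"] assms diff_mem by (simp add: algebra_simps)

lemma nrm_sum_le:
  assumes "\<And>i. i \<in> I \<Longrightarrow> f i \<in> H"
  shows "nrm ip (sum f I) \<le> (\<Sum>i\<in>I. nrm ip (f i))"
  using assms
proof (induction I rule: infinite_finite_induct)
  case (insert i I)
  then show ?case using nrm_triangle[of "f i" "sum f I"] sum_mem[of I f] by simp
qed auto

end

section \<open>Definite forms: convergence, closure and adjoints\<close>

locale inner_space = semi_inner +
  assumes ip_definite: "x \<in> H \<Longrightarrow> ip x x = 0 \<Longrightarrow> x = 0"
begin

lemma nrm_eq_0: "x \<in> H \<Longrightarrow> nrm ip x = 0 \<longleftrightarrow> x = 0"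
  using ip_definite[of x] ip_self[of x] by auto

lemma eq_if_ip_eq:
  assumes "x \<in> H" "y \<in> H" "\<And>u. u \<in> H \<Longrightarrow> ip u x = ip u y"
  shows "x = y"
proof -
  have "ip (x - y) (x - y) = 0"
    using assms diff_mem[of x y] by (simp add: ip_diff_right)
  then show ?thesis using ip_definite[of "x - y"] assms diff_mem by simp
qed

lemma eq_if_ip_eq':
  assumes "x \<in> H" "y \<in> H" "\<And>u. u \<in> H \<Longrightarrow> ip x u = ip y u"
  shows "x = y"
  using assms by (intro eq_if_ip_eq) (simp_all add: ip_sym[of x] ip_sym[of y])

definition converges :: "(nat \<Rightarrow> 'a) \<Rightarrow> 'a \<Rightarrow> bool" where
  "converges X x \<longleftrightarrow> x \<in> H \<and> (\<lambda>n. nrm ip (X n - x)) \<longlonglongrightarrow> 0"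

lemma converges_ip:
  assumes X: "\<And>n. X n \<in> H" and c: "converges X x" and y: "y \<in> H"
  shows "(\<lambda>n. ip (X n) y) \<longlonglongrightarrow> ip x y"
proof -
  have x: "x \<in> H" and l: "(\<lambda>n. nrm ip (X n - x)) \<longlonglongrightarrow> 0" using c by (auto simp: converges_def)
  have "(\<lambda>n. nrm ip (X n - x) * nrm ip y) \<longlonglongrightarrow> 0" using tendsto_mult_right[OF l, of "nrm ip y"] by simp
  then have "(\<lambda>n. ip (X n) y - ip x y) \<longlonglongrightarrow> 0"
    by (rule Lim_null_comparison[rotated]) 
      (use cauchy_schwarz[OF diff_mem[OF X x] y] in \<open>simp add: ip_diff_left X x y\<close>)
  then show ?thesis by (simp add: LIM_zero_iff)
qed

lemma converges_ip2:
  assumes X: "\<And>n. X n \<in> H" "\<And>n. Y n \<in> H" and c: "converges X x" "converges Y y"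
  shows "(\<lambda>n. ip (X n) (Y n)) \<longlonglongrightarrow> ip x y"
proof -
  have xy: "x \<in> H" "y \<in> H" and l: "(\<lambda>n. nrm ip (X n - x)) \<longlonglongrightarrow> 0" "(\<lambda>n. nrm ip (Y n - y)) \<longlonglongrightarrow> 0"
    using c by (auto simp: converges_def)
  have bd: "norm (ip (X n) (Y n) - ip x y)
      \<le> nrm ip (X n - x) * nrm ip (Y n - y) + nrm ip (X n - x) * nrm ip y + nrm ip x * nrm ip (Y n - y)" for n
  proof -
    have "ip (X n) (Y n) - ip x y = ip (X n - x) (Y n - y) + ip (X n - x) y + ip x (Y n - y)"
      using X xy diff_mem by (simp add: ip_diff_left ip_diff_right)
    also have "norm \<dots> \<le> cmod (ip (X n - x) (Y n - y)) + cmod (ip (X n - x) y) + cmod (ip x (Y n - y))"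
      by (intro order_trans[OF norm_triangle_ineq] add_right_mono norm_triangle_ineq)
    also have "\<dots> \<le> nrm ip (X n - x) * nrm ip (Y n - y) + nrm ip (X n - x) * nrm ip y + nrm ip x * nrm ip (Y n - y)"
      using X xy by (intro add_mono cauchy_schwarz diff_mem)
    finally show ?thesis .
  qed
  have "(\<lambda>n. nrm ip (X n - x) * nrm ip (Y n - y) + nrm ip (X n - x) * nrm ip y + nrm ip x * nrm ip (Y n - y))
      \<longlonglongrightarrow> 0 * 0 + 0 * nrm ip y + nrm ip x * 0"
    by (intro tendsto_intros l)
  then have "(\<lambda>n. ip (X n) (Y n) - ip x y) \<longlonglongrightarrow> 0"
    by (intro Lim_null_comparison[OF always_eventually[OF allI[OF bd]]]) simp
  then show ?thesis by (simp add: LIM_zero_iff)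
qed

lemma converges_unique:
  assumes X: "\<And>n. X n \<in> H" and "converges X x" "converges X y"
  shows "x = y"
proof -
  have xy: "x \<in> H" "y \<in> H" using assms by (auto simp: converges_def)
  have "(\<lambda>n. nrm ip (X n - x) + nrm ip (X n - y)) \<longlonglongrightarrow> 0 + 0"
    using assms by (intro tendsto_add) (auto simp: converges_def)
  moreover have "nrm ip (x - y) \<le> nrm ip (X n - x) + nrm ip (X n - y)" for n
    using nrm_triangle_diff[of x "X n" y] nrm_diff_commute[OF X xy(1), of n] xy X by simp
  ultimately have "nrm ip (x - y) \<le> 0"
    by (intro LIMSEQ_le_const) auto
  then show ?thesis using nrm_eq_0[OF diff_mem[OF xy]] nrm_nonneg[OF diff_mem[OF xy]] by simp
qed

lemma converges_add:
  assumes X: "\<And>n. X n \<in> H" "\<And>n. Y n \<in> H" and c: "converges X x" "converges Y y"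
  shows "converges (\<lambda>n. X n + Y n) (x + y)"
proof -
  have xy: "x \<in> H" "y \<in> H" using c by (auto simp: converges_def)
  have "(\<lambda>n. nrm ip (X n - x) + nrm ip (Y n - y)) \<longlonglongrightarrow> 0 + 0"
    using c by (intro tendsto_add) (auto simp: converges_def)
  then have l: "(\<lambda>n. nrm ip (X n - x) + nrm ip (Y n - y)) \<longlonglongrightarrow> 0" by simp
  have "norm (nrm ip (X n + Y n - (x + y))) \<le> nrm ip (X n - x) + nrm ip (Y n - y)" for n
  proof -
    have "X n + Y n - (x + y) = (X n - x) + (Y n - y)" by simp
    then show ?thesis
      using nrm_triangle[of "X n - x" "Y n - y"] nrm_nonneg[of "X n - x + (Y n - y)"] X xy
      by (simp only: diff_mem add_mem real_norm_def abs_of_nonneg)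
  qed
  then have "(\<lambda>n. nrm ip (X n + Y n - (x + y))) \<longlonglongrightarrow> 0"
    by (intro Lim_null_comparison[OF _ l] always_eventually allI)
  then show ?thesis using xy add_mem by (simp add: converges_def)
qed

lemma converges_scale:
  assumes X: "\<And>n. X n \<in> H" and c: "converges X x"
  shows "converges (\<lambda>n. cscale a (X n)) (cscale a x)"
proof -
  have x: "x \<in> H" and l: "(\<lambda>n. nrm ip (X n - x)) \<longlonglongrightarrow> 0" using c by (auto simp: converges_def)
  have "nrm ip (cscale a (X n) - cscale a x) = cmod a * nrm ip (X n - x)" for n
    using nrm_scale[OF diff_mem[OF X x]] by (simp add: cscale_diff_right)
  then show ?thesis using tendsto_mult_left[OF l, of "cmod a"] x scale_mem by (simp add: converges_def)
qed

lemma converges_bounded_linear: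
  assumes X: "\<And>n. X n \<in> H" and c: "converges X x"
    and K: "inner_space K ipK" and T: "\<And>u. u \<in> H \<Longrightarrow> T u \<in> K" and lin: "linear_on H T"
    and bd: "\<And>u. u \<in> H \<Longrightarrow> nrm ipK (T u) \<le> C * nrm ip u"
  shows "inner_space.converges K ipK (\<lambda>n. T (X n)) (T x)"
proof -
  interpret K: inner_space K ipK by (rule K)
  have x: "x \<in> H" and l: "(\<lambda>n. nrm ip (X n - x)) \<longlonglongrightarrow> 0" using c by (auto simp: converges_def)
  have "T (X n - x) = T (X n) - T x" for n
  proof -
    have "T (X n - x) = T (X n + cscale (- 1) x)" by (simp add: cscale_neg_one)
    also have "\<dots> = T (X n) + cscale (- 1) (T x)" using lin X x scale_mem unfolding linear_on_def by simp
    finally show ?thesis by (simp add: cscale_neg_one)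
  qed
  then have "norm (nrm ipK (T (X n) - T x)) \<le> C * nrm ip (X n - x)" for n
    using bd[OF diff_mem[OF X x]] K.nrm_nonneg[OF K.diff_mem[OF T[OF X] T[OF x]]] by simp
  then have "(\<lambda>n. nrm ipK (T (X n) - T x)) \<longlonglongrightarrow> 0"
    by (intro Lim_null_comparison[OF _ tendsto_mult_right_zero[OF l, of C]] always_eventually allI)
  then show ?thesis using T x by (simp add: K.converges_def)
qed

lemma clos_iff: "S \<subseteq> H \<Longrightarrow> x \<in> clos H ip S \<longleftrightarrow> (\<exists>X. (\<forall>n. X n \<in> S) \<and> converges X x)"
proof
  assume S: "S \<subseteq> H" and "x \<in> clos H ip S"
  then have x: "x \<in> H" and *: "\<And>e. e > 0 \<Longrightarrow> \<exists>y\<in>S. nrm ip (x - y) < e" by (auto simp: clos_def)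
  have "\<exists>y\<in>S. nrm ip (x - y) < 1 / real (Suc n)" for n using * by simp
  then obtain X where X: "\<And>n. X n \<in> S" "\<And>n. nrm ip (x - X n) < 1 / real (Suc n)" by metis
  have "norm (nrm ip (X n - x)) \<le> 1 / real (Suc n)" for n
    using X[of n] S x nrm_diff_commute[of x "X n"] diff_mem[of "X n" x] by (auto simp: subset_iff less_imp_le)
  then have "(\<lambda>n. nrm ip (X n - x)) \<longlonglongrightarrow> 0"
    by (intro Lim_null_comparison[OF _ LIMSEQ_inverse_real_of_nat]) (auto simp: field_simps)
  then show "\<exists>X. (\<forall>n. X n \<in> S) \<and> converges X x" using X x by (auto simp: converges_def)
next
  assume S: "S \<subseteq> H" and "\<exists>X. (\<forall>n. X n \<in> S) \<and> converges X x"
  then obtain X where X: "\<And>n. X n \<in> S" and x: "x \<in> H" and l: "(\<lambda>n. nrm ip (X n - x)) \<longlonglongrightarrow> 0"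
    by (auto simp: converges_def)
  show "x \<in> clos H ip S"
    unfolding clos_def
  proof (intro CollectI conjI allI impI)
    fix e :: real assume "e > 0"
    then obtain n where "norm (nrm ip (X n - x) - 0) < e" using LIMSEQ_D[OF l] by blast
    then have "nrm ip (x - X n) < e" using nrm_diff_commute[of x "X n"] x X[of n] S by (simp add: subset_iff)
    then show "\<exists>y\<in>S. nrm ip (x - y) < e" using X by blast
  qed (rule x)
qed

lemma adjoint_eqI:
  assumes "x \<in> H" "\<And>u. u \<in> H \<Longrightarrow> ip2 (T u) y = ip u x"
  shows "adjoint H ip K ip2 T y = x"
  unfolding adjoint_def using assms by (intro the_equality) (auto intro: eq_if_ip_eq)

end

locale hilbert = inner_space +
  assumes complete: "\<And>X. (\<And>n. X n \<in> H) \<Longrightarrow>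
      (\<And>e. e > 0 \<Longrightarrow> \<exists>N. \<forall>m\<ge>N. \<forall>n\<ge>N. nrm ip (X m - X n) < e) \<Longrightarrow> \<exists>x. converges X x"
begin

lemma abs_summable_converges:
  assumes f: "\<And>k. f k \<in> H" and s: "summable g" and b: "\<And>k. nrm ip (f k) \<le> g k"
  shows "\<exists>x. converges (\<lambda>n. \<Sum>k<n. f k) x"
proof (rule complete)
  show "(\<Sum>k<n. f k) \<in> H" for n using f by (rule sum_mem)
  have g0: "0 \<le> g k" for k using b[of k] f[of k] nrm_nonneg[of "f k"] by linarith
  fix e :: real assume "e > 0"
  then obtain N where N: "\<And>m n. m \<ge> N \<Longrightarrow> norm (sum g {m..<n}) < e"
    using s unfolding summable_Cauchy by blast
  have *: "nrm ip ((\<Sum>k<n. f k) - (\<Sum>k<m. f k)) < e" if "m \<ge> N" "m \<le> n" for m n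
  proof -
    have "(\<Sum>k<n. f k) - (\<Sum>k<m. f k) = (\<Sum>k\<in>{m..<n}. f k)"
      using that sum_diff_nat_ivl[of 0 m n f] by (simp add: atLeast0LessThan)
    also have "nrm ip \<dots> \<le> (\<Sum>k\<in>{m..<n}. nrm ip (f k))" using f by (intro nrm_sum_le)
    also have "\<dots> \<le> sum g {m..<n}" by (intro sum_mono b)
    also have "\<dots> < e" using N[of m n] that by simp
    finally show ?thesis .
  qed
  show "\<exists>N. \<forall>m\<ge>N. \<forall>n\<ge>N. nrm ip ((\<Sum>k<m. f k) - (\<Sum>k<n. f k)) < e"
  proof (intro exI[of _ N] allI impI)
    fix m n assume "N \<le> m" "N \<le> n"
    then show "nrm ip ((\<Sum>k<m. f k) - (\<Sum>k<n. f k)) < e"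
      using *[of m n] *[of n m] nrm_diff_commute[OF sum_mem[of "{..<m}" f, OF f] sum_mem[of "{..<n}" f, OF f]]
      by (cases "m \<le> n") auto
  qed
qed

end

section \<open>Linear maps and Neumann series\<close>

lemma linear_on_add: "linear_on H T \<Longrightarrow> x \<in> H \<Longrightarrow> y \<in> H \<Longrightarrow> T (x + y) = T x + T y"
  and linear_on_scale: "linear_on H T \<Longrightarrow> x \<in> H \<Longrightarrow> T (cscale c x) = cscale c (T x)"
  by (simp_all add: linear_on_def)

context semi_inner
begin

lemma linear_on_zero:
  fixes T :: "'a \<Rightarrow> 'b::cvec"
  shows "linear_on H T \<Longrightarrow> T 0 = 0"
  using linear_on_scale[of H T 0 0] zero_mem by simp

lemma linear_on_diff:
  fixes T :: "'a \<Rightarrow> 'b::cvec"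
  assumes "linear_on H T" "x \<in> H" "y \<in> H"
  shows "T (x - y) = T x - T y"
proof -
  have "T (x + cscale (-1) y) = T x + cscale (-1) (T y)"
    using assms scale_mem[of y "-1"] by (simp only: linear_on_add linear_on_scale)
  then show ?thesis by (simp add: cscale_neg_one)
qed

lemma linear_on_sum:
  fixes T :: "'a \<Rightarrow> 'b::cvec"
  assumes "linear_on H T" "\<And>i. i \<in> I \<Longrightarrow> f i \<in> H"
  shows "T (sum f I) = (\<Sum>i\<in>I. T (f i))"
  using assms(2)
  by (induction I rule: infinite_finite_induct)
    (simp_all add: linear_on_zero[OF assms(1)] linear_on_add[OF assms(1)] sum_mem)

end

text \<open>A difference of two solutions satisfies d = z T d with |z| < 1. This is the uniqueness
  demanded by the definite description in \<open>resolv\<close>.\<close>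

lemma (in inner_space) contraction_fixed_unique:
  assumes T: "\<And>x. x \<in> H \<Longrightarrow> T x \<in> H" and lin: "linear_on H T"
    and c: "\<And>x. x \<in> H \<Longrightarrow> nrm ip (T x) \<le> nrm ip x" and z: "cmod z < 1"
    and xy: "x \<in> H" "y \<in> H" "x - cscale z (T x) = y - cscale z (T y)"
  shows "x = y"
proof -
  have d: "x - y \<in> H" using xy diff_mem by simp
  have "x - y = cscale z (T (x - y))"
    unfolding linear_on_diff[OF lin xy(1,2)] cscale_diff_right using xy(3) by (simp add: algebra_simps)
  then have "nrm ip (x - y) = cmod z * nrm ip (T (x - y))"
    using nrm_scale[OF T[OF d], of z] by simp
  also have "\<dots> \<le> cmod z * nrm ip (x - y)" using c[OF d] by (simp add: mult_left_mono)
  finally have "(1 - cmod z) * nrm ip (x - y) \<le> 0" by (simp add: algebra_simps)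
  then have "nrm ip (x - y) = 0" using z nrm_nonneg[OF d] by (simp add: mult_le_0_iff)
  then show ?thesis using nrm_eq_0[OF d] by simp
qed

text \<open>Used with two operators: the adjoint shift produces the state of the feedback equation,
  and the shift itself shows that f / (1 - cnj z w) lies in the space. The terms z^k T^k y decay
  geometrically, and the recursion for the partial sums passes to the limit because T is
  continuous.\<close>

lemma (in hilbert) neumann:
  assumes T: "\<And>x. x \<in> H \<Longrightarrow> T x \<in> H" and lin: "linear_on H T"
    and c: "\<And>x. x \<in> H \<Longrightarrow> nrm ip (T x) \<le> nrm ip x" and z: "cmod z < 1" and y: "y \<in> H"
  shows "\<exists>x\<in>H. x - cscale z (T x) = y"
proof -
  define f where "f k = cscale (z ^ k) ((T ^^ k) y)" for k
  have Tk: "(T ^^ k) y \<in> H" "nrm ip ((T ^^ k) y) \<le> nrm ip y" for k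
    by (induction k) (use T c y in \<open>auto intro: order_trans\<close>)
  have f: "f k \<in> H" for k using Tk scale_mem by (simp add: f_def)
  have nf: "nrm ip (f k) \<le> cmod z ^ k * nrm ip y" for k
    unfolding f_def using Tk[of k] by (simp add: nrm_scale norm_power mult_left_mono)
  have "summable (\<lambda>k. cmod z ^ k * nrm ip y)" using z by (intro summable_mult2 summable_geometric) simp
  from abs_summable_converges[OF f this nf] obtain x where x: "converges (\<lambda>n. \<Sum>k<n. f k) x" by auto
  then have xH: "x \<in> H" by (simp add: converges_def)
  have sH: "(\<Sum>k<n. f k) \<in> H" for n using f by (rule sum_mem)
  have step: "(\<Sum>k<Suc n. f k) = y + cscale z (T (\<Sum>k<n. f k))" for n
  proof -
    have fS: "f (Suc k) = cscale z (T (f k))" for k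
      using Tk by (simp add: f_def linear_on_scale[OF lin] cscale_cscale)
    have "(\<Sum>k<Suc n. f k) = f 0 + (\<Sum>k<n. cscale z (T (f k)))"
      unfolding fS[symmetric] by (rule sum.lessThan_Suc_shift)
    also have "(\<Sum>k<n. cscale z (T (f k))) = cscale z (T (\<Sum>k<n. f k))"
      using f by (simp add: linear_on_sum[OF lin]) (induction n, simp_all add: cscale_add_right)
    finally show ?thesis by (simp add: f_def cscale_one)
  qed
  have i: "inner_space H ip" by unfold_locales
  have "converges (\<lambda>n. T (\<Sum>k<n. f k)) (T x)"
    by (rule converges_bounded_linear[OF sH x i T lin, of 1]) (use c in auto)
  then have "converges (\<lambda>n. cscale z (T (\<Sum>k<n. f k))) (cscale z (T x))"
    using sH T by (intro converges_scale) auto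
  then have "converges (\<lambda>n. y + cscale z (T (\<Sum>k<n. f k))) (y + cscale z (T x))"
    using sH T y scale_mem by (intro converges_add) (auto simp: converges_def)
  then have "converges (\<lambda>n. \<Sum>k<Suc n. f k) (y + cscale z (T x))" by (simp only: step)
  moreover have "converges (\<lambda>n. \<Sum>k<Suc n. f k) x"
    using x unfolding converges_def by (auto intro: LIMSEQ_Suc simp del: sum.lessThan_Suc)
  ultimately have "x = y + cscale z (T x)" by (intro converges_unique[OF sH])
  then show ?thesis using xH by (intro bexI[of _ x]) (auto simp: algebra_simps)
qed

text \<open>Taylor coefficients of \<open>sqrt (1 - t)\<close> at \<open>0\<close>.\<close>
definition sqrt_coef :: "nat \<Rightarrow> real" where
  "sqrt_coef k = pochhammer (- (1 / 2)) k / fact k"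

lemma sqrt_coef_0 [simp]: "sqrt_coef 0 = 1"
  by (simp add: sqrt_coef_def)

lemma pochhammer_half_nonneg: "0 \<le> pochhammer (1 / 2 :: real) n"
  by (intro pochhammer_nonneg) simp

lemma pochhammer_minus_half: "pochhammer (- (1 / 2) :: real) (Suc n) = - pochhammer (1 / 2) n / 2"
  using pochhammer_rec[of "- (1 / 2) :: real" n] by simp

lemma sqrt_coef_nonpos: "k \<noteq> 0 \<Longrightarrow> sqrt_coef k \<le> 0"
  using pochhammer_half_nonneg by (cases k) (auto simp: sqrt_coef_def pochhammer_minus_half divide_simps)

text \<open>The partial sums are the coefficients of sqrt (1 - t) / (1 - t) = (1 - t)^(-1/2), which
  are nonnegative. Both absolute summability at t = 1 and positivity of the operator square root
  rest on this.\<close>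

lemma sum_sqrt_coef: "(\<Sum>k\<le>n. sqrt_coef k) = pochhammer (1 / 2) n / fact n"
proof (induction n)
  case (Suc n)
  have "(\<Sum>k\<le>Suc n. sqrt_coef k) = pochhammer (1 / 2) n / fact n - pochhammer (1 / 2) n / 2 / fact (Suc n)"
    using Suc by (simp add: sqrt_coef_def pochhammer_minus_half)
  also have "\<dots> = pochhammer (1 / 2) (Suc n) / fact (Suc n)"
    by (simp add: pochhammer_Suc divide_simps) (simp add: algebra_simps)
  finally show ?case .
qed simp

lemma sum_sqrt_coef_nonneg: "0 \<le> (\<Sum>k<n. sqrt_coef k)"
proof (cases n)
  case (Suc m)
  then show ?thesis using sum_sqrt_coef[of m] pochhammer_half_nonneg[of m]
    by (simp add: lessThan_Suc_atMost)
qed simp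

text \<open>Only the first coefficient is positive, so a sum of moduli equals 2 minus a partial
  sum.\<close>

lemma summable_sqrt_coef: "summable (\<lambda>k. \<bar>sqrt_coef k\<bar>)"
proof (rule summableI_nonneg_bounded)
  fix n
  show "(\<Sum>k<n. \<bar>sqrt_coef k\<bar>) \<le> 2"
  proof (cases n)
    case (Suc m)
    have "(\<Sum>k<n. \<bar>sqrt_coef k\<bar>) = 1 + (\<Sum>k<m. \<bar>sqrt_coef (Suc k)\<bar>)"
      by (simp add: Suc sum.lessThan_Suc_shift del: sum.lessThan_Suc)
    also have "(\<Sum>k<m. \<bar>sqrt_coef (Suc k)\<bar>) = - (\<Sum>k<m. sqrt_coef (Suc k))"
      using sqrt_coef_nonpos by (simp add: abs_of_nonpos sum_negf)
    also have "\<dots> = 1 - (\<Sum>k<n. sqrt_coef k)"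
      by (simp add: Suc sum.lessThan_Suc_shift del: sum.lessThan_Suc)
    finally show ?thesis using sum_sqrt_coef_nonneg[of n] by simp
  qed simp
qed simp

lemma sqrt_coef_gchoose: "sqrt_coef k = (- 1) ^ k * ((1 / 2) gchoose k)"
  by (simp add: gbinomial_pochhammer sqrt_coef_def flip: power_mult_distrib)

text \<open>The series squares to 1 - t, by Vandermonde's identity with 1/2 + 1/2 = 1.\<close>

lemma sqrt_coef_convolution:
  "(\<Sum>i\<le>k. sqrt_coef i * sqrt_coef (k - i)) = (if k = 0 then 1 else if k = 1 then - 1 else 0)"
proof -
  have "(\<Sum>i\<le>k. sqrt_coef i * sqrt_coef (k - i))
      = (\<Sum>i\<le>k. (- 1) ^ k * (((1 / 2) gchoose i) * ((1 / 2) gchoose (k - i))))"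
  proof (rule sum.cong)
    fix i assume "i \<in> {..k}"
    then have "(- 1 :: real) ^ k = (- 1) ^ i * (- 1) ^ (k - i)" by (simp flip: power_add)
    then show "sqrt_coef i * sqrt_coef (k - i)
        = (- 1) ^ k * (((1 / 2) gchoose i) * ((1 / 2) gchoose (k - i)))" by (simp add: sqrt_coef_gchoose)
  qed simp
  also have "\<dots> = (- 1) ^ k * ((1 :: real) gchoose k)"
    using gbinomial_Vandermonde[of "1 / 2 :: real" "1 / 2" k]
    by (simp add: atMost_atLeast0 flip: sum_distrib_left)
  also have "(1 :: real) gchoose k = of_nat (1 choose k)" using binomial_gbinomial[of 1 k, where 'a = real] by simp
  finally show ?thesis by (auto simp: binomial_eq_0)
qed

lemma summable_bounded_mult:
  fixes b :: "nat \<Rightarrow> real" and m :: "nat \<Rightarrow> complex"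
  assumes "summable (\<lambda>k. \<bar>b k\<bar>)" "\<And>k. cmod (m k) \<le> C"
  shows "summable (\<lambda>k. norm (of_real (b k) * m k))"
proof (rule summable_comparison_test')
  show "summable (\<lambda>k. \<bar>b k\<bar> * C)" using assms(1) by (rule summable_mult2)
  show "norm (norm (of_real (b k) * m k)) \<le> \<bar>b k\<bar> * C" if "k \<ge> 0" for k
    using assms(2)[of k] by (simp add: norm_mult mult_left_mono)
qed

lemma infsum_eq_suminf:
  fixes f :: "nat \<Rightarrow> 'a::banach"
  shows "f summable_on UNIV \<Longrightarrow> infsum f UNIV = suminf f"
  by (intro sums_unique has_sum_imp_sums has_sum_infsum)

text \<open>Squaring the operator series produces moments \<open>m (i + j)\<close>, which do not
  split into a factor in i and a factor in j; this replaces the usual Cauchy product. Boundedness of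
  \<open>m\<close> makes the double sum absolutely convergent, and it is regrouped along i + j =
  k.\<close>

lemma hankel_cauchy_product:
  fixes b :: "nat \<Rightarrow> real" and m :: "nat \<Rightarrow> complex"
  assumes b: "summable (\<lambda>k. \<bar>b k\<bar>)" and m: "\<And>k. cmod (m k) \<le> C"
  shows "(\<Sum>i. of_real (b i) * (\<Sum>j. of_real (b j) * m (i + j)))
       = (\<Sum>k. of_real (\<Sum>i\<le>k. b i * b (k - i)) * m k)"
proof -
  define f where "f = (\<lambda>i j. of_real (b i) * (of_real (b j) * m (i + j)))"
  have C: "0 \<le> C" using order_trans[OF norm_ge_zero m] by blast
  have bs: "(\<lambda>k. \<bar>b k\<bar>) summable_on UNIV" using b by (simp add: summable_on_UNIV_nonneg_real_iff)
  have bsum: "((\<lambda>j. \<bar>b j\<bar>) has_sum (\<Sum>\<^sub>\<infinity>j. \<bar>b j\<bar>)) UNIV" using bs by simp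
  have "(\<lambda>p. case p of (i, j) \<Rightarrow> C * \<bar>b i\<bar> * \<bar>b j\<bar>) summable_on UNIV \<times> UNIV"
  proof (rule summable_on_SigmaI)
    show "((\<lambda>j. case (i, j) of (i, j) \<Rightarrow> C * \<bar>b i\<bar> * \<bar>b j\<bar>) has_sum C * \<bar>b i\<bar> * (\<Sum>\<^sub>\<infinity>j. \<bar>b j\<bar>)) UNIV" for i
      using has_sum_cmult_right[OF bsum, of "C * \<bar>b i\<bar>"] by simp
    show "(\<lambda>i. C * \<bar>b i\<bar> * (\<Sum>\<^sub>\<infinity>j. \<bar>b j\<bar>)) summable_on UNIV"
      by (intro summable_on_cmult_left summable_on_cmult_right bs)
  qed (use C in auto)
  then have "(\<lambda>p. norm (case p of (i, j) \<Rightarrow> C * \<bar>b i\<bar> * \<bar>b j\<bar>)) summable_on UNIV \<times> UNIV"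
    by (rule summable_on_iff_abs_summable_on_real[THEN iffD1])
  then have "(\<lambda>p. norm (case p of (i, j) \<Rightarrow> f i j)) summable_on UNIV \<times> UNIV"
  proof (rule Infinite_Sum.abs_summable_on_comparison_test)
    fix p :: "nat \<times> nat"
    obtain i j where p: "p = (i, j)" by (cases p)
    have "\<bar>b i\<bar> * (\<bar>b j\<bar> * cmod (m (i + j))) \<le> \<bar>b i\<bar> * (\<bar>b j\<bar> * C)"
      by (intro mult_left_mono m) auto
    then show "norm (case p of (i, j) \<Rightarrow> f i j) \<le> norm (case p of (i, j) \<Rightarrow> C * \<bar>b i\<bar> * \<bar>b j\<bar>)"
      using C by (simp add: p f_def norm_mult abs_mult mult_ac)
  qed
  then have fs: "(\<lambda>(i, j). f i j) summable_on UNIV \<times> UNIV" by (rule abs_summable_summable)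
  have inner: "(\<Sum>j. of_real (b j) * m (i + j)) = (\<Sum>\<^sub>\<infinity>j. of_real (b j) * m (i + j))" for i
    by (intro infsum_eq_suminf[symmetric] norm_summable_imp_summable_on summable_bounded_mult[OF b, of _ C] m)
  have "(\<Sum>i. of_real (b i) * (\<Sum>j. of_real (b j) * m (i + j))) = (\<Sum>i. \<Sum>\<^sub>\<infinity>j. f i j)"
    unfolding inner f_def by (simp add: infsum_cmult_right')
  also have "\<dots> = (\<Sum>\<^sub>\<infinity>i. \<Sum>\<^sub>\<infinity>j. f i j)"
    using summable_on_Sigma_banach[OF fs] by (rule infsum_eq_suminf[symmetric])
  also have "\<dots> = infsum (\<lambda>(i, j). f i j) (UNIV \<times> UNIV)" using fs by (rule infsum_Sigma'_banach)
  also have "\<dots> = infsum (\<lambda>(k, i). f i (k - i)) (Sigma UNIV (\<lambda>k. {..k}))"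
    by (rule infsum_reindex_bij_witness[of _ "\<lambda>(k, i). (i, k - i)" "\<lambda>(i, j). (i + j, i)"]) auto
  also have "\<dots> = (\<Sum>\<^sub>\<infinity>k. \<Sum>\<^sub>\<infinity>i\<in>{..k}. f i (k - i))"
  proof (rule infsum_Sigma'_banach[symmetric])
    show "(\<lambda>(k, i). f i (k - i)) summable_on (SIGMA k:UNIV. {..k})"
      by (rule summable_on_reindex_bij_witness[of _ "\<lambda>(i, j). (i + j, i)" "\<lambda>(k, i). (i, k - i)" , THEN iffD2, OF _ _ _ _ _ fs]) auto
  qed
  also have "\<dots> = (\<Sum>\<^sub>\<infinity>k. of_real (\<Sum>i\<le>k. b i * b (k - i)) * m k)"
    by (intro infsum_cong) (simp add: f_def sum_distrib_right mult.assoc)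
  also have "\<dots> = (\<Sum>k. of_real (\<Sum>i\<le>k. b i * b (k - i)) * m k)"
  proof (rule infsum_eq_suminf, rule norm_summable_imp_summable_on, rule summable_bounded_mult[OF _ m])
    have "summable (\<lambda>k. \<Sum>i\<le>k. \<bar>b i\<bar> * \<bar>b (k - i)\<bar>)"
      using b by (intro summable_Cauchy_product) auto
    then show "summable (\<lambda>k. \<bar>\<Sum>i\<le>k. b i * b (k - i)\<bar>)"
      by (rule summable_comparison_test'[where N = 0]) (simp add: sum_abs flip: abs_mult)
  qed
  finally show ?thesis .
qed

section \<open>Square roots of positive contractions\<close>

locale symmetric_contraction = hilbert +
  fixes X
  assumes X_mem: "x \<in> H \<Longrightarrow> X x \<in> H"
    and X_linear: "linear_on H X"
    and X_sym: "x \<in> H \<Longrightarrow> y \<in> H \<Longrightarrow> ip (X x) y = ip x (X y)"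
    and X_contr: "x \<in> H \<Longrightarrow> nrm ip (X x) \<le> nrm ip x"
begin

lemma X_pow_mem: "x \<in> H \<Longrightarrow> (X ^^ k) x \<in> H"
  by (induction k) (simp_all add: X_mem)

lemma X_pow_contr: "x \<in> H \<Longrightarrow> nrm ip ((X ^^ k) x) \<le> nrm ip x"
  by (induction k) (auto intro: order_trans[OF X_contr] X_pow_mem)

lemma X_pow_sym: "x \<in> H \<Longrightarrow> y \<in> H \<Longrightarrow> ip ((X ^^ k) x) y = ip x ((X ^^ k) y)"
  by (induction k arbitrary: y) (simp_all add: X_sym X_pow_mem X_mem, simp add: funpow_swap1)

lemma X_pow_add: "x \<in> H \<Longrightarrow> y \<in> H \<Longrightarrow> (X ^^ k) (x + y) = (X ^^ k) x + (X ^^ k) y"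
  by (induction k) (simp_all add: linear_on_add[OF X_linear] X_pow_mem)

lemma X_pow_scale: "x \<in> H \<Longrightarrow> (X ^^ k) (cscale c x) = cscale c ((X ^^ k) x)"
  by (induction k) (simp_all add: linear_on_scale[OF X_linear] X_pow_mem)

lemma X_pow_ip_bound: "x \<in> H \<Longrightarrow> y \<in> H \<Longrightarrow> cmod (ip ((X ^^ k) x) y) \<le> nrm ip x * nrm ip y"
  using cauchy_schwarz[OF X_pow_mem, of x y k] X_pow_contr[of x k] nrm_nonneg[of y]
  by (meson mult_right_mono order_trans)

text \<open>The binomial series of sqrt (1 - X), which converges in norm even if \<open>X\<close>
  has norm 1. The value 0 off \<open>H\<close> is the normalisation built into
  \<open>psqrt\<close>.\<close>

definition sqrt_op :: "'a \<Rightarrow> 'a" where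
  "sqrt_op x = (if x \<in> H then SOME s. converges (\<lambda>n. \<Sum>k<n. cscale (of_real (sqrt_coef k)) ((X ^^ k) x)) s else 0)"

lemma sqrt_op_converges:
  assumes x: "x \<in> H"
  shows "converges (\<lambda>n. \<Sum>k<n. cscale (of_real (sqrt_coef k)) ((X ^^ k) x)) (sqrt_op x)"
proof -
  have "\<exists>s. converges (\<lambda>n. \<Sum>k<n. cscale (of_real (sqrt_coef k)) ((X ^^ k) x)) s"
  proof (rule abs_summable_converges)
    show "summable (\<lambda>k. \<bar>sqrt_coef k\<bar> * nrm ip x)" by (intro summable_mult2 summable_sqrt_coef)
  qed (simp_all add: x X_pow_mem scale_mem nrm_scale X_pow_contr mult_left_mono)
  then show ?thesis using x by (simp add: sqrt_op_def someI_ex)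
qed

lemma sqrt_op_mem: "sqrt_op x \<in> H"
  using sqrt_op_converges[of x] zero_mem by (cases "x \<in> H") (auto simp: converges_def sqrt_op_def)

lemma sqrt_op_ip:
  assumes x: "x \<in> H" and y: "y \<in> H"
  shows "(\<lambda>k. of_real (sqrt_coef k) * ip ((X ^^ k) x) y) sums ip (sqrt_op x) y"
proof -
  have "(\<lambda>n. ip (\<Sum>k<n. cscale (of_real (sqrt_coef k)) ((X ^^ k) x)) y) \<longlonglongrightarrow> ip (sqrt_op x) y"
    by (intro converges_ip[OF _ sqrt_op_converges[OF x] y] sum_mem scale_mem X_pow_mem x)
  then show ?thesis
    using x y by (simp add: sums_def ip_sum_left scale_mem X_pow_mem ip_scale_left)
qed

lemma sqrt_op_sym:
  assumes x: "x \<in> H" and y: "y \<in> H"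
  shows "ip (sqrt_op x) y = ip x (sqrt_op y)"
proof -
  have "(\<lambda>k. cnj (of_real (sqrt_coef k) * ip ((X ^^ k) y) x)) sums cnj (ip (sqrt_op y) x)"
    using sqrt_op_ip[OF y x] unfolding sums_cnj .
  moreover have "cnj (ip ((X ^^ k) y) x) = ip ((X ^^ k) x) y" for k
    using ip_sym[OF X_pow_mem[OF y, of k] x] x y by (simp add: X_pow_sym)
  ultimately have "(\<lambda>k. of_real (sqrt_coef k) * ip ((X ^^ k) x) y) sums ip x (sqrt_op y)"
    using ip_sym[OF sqrt_op_mem x, of y] by simp
  then show ?thesis using sqrt_op_ip[OF x y] by (rule sums_unique2[symmetric])
qed

lemma sqrt_op_linear: "linear_on H sqrt_op"
  unfolding linear_on_def
proof (intro conjI ballI allI)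
  fix x y assume xy: "x \<in> H" "y \<in> H"
  show "sqrt_op (x + y) = sqrt_op x + sqrt_op y"
  proof (rule eq_if_ip_eq')
    fix u assume u: "u \<in> H"
    have "(\<lambda>k. of_real (sqrt_coef k) * ip ((X ^^ k) x) u + of_real (sqrt_coef k) * ip ((X ^^ k) y) u)
        sums (ip (sqrt_op x) u + ip (sqrt_op y) u)"
      by (intro sums_add sqrt_op_ip xy u)
    then have "(\<lambda>k. of_real (sqrt_coef k) * ip ((X ^^ k) (x + y)) u) sums ip (sqrt_op x + sqrt_op y) u"
      using xy u by (simp add: X_pow_add ip_add_left X_pow_mem sqrt_op_mem distrib_left)
    then show "ip (sqrt_op (x + y)) u = ip (sqrt_op x + sqrt_op y) u"
      using sqrt_op_ip[OF add_mem[OF xy] u] by (rule sums_unique2[symmetric])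
  qed (simp_all add: sqrt_op_mem add_mem)
next
  fix x c assume x: "x \<in> H"
  show "sqrt_op (cscale c x) = cscale c (sqrt_op x)"
  proof (rule eq_if_ip_eq')
    fix u assume u: "u \<in> H"
    have "(\<lambda>k. c * (of_real (sqrt_coef k) * ip ((X ^^ k) x) u)) sums (c * ip (sqrt_op x) u)"
      by (intro sums_mult sqrt_op_ip x u)
    then have "(\<lambda>k. of_real (sqrt_coef k) * ip ((X ^^ k) (cscale c x)) u) sums ip (cscale c (sqrt_op x)) u"
      using x u by (simp add: X_pow_scale ip_scale_left X_pow_mem sqrt_op_mem mult_ac)
    then show "ip (sqrt_op (cscale c x)) u = ip (cscale c (sqrt_op x)) u"
      using sqrt_op_ip[OF scale_mem[OF x] u] by (rule sums_unique2[symmetric])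
  qed (simp_all add: sqrt_op_mem scale_mem)
qed

text \<open>For k > 0 the coefficient is nonpositive while <X^k x, x> is at most <x, x>, so every
  partial sum dominates the sum of the coefficients times <x, x>.\<close>

lemma sqrt_op_nonneg:
  assumes x: "x \<in> H"
  shows "0 \<le> Re (ip (sqrt_op x) x)"
proof -
  have "(\<lambda>k. sqrt_coef k * Re (ip ((X ^^ k) x) x)) sums Re (ip (sqrt_op x) x)"
    using sums_Re[OF sqrt_op_ip[OF x x]] by simp
  then have lim: "(\<lambda>n. \<Sum>k<n. sqrt_coef k * Re (ip ((X ^^ k) x) x)) \<longlonglongrightarrow> Re (ip (sqrt_op x) x)"
    by (simp add: sums_def)
  have le: "sqrt_coef k * Re (ip x x) \<le> sqrt_coef k * Re (ip ((X ^^ k) x) x)" for k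
  proof (cases "k = 0")
    case False
    have "Re (ip ((X ^^ k) x) x) \<le> Re (ip x x)"
      using X_pow_ip_bound[OF x x, of k] complex_Re_le_cmod[of "ip ((X ^^ k) x) x"] nrm_sq[OF x]
      by (simp add: power2_eq_square)
    then show ?thesis using sqrt_coef_nonpos[OF False] by (rule mult_left_mono_neg)
  qed simp
  have "0 \<le> (\<Sum>k<n. sqrt_coef k * Re (ip ((X ^^ k) x) x))" for n
  proof -
    have "0 \<le> (\<Sum>k<n. sqrt_coef k) * Re (ip x x)"
      using sum_sqrt_coef_nonneg ip_nonneg[OF x] by simp
    also have "\<dots> \<le> (\<Sum>k<n. sqrt_coef k * Re (ip ((X ^^ k) x) x))"
      unfolding sum_distrib_right by (intro sum_mono le)
    finally show ?thesis .
  qed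
  then show ?thesis using lim by (intro LIMSEQ_le_const) auto
qed

text \<open>Tested against \<open>y\<close>, both applications of the series involve the same
  moments <X^k x, y>; after regrouping only degrees 0 and 1 survive.\<close>

lemma sqrt_op_sqrt_op:
  assumes x: "x \<in> H"
  shows "sqrt_op (sqrt_op x) = x - X x"
proof (rule eq_if_ip_eq')
  show "sqrt_op (sqrt_op x) \<in> H" "x - X x \<in> H" using x by (simp_all add: sqrt_op_mem diff_mem X_mem)
  fix y assume y: "y \<in> H"
  define m where "m k = ip ((X ^^ k) x) y" for k
  have inner: "ip ((X ^^ i) (sqrt_op x)) y = (\<Sum>j. of_real (sqrt_coef j) * m (i + j))" for i
  proof -
    have m: "ip ((X ^^ j) x) ((X ^^ i) y) = m (i + j)" for j
      using x y by (simp add: m_def X_pow_sym[symmetric] X_pow_mem funpow_add)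
    have "ip ((X ^^ i) (sqrt_op x)) y = ip (sqrt_op x) ((X ^^ i) y)" by (intro X_pow_sym sqrt_op_mem y)
    also have "\<dots> = (\<Sum>j. of_real (sqrt_coef j) * ip ((X ^^ j) x) ((X ^^ i) y))"
      by (intro sums_unique sqrt_op_ip x X_pow_mem y)
    finally show ?thesis unfolding m .
  qed
  have "ip (sqrt_op (sqrt_op x)) y = (\<Sum>i. of_real (sqrt_coef i) * ip ((X ^^ i) (sqrt_op x)) y)"
    by (intro sums_unique sqrt_op_ip sqrt_op_mem y)
  also have "\<dots> = (\<Sum>k. of_real (\<Sum>i\<le>k. sqrt_coef i * sqrt_coef (k - i)) * m k)"
    unfolding inner using X_pow_ip_bound[OF x y]
    by (intro hankel_cauchy_product[where C = "nrm ip x * nrm ip y"] summable_sqrt_coef) (simp add: m_def)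
  also have "\<dots> = (\<Sum>k\<in>{0,1}. of_real (\<Sum>i\<le>k. sqrt_coef i * sqrt_coef (k - i)) * m k)"
    by (intro suminf_finite) (auto simp: sqrt_coef_convolution)
  also have "\<dots> = ip (x - X x) y"
    using x y by (simp add: sqrt_coef_convolution m_def ip_diff_left X_mem)
  finally show "ip (sqrt_op (sqrt_op x)) y = ip (x - X x) y" .
qed

text \<open>A competitor \<open>B\<close> commutes with X = 1 - B^2 and hence with the series. For
  the difference y = B x - sqrt_op x this gives (B + sqrt_op) y = 0, so both nonnegative forms
  vanish at \<open>y\<close>. Then both operators annihilate \<open>y\<close>, and symmetry gives
  <y, y> = 0.\<close>

lemma sqrt_op_unique:
  assumes B: "\<And>x. x \<in> H \<Longrightarrow> B x \<in> H" and lin: "linear_on H B"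
    and sym: "\<And>x y. x \<in> H \<Longrightarrow> y \<in> H \<Longrightarrow> ip (B x) y = ip x (B y)"
    and pos: "\<And>x. x \<in> H \<Longrightarrow> 0 \<le> Re (ip (B x) x)"
    and sq: "\<And>x. x \<in> H \<Longrightarrow> B (B x) = x - X x"
    and x: "x \<in> H"
  shows "B x = sqrt_op x"
proof -
  have XB: "X (B u) = B (X u)" if u: "u \<in> H" for u
  proof -
    have "B u - X (B u) = B (u - X u)" using sq[OF B[OF u]] sq[OF u] by simp
    also have "\<dots> = B u - B (X u)" using lin u by (simp add: linear_on_diff X_mem)
    finally show ?thesis by simp
  qed
  have XkB: "(X ^^ k) (B u) = B ((X ^^ k) u)" if u: "u \<in> H" for k u
    by (induction k) (use u in \<open>simp_all add: XB X_pow_mem\<close>)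
  have comm: "B (sqrt_op u) = sqrt_op (B u)" if u: "u \<in> H" for u
  proof (rule eq_if_ip_eq')
    fix y assume y: "y \<in> H"
    have "(\<lambda>k. of_real (sqrt_coef k) * ip ((X ^^ k) u) (B y)) sums ip (sqrt_op u) (B y)"
      by (intro sqrt_op_ip u B y)
    moreover have "ip ((X ^^ k) u) (B y) = ip ((X ^^ k) (B u)) y" for k
      using u y by (simp add: XkB sym[symmetric] X_pow_mem)
    moreover have "ip (sqrt_op u) (B y) = ip (B (sqrt_op u)) y" using y by (simp add: sym sqrt_op_mem)
    ultimately have "(\<lambda>k. of_real (sqrt_coef k) * ip ((X ^^ k) (B u)) y) sums ip (B (sqrt_op u)) y" by simp
    then show "ip (B (sqrt_op u)) y = ip (sqrt_op (B u)) y"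
      using sqrt_op_ip[OF B[OF u] y] by (rule sums_unique2)
  qed (simp_all add: B sqrt_op_mem u)
  define y where "y = B x - sqrt_op x"
  have yH: "y \<in> H" using x by (simp add: y_def diff_mem B sqrt_op_mem)
  have "B y + sqrt_op y = 0"
    using x by (simp add: y_def linear_on_diff[OF lin] linear_on_diff[OF sqrt_op_linear] B sqrt_op_mem comm sq sqrt_op_sqrt_op)
  then have s0: "ip (B y) y + ip (sqrt_op y) y = 0"
    using yH by (simp add: ip_add_left[symmetric] B sqrt_op_mem)
  \<comment> \<open>A positive operator annihilates every zero of its quadratic form, by
    Cauchy-Schwarz for that possibly degenerate form.\<close>
  have null: "A y = 0" if A: "\<And>x. x \<in> H \<Longrightarrow> A x \<in> H" and lin: "linear_on H A"
    and sym: "\<And>x y. x \<in> H \<Longrightarrow> y \<in> H \<Longrightarrow> ip (A x) y = ip x (A y)"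
    and pos: "\<And>x. x \<in> H \<Longrightarrow> 0 \<le> Re (ip (A x) x)" and 0: "Re (ip (A y) y) = 0" for A
  proof -
    interpret A: semi_inner H "\<lambda>u v. ip (A u) v"
    proof
      show "ip (A v) u = cnj (ip (A u) v)" if "u \<in> H" "v \<in> H" for u v
        using that ip_sym[of u "A v"] A by (simp add: sym)
    qed (simp_all add: zero_mem add_mem scale_mem A pos ip_add_left ip_scale_left
        linear_on_add[OF lin] linear_on_scale[OF lin])
    have "cmod (ip (A y) (A y)) \<le> nrm (\<lambda>u v. ip (A u) v) y * nrm (\<lambda>u v. ip (A u) v) (A y)"
      by (intro A.cauchy_schwarz yH A)
    also have "\<dots> = 0" using 0 by (simp add: nrm_def)
    finally show ?thesis using ip_definite[OF A[OF yH]] by simp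
  qed
  have "Re (ip (B y) y) + Re (ip (sqrt_op y) y) = 0" using s0 by (metis plus_complex.simps(1) zero_complex.simps(1))
  then have 0: "Re (ip (B y) y) = 0" "Re (ip (sqrt_op y) y) = 0"
    using pos[OF yH] sqrt_op_nonneg[OF yH] by linarith+
  have "B y = 0" by (rule null[OF B lin sym pos 0(1)])
  moreover have "sqrt_op y = 0"
    by (rule null[OF sqrt_op_mem sqrt_op_linear sqrt_op_sym sqrt_op_nonneg 0(2)])
  ultimately have "ip (B x) y = 0" "ip (sqrt_op x) y = 0"
    using x yH by (simp_all only: sym sqrt_op_sym ip_zero_right)
  then have "ip (B x - sqrt_op x) y = 0"
    using ip_diff_left[OF B[OF x] sqrt_op_mem yH] by simp
  then have "ip y y = 0" by (simp only: y_def)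
  then show ?thesis using ip_definite[OF yH] by (simp add: y_def)
qed

lemma psqrt_eq_sqrt_op:
  assumes A: "\<And>x. x \<in> H \<Longrightarrow> A x = x - X x"
  shows "psqrt H ip A = sqrt_op"
  unfolding psqrt_def
proof (rule the_equality)
  show "(\<forall>x. x \<notin> H \<longrightarrow> sqrt_op x = 0) \<and> (\<forall>x\<in>H. sqrt_op x \<in> H) \<and> linear_on H sqrt_op
      \<and> (\<forall>x\<in>H. \<forall>y\<in>H. ip (sqrt_op x) y = ip x (sqrt_op y)) \<and> (\<forall>x\<in>H. 0 \<le> Re (ip (sqrt_op x) x))
      \<and> (\<forall>x\<in>H. sqrt_op (sqrt_op x) = A x)"
    by (intro conjI ballI allI impI sqrt_op_mem sqrt_op_linear sqrt_op_sym sqrt_op_nonneg)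
      (simp_all add: sqrt_op_sqrt_op A, simp add: sqrt_op_def)
next
  fix B
  assume B: "(\<forall>x. x \<notin> H \<longrightarrow> B x = 0) \<and> (\<forall>x\<in>H. B x \<in> H) \<and> linear_on H B
      \<and> (\<forall>x\<in>H. \<forall>y\<in>H. ip (B x) y = ip x (B y)) \<and> (\<forall>x\<in>H. 0 \<le> Re (ip (B x) x))
      \<and> (\<forall>x\<in>H. B (B x) = A x)"
  show "B = sqrt_op"
  proof
    fix x
    show "B x = sqrt_op x"
    proof (cases "x \<in> H")
      case True
      then show ?thesis using B A by (intro sqrt_op_unique) auto
    qed (use B in \<open>simp add: sqrt_op_def\<close>)
  qed
qed

end

text \<open>Since this relation is symmetric in \<open>(D, L)\<close>, one totality lemma gives both the domain and the
  surjectivity of the isometric extension of \<open>D x \<mapsto> L x\<close>.\<close>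
definition limit_pair where
  "limit_pair H ipH K ipK M D L y g \<longleftrightarrow>
     (\<exists>X. (\<forall>n. X n \<in> M) \<and> inner_space.converges H ipH (\<lambda>n. D (X n)) y
        \<and> inner_space.converges K ipK (\<lambda>n. L (X n)) g)"

lemma limit_pair_swap: "limit_pair H ipH K ipK M D L y g \<longleftrightarrow> limit_pair K ipK H ipH M L D g y"
  by (auto simp: limit_pair_def)

text \<open>The domain \<open>M\<close> is the whole space when \<open>D\<close> is a defect
  operator, and the incomplete span of the kernel functions when a representation operator is to be
  extended.\<close>

locale isometric_pair = M: semi_inner M ipM + H: hilbert H ipH + K: hilbert K ipK
  for M :: "'m::cvec set" and ipM and H :: "'a::cvec set" and ipH and K :: "'b::cvec set" and ipK +
  fixes D L
  assumes D: "x \<in> M \<Longrightarrow> D x \<in> H" and L: "x \<in> M \<Longrightarrow> L x \<in> K"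
    and D_lin: "linear_on M D" and L_lin: "linear_on M L"
    and iso: "x \<in> M \<Longrightarrow> y \<in> M \<Longrightarrow> ipK (L x) (L y) = ipH (D x) (D y)"
begin

text \<open>Approximants of \<open>y\<close> by values of \<open>D\<close> form a Cauchy sequence;
  the isometry relation carries their distances over to the values of \<open>L\<close>, and
  completeness of \<open>K\<close> supplies the partner.\<close>

lemma limit_pair_total:
  assumes "y \<in> clos H ipH (D ` M)"
  shows "\<exists>g. limit_pair H ipH K ipK M D L y g"
proof -
  have "D ` M \<subseteq> H" using D by auto
  then obtain Y where Y: "\<And>n. Y n \<in> D ` M" and c: "H.converges Y y" using assms unfolding H.clos_iff[OF \<open>D ` M \<subseteq> H\<close>] by blast
  have "\<forall>n. \<exists>x. x \<in> M \<and> Y n = D x" using Y by blast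
  from choice[OF this] obtain X where X: "\<And>n. X n \<in> M" "\<And>n. Y n = D (X n)" by blast
  have nn: "nrm ipK (L (X m) - L (X n)) = nrm ipH (Y m - Y n)" for m n
    using X iso[OF M.diff_mem M.diff_mem, of "X m" "X n" "X m" "X n"]
    by (simp add: nrm_def M.linear_on_diff[OF D_lin] M.linear_on_diff[OF L_lin])
  have YH: "Y n \<in> H" for n using X D by simp
  have "\<exists>g. K.converges (\<lambda>n. L (X n)) g"
  proof (rule K.complete)
    fix e :: real assume "e > 0"
    then have e: "e / 2 > 0" by simp
    have "(\<lambda>n. nrm ipH (Y n - y)) \<longlonglongrightarrow> 0" using c by (simp add: H.converges_def)
    from LIMSEQ_D[OF this e] obtain N where N: "\<And>n. n \<ge> N \<Longrightarrow> norm (nrm ipH (Y n - y) - 0) < e / 2"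
      by blast
    have y: "y \<in> H" using c by (simp add: H.converges_def)
    have "nrm ipH (Y m - Y n) < e" if "m \<ge> N" "n \<ge> N" for m n
    proof -
      have "nrm ipH (Y m - Y n) \<le> nrm ipH (Y m - y) + nrm ipH (Y n - y)"
        using H.nrm_triangle_diff[OF YH y YH, of m n] H.nrm_diff_commute[OF y YH, of n] by simp
      moreover have "nrm ipH (Y m - y) < e / 2" "nrm ipH (Y n - y) < e / 2" using N that by force+
      ultimately show ?thesis by linarith
    qed
    then show "\<exists>N. \<forall>m\<ge>N. \<forall>n\<ge>N. nrm ipK (L (X m) - L (X n)) < e" unfolding nn by blast
  qed (use X L in simp)
  moreover have "Y = (\<lambda>n. D (X n))" by (rule ext) (rule X(2))
  ultimately show ?thesis using c X(1) unfolding limit_pair_def by blast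
qed

lemma limit_pair_mem:
  assumes "limit_pair H ipH K ipK M D L y g"
  shows "y \<in> clos H ipH (D ` M)" "y \<in> H" "g \<in> K"
proof -
  obtain X where "\<And>n. X n \<in> M" "H.converges (\<lambda>n. D (X n)) y" "K.converges (\<lambda>n. L (X n)) g"
    using assms by (auto simp: limit_pair_def)
  then show "y \<in> clos H ipH (D ` M)" "y \<in> H" "g \<in> K"
    using D by (auto simp: H.clos_iff image_subset_iff H.converges_def K.converges_def intro!: exI[of _ "\<lambda>n. D (X n)"])
qed

lemma limit_pair_ip:
  assumes "limit_pair H ipH K ipK M D L y g" "limit_pair H ipH K ipK M D L y' g'"
  shows "ipK g g' = ipH y y'"
proof -
  obtain X X' where X: "\<And>n. X n \<in> M" "\<And>n. X' n \<in> M" and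
    c: "H.converges (\<lambda>n. D (X n)) y" "K.converges (\<lambda>n. L (X n)) g"
       "H.converges (\<lambda>n. D (X' n)) y'" "K.converges (\<lambda>n. L (X' n)) g'"
    using assms unfolding limit_pair_def by blast
  have "(\<lambda>n. ipK (L (X n)) (L (X' n))) \<longlonglongrightarrow> ipK g g'" using X L c by (intro K.converges_ip2) auto
  moreover have "(\<lambda>n. ipH (D (X n)) (D (X' n))) \<longlonglongrightarrow> ipH y y'" using X D c by (intro H.converges_ip2) auto
  ultimately show ?thesis using X iso LIMSEQ_unique by fastforce
qed

lemma limit_pair_add:
  assumes "limit_pair H ipH K ipK M D L y g" "limit_pair H ipH K ipK M D L y' g'"
  shows "limit_pair H ipH K ipK M D L (y + y') (g + g')"
proof -
  obtain X X' where X: "\<And>n. X n \<in> M" "\<And>n. X' n \<in> M" and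
    c: "H.converges (\<lambda>n. D (X n)) y" "K.converges (\<lambda>n. L (X n)) g"
       "H.converges (\<lambda>n. D (X' n)) y'" "K.converges (\<lambda>n. L (X' n)) g'"
    using assms unfolding limit_pair_def by blast
  have "H.converges (\<lambda>n. D (X n) + D (X' n)) (y + y')" "K.converges (\<lambda>n. L (X n) + L (X' n)) (g + g')"
    using X c D L by (auto intro!: H.converges_add K.converges_add)
  then show ?thesis
    using X unfolding limit_pair_def
    by (intro exI[of _ "\<lambda>n. X n + X' n"]) (simp add: linear_on_add[OF D_lin] linear_on_add[OF L_lin] M.add_mem)
qed

lemma limit_pair_scale:
  assumes "limit_pair H ipH K ipK M D L y g"
  shows "limit_pair H ipH K ipK M D L (cscale c y) (cscale c g)"
proof -
  obtain X where X: "\<And>n. X n \<in> M" and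
    c: "H.converges (\<lambda>n. D (X n)) y" "K.converges (\<lambda>n. L (X n)) g"
    using assms unfolding limit_pair_def by blast
  have "H.converges (\<lambda>n. cscale c (D (X n))) (cscale c y)" "K.converges (\<lambda>n. cscale c (L (X n))) (cscale c g)"
    using X c D L by (auto intro!: H.converges_scale K.converges_scale)
  then show ?thesis
    using X unfolding limit_pair_def
    by (intro exI[of _ "\<lambda>n. cscale c (X n)"]) (simp add: linear_on_scale[OF D_lin] linear_on_scale[OF L_lin] M.scale_mem)
qed

lemma limit_pair_self: "x \<in> M \<Longrightarrow> limit_pair H ipH K ipK M D L (D x) (L x)"
  unfolding limit_pair_def
  by (intro exI[of _ "\<lambda>n. x"]) (simp add: H.converges_def K.converges_def D L)

lemma limit_pair_unique:
  assumes "limit_pair H ipH K ipK M D L y g" "limit_pair H ipH K ipK M D L y g'"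
  shows "g = g'"
proof (rule K.ip_definite[of "g - g'", THEN iffD1[OF right_minus_eq]])
  have mem: "g \<in> K" "g' \<in> K" using assms limit_pair_mem by auto
  then show "g - g' \<in> K" by (rule K.diff_mem)
  show "ipK (g - g') (g - g') = 0"
    using limit_pair_ip[OF assms(1) assms(1)] limit_pair_ip[OF assms(1) assms(2)]
      limit_pair_ip[OF assms(2) assms(1)] limit_pair_ip[OF assms(2) assms(2)] mem
    by (simp add: K.ip_diff_left K.ip_diff_right K.diff_mem)
qed

text \<open>For a defect operator \<open>D\<close> this is the unitary factor in the polar
  decomposition L = v D.\<close>

lemma isometric_extension:
  assumes dense: "K \<subseteq> clos K ipK (L ` M)"
  shows "\<exists>v. unitary_betw (clos H ipH (D ` M)) ipH K ipK v \<and> (\<forall>x\<in>M. v (D x) = L x)"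
proof -
  interpret swap: isometric_pair M ipM K ipK H ipH L D
    by unfold_locales (simp_all add: D L D_lin L_lin iso)
  define v where "v y = (SOME g. limit_pair H ipH K ipK M D L y g)" for y
  have v: "limit_pair H ipH K ipK M D L y (v y)" if "y \<in> clos H ipH (D ` M)" for y
    unfolding v_def by (rule someI_ex[OF limit_pair_total[OF that]])
  have v_eq: "v y = g" if "limit_pair H ipH K ipK M D L y g" for y g
    using limit_pair_unique[OF v[OF limit_pair_mem(1)[OF that]] that] .
  have "unitary_betw (clos H ipH (D ` M)) ipH K ipK v"
    unfolding unitary_betw_def linear_on_def
  proof (intro conjI ballI allI)
    show "v ` clos H ipH (D ` M) = K"
    proof
      show "v ` clos H ipH (D ` M) \<subseteq> K" using v limit_pair_mem by blast
      show "K \<subseteq> v ` clos H ipH (D ` M)"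
      proof
        fix g assume "g \<in> K"
        then obtain y where "limit_pair H ipH K ipK M D L y g"
          using swap.limit_pair_total[of g] dense limit_pair_swap by blast
        then show "g \<in> v ` clos H ipH (D ` M)" using v_eq limit_pair_mem(1) by blast
      qed
    qed
  qed (auto intro!: v_eq limit_pair_add limit_pair_scale limit_pair_ip v)
  moreover have "v (D x) = L x" if "x \<in> M" for x using limit_pair_self[OF that] by (rule v_eq)
  ultimately show ?thesis by blast
qed

end

section \<open>Unitary colligations and characteristic functions\<close>

text \<open>The block operator \<open>(T, J; L, B) : H \<oplus> E \<rightarrow> H \<oplus> F\<close> is unitary; only the relations that
  are needed to identify the characteristic function of \<open>T\<close> with the transfer function are required.\<close>
locale colligation = H: hilbert H ipH + E: hilbert E ipE + F: hilbert F ipF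
  for H :: "'a::cvec set" and ipH and E :: "'b::cvec set" and ipE and F :: "'c::cvec set" and ipF +
  fixes T T' :: "'a \<Rightarrow> 'a" and J :: "'b \<Rightarrow> 'a" and J' :: "'a \<Rightarrow> 'b"
    and L :: "'a \<Rightarrow> 'c" and L' :: "'c \<Rightarrow> 'a" and B' :: "'c \<Rightarrow> 'b"
  assumes T_mem: "x \<in> H \<Longrightarrow> T x \<in> H" and T'_mem: "x \<in> H \<Longrightarrow> T' x \<in> H"
    and J_mem: "e \<in> E \<Longrightarrow> J e \<in> H" and J'_mem: "x \<in> H \<Longrightarrow> J' x \<in> E"
    and L_mem: "x \<in> H \<Longrightarrow> L x \<in> F" and L'_mem: "g \<in> F \<Longrightarrow> L' g \<in> H"
    and T_lin: "linear_on H T" and T'_lin: "linear_on H T'"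
    and J'_lin: "linear_on H J'" and L_lin: "linear_on H L"
    and T_adj: "x \<in> H \<Longrightarrow> y \<in> H \<Longrightarrow> ipH (T x) y = ipH x (T' y)"
    and J_adj: "e \<in> E \<Longrightarrow> x \<in> H \<Longrightarrow> ipH (J e) x = ipE e (J' x)"
    and L_adj: "x \<in> H \<Longrightarrow> g \<in> F \<Longrightarrow> ipF (L x) g = ipH x (L' g)"
    and T'_T: "x \<in> H \<Longrightarrow> T' (T x) + L' (L x) = x"
    and T_T': "x \<in> H \<Longrightarrow> T (T' x) + J (J' x) = x"
    and J'_T: "x \<in> H \<Longrightarrow> J' (T x) + B' (L x) = 0"
    and J'_dense: "E \<subseteq> clos E ipE (J' ` H)" and L_dense: "F \<subseteq> clos F ipF (L ` H)"
begin

lemma T'_adj: "x \<in> H \<Longrightarrow> y \<in> H \<Longrightarrow> ipH (T' x) y = ipH x (T y)"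
  using T_adj[of y x] H.ip_sym[of "T y" x] H.ip_sym[of y "T' x"] T_mem T'_mem by simp

lemma nrm_T: "x \<in> H \<Longrightarrow> nrm ipH (T x) \<le> nrm ipH x"
proof -
  assume x: "x \<in> H"
  have "ipH x x = ipH x (T' (T x) + L' (L x))" using T'_T[OF x] by simp
  also have "\<dots> = ipH (T x) (T x) + ipF (L x) (L x)"
    using x by (simp add: H.ip_add_right T_mem T'_mem L_mem L'_mem T_adj L_adj)
  finally show ?thesis using F.ip_nonneg[OF L_mem[OF x]] by (simp add: nrm_def)
qed

lemma nrm_T': "x \<in> H \<Longrightarrow> nrm ipH (T' x) \<le> nrm ipH x"
proof -
  assume x: "x \<in> H"
  have "ipH x x = ipH (T (T' x) + J (J' x)) x" using T_T'[OF x] by simp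
  also have "\<dots> = ipH (T' x) (T' x) + ipE (J' x) (J' x)"
    using x by (simp add: H.ip_add_left T_mem T'_mem J_mem J'_mem T_adj J_adj)
  finally show ?thesis using E.ip_nonneg[OF J'_mem[OF x]] by (simp add: nrm_def)
qed

lemma contraction: "is_contraction H ipH T"
  by (simp add: is_contraction_def T_mem T_lin nrm_T)

lemma adjoint_T: "y \<in> H \<Longrightarrow> adjoint H ipH H ipH T y = T' y"
  by (rule H.adjoint_eqI) (simp_all add: T'_mem T_adj)

lemma symmetric_contraction_T'_T: "symmetric_contraction H ipH (\<lambda>x. T' (T x))"
proof
  show "linear_on H (\<lambda>x. T' (T x))"
    using T_lin T'_lin T_mem by (simp add: linear_on_def)
qed (auto simp: T_mem T'_mem T_adj T'_adj intro: order_trans[OF nrm_T' nrm_T])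

lemma symmetric_contraction_T_T': "symmetric_contraction H ipH (\<lambda>x. T (T' x))"
proof
  show "linear_on H (\<lambda>x. T (T' x))"
    using T_lin T'_lin T'_mem by (simp add: linear_on_def)
qed (auto simp: T_mem T'_mem T_adj T'_adj intro: order_trans[OF nrm_T nrm_T'])

interpretation X: symmetric_contraction H ipH "\<lambda>x. T' (T x)" by (rule symmetric_contraction_T'_T)
interpretation Y: symmetric_contraction H ipH "\<lambda>x. T (T' x)" by (rule symmetric_contraction_T_T')

lemma defect_op_eq: "defect_op H ipH T = X.sqrt_op"
  unfolding defect_op_def by (rule X.psqrt_eq_sqrt_op) (simp add: adjoint_T T_mem)

lemma defect_op_star_eq: "defect_op_star H ipH T = Y.sqrt_op"
  unfolding defect_op_star_def by (rule Y.psqrt_eq_sqrt_op) (simp add: adjoint_T T_mem)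

text \<open>Energy balance: the square of the defect operator is 1 - T' T = L' L.\<close>

lemma ip_defect:
  assumes x: "x \<in> H" and y: "y \<in> H"
  shows "ipF (L x) (L y) = ipH (defect_op H ipH T x) (defect_op H ipH T y)"
proof -
  have "ipH (X.sqrt_op x) (X.sqrt_op y) = ipH x (X.sqrt_op (X.sqrt_op y))"
    using x by (simp add: X.sqrt_op_sym X.sqrt_op_mem)
  also have "X.sqrt_op (X.sqrt_op y) = L' (L y)"
    using X.sqrt_op_sqrt_op[OF y] T'_T[OF y] by (simp add: diff_eq_eq add.commute)
  finally show ?thesis using x y by (simp add: defect_op_eq L_adj L_mem)
qed

lemma ip_defect_star:
  assumes x: "x \<in> H" and y: "y \<in> H"
  shows "ipE (J' x) (J' y) = ipH (defect_op_star H ipH T x) (defect_op_star H ipH T y)"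
proof -
  have "ipH (Y.sqrt_op x) (Y.sqrt_op y) = ipH (Y.sqrt_op (Y.sqrt_op x)) y"
    using y by (simp add: Y.sqrt_op_sym Y.sqrt_op_mem)
  also have "Y.sqrt_op (Y.sqrt_op x) = J (J' x)"
    using Y.sqrt_op_sqrt_op[OF x] T_T'[OF x] by (simp add: diff_eq_eq add.commute)
  finally show ?thesis using x y by (simp add: defect_op_star_eq J_adj J'_mem)
qed

text \<open>The state \<open>y\<close> of the adjoint system with input \<open>L x\<close> encodes
  the resolvent: for r = z y - T x the relation T' T + L' L = 1 gives T' r = y - x, hence r - z T' r
  = z x - T x.\<close>

lemma resolv_eq:
  assumes z: "cmod z < 1" and x: "x \<in> H" and y: "y \<in> H" "y = T' (cscale z y) + L' (L x)"
  shows "resolv H ipH T z (cscale z x - T x) = cscale z y - T x"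
  unfolding resolv_def
proof (rule the_equality)
  have Ty: "T' (cscale z y) \<in> H" using y by (simp add: T'_mem H.scale_mem)
  have r: "cscale z y - T x \<in> H" using x y by (simp add: H.diff_mem H.scale_mem T_mem)
  have "T' (cscale z y - T x) = T' (cscale z y) - T' (T x)"
    using x y by (intro H.linear_on_diff T'_lin H.scale_mem T_mem)
  also have "\<dots> = y - x" using y(2) T'_T[OF x] by (metis add_diff_cancel_right diff_add_eq diff_diff_eq2 add.commute)
  finally have "cscale z y - T x - cscale z (T' (cscale z y - T x)) = cscale z x - T x"
    by (simp add: cscale_diff_right)
  then show eq: "cscale z y - T x \<in> H \<and> cscale z y - T x
      - cscale z (adjoint H ipH H ipH T (cscale z y - T x)) = cscale z x - T x"
    using r by (simp add: adjoint_T)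
  fix u assume u: "u \<in> H \<and> u - cscale z (adjoint H ipH H ipH T u) = cscale z x - T x"
  show "u = cscale z y - T x"
  proof (rule H.contraction_fixed_unique[OF T'_mem T'_lin nrm_T' z conjunct1[OF u] r])
    show "u - cscale z (T' u) = cscale z y - T x - cscale z (T' (cscale z y - T x))"
      using conjunct2[OF u] conjunct2[OF eq] by (simp only: adjoint_T[OF conjunct1[OF u]] adjoint_T[OF r])
  qed
qed

text \<open>Applying \<open>J'\<close> to the vector found in \<open>resolv_eq\<close> and replacing
  - J' T by B' L yields \<open>Theta z (L x)\<close>. The two unitaries extend the isometries from
  defect vectors to values of \<open>L\<close> and of \<open>J'\<close>.\<close>

theorem char_fun_coincides_transfer:
  assumes Theta: "\<And>z g. cmod z < 1 \<Longrightarrow> g \<in> F \<Longrightarrow>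
      \<exists>x\<in>H. x = T' (cscale z x) + L' g \<and> Theta z g = J' (cscale z x) + B' g"
  shows "char_fun_coincides H ipH T F ipF E ipE Theta"
proof -
  have "isometric_pair H ipH H ipH F ipF (defect_op H ipH T) L"
    by unfold_locales (auto simp: ip_defect L_mem L_lin, simp_all add: defect_op_eq X.sqrt_op_mem X.sqrt_op_linear)
  then obtain v where v: "unitary_betw (clos H ipH (defect_op H ipH T ` H)) ipH F ipF v"
    "\<And>x. x \<in> H \<Longrightarrow> v (defect_op H ipH T x) = L x"
    using isometric_pair.isometric_extension[OF _ L_dense] by blast
  have "isometric_pair H ipH H ipH E ipE (defect_op_star H ipH T) J'"
    by unfold_locales (auto simp: ip_defect_star J'_mem J'_lin, simp_all add: defect_op_star_eq Y.sqrt_op_mem Y.sqrt_op_linear)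
  then obtain vs where vs: "unitary_betw (clos H ipH (defect_op_star H ipH T ` H)) ipH E ipE vs"
    "\<And>x. x \<in> H \<Longrightarrow> vs (defect_op_star H ipH T x) = J' x"
    using isometric_pair.isometric_extension[OF _ J'_dense] by blast
  have "vs (defect_op_star H ipH T (resolv H ipH T z (cscale z x - T x))) = Theta z (v (defect_op H ipH T x))"
    if z: "z \<in> ball 0 1" and x: "x \<in> H" for z x
  proof -
    have z1: "cmod z < 1" using z by simp
    obtain y where y: "y \<in> H" "y = T' (cscale z y) + L' (L x)"
      and Th: "Theta z (L x) = J' (cscale z y) + B' (L x)"
      using Theta[OF z1 L_mem[OF x]] by blast
    have "cscale z y - T x \<in> H" using x y by (simp add: H.diff_mem H.scale_mem T_mem)
    moreover have "J' (cscale z y - T x) = J' (cscale z y) - J' (T x)"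
      using x y by (intro H.linear_on_diff J'_lin H.scale_mem T_mem)
    moreover have "B' (L x) = - J' (T x)"
      using J'_T[OF x] by (simp add: eq_neg_iff_add_eq_0 add.commute)
    ultimately show ?thesis
      using x by (simp only: resolv_eq[OF z1 x y] vs(2) v(2) Th) simp
  qed
  then show ?thesis using v(1) vs(1) unfolding char_fun_coincides_def by blast
qed

end

section \<open>Weighted sequence spaces and direct sums\<close>

definition wl2 :: "(nat \<Rightarrow> real) \<Rightarrow> (nat \<Rightarrow> complex) set" where
  "wl2 w = {a. summable (\<lambda>k. w k * (cmod (a k))\<^sup>2)}"

definition wl2_ip :: "(nat \<Rightarrow> real) \<Rightarrow> (nat \<Rightarrow> complex) \<Rightarrow> (nat \<Rightarrow> complex) \<Rightarrow> complex" where
  "wl2_ip w a b = (\<Sum>k. a k * cnj (b k) * of_real (w k))"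

lemma wl2_ip_summable:
  assumes w: "\<And>k. 0 < w k" and a: "a \<in> wl2 w" and b: "b \<in> wl2 w"
  shows "summable (\<lambda>k. a k * cnj (b k) * of_real (w k))"
proof (rule summable_norm_cancel, rule summable_comparison_test'[where N = 0])
  show "summable (\<lambda>k. w k * (cmod (a k))\<^sup>2 + w k * (cmod (b k))\<^sup>2)"
    using a b by (intro summable_add) (simp_all add: wl2_def)
  fix k
  have "2 * (cmod (a k) * cmod (b k)) \<le> (cmod (a k))\<^sup>2 + (cmod (b k))\<^sup>2"
    using sum_squares_bound[of "cmod (a k)" "cmod (b k)"] by simp
  moreover have "0 \<le> cmod (a k) * cmod (b k)" by simp
  ultimately have "cmod (a k) * cmod (b k) \<le> (cmod (a k))\<^sup>2 + (cmod (b k))\<^sup>2" by linarith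
  then have "w k * (cmod (a k) * cmod (b k)) \<le> w k * ((cmod (a k))\<^sup>2 + (cmod (b k))\<^sup>2)"
    using w[of k] by (intro mult_left_mono) auto
  then show "norm (norm (a k * cnj (b k) * of_real (w k))) \<le> w k * (cmod (a k))\<^sup>2 + w k * (cmod (b k))\<^sup>2"
    using w[of k] by (simp add: norm_mult algebra_simps)
qed

lemma wl2_ip_self: "wl2_ip w a a = (\<Sum>k. of_real (w k * (cmod (a k))\<^sup>2))"
  unfolding wl2_ip_def by (simp only: of_real_mult complex_norm_square mult_ac)

lemma Re_wl2_ip_self:
  assumes "a \<in> wl2 w"
  shows "Re (wl2_ip w a a) = (\<Sum>k. w k * (cmod (a k))\<^sup>2)"
  unfolding wl2_ip_self using assms by (subst suminf_of_real[symmetric]) (simp_all add: wl2_def)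

lemma inner_space_wl2:
  assumes w: "\<And>k. 0 < w k"
  shows "inner_space (wl2 w) (wl2_ip w)"
proof
  fix a b assume ab: "a \<in> wl2 w" "b \<in> wl2 w"
  show "a + b \<in> wl2 w"
    unfolding wl2_def mem_Collect_eq
  proof (rule summable_comparison_test'[where N = 0])
    show "summable (\<lambda>k. 2 * (w k * (cmod (a k))\<^sup>2) + 2 * (w k * (cmod (b k))\<^sup>2))"
      using ab by (intro summable_add summable_mult) (simp_all add: wl2_def)
    fix k
    have "(cmod (a k + b k))\<^sup>2 \<le> (cmod (a k) + cmod (b k))\<^sup>2" by (intro power_mono norm_triangle_ineq) auto
    also have "\<dots> \<le> 2 * (cmod (a k))\<^sup>2 + 2 * (cmod (b k))\<^sup>2"
      using sum_squares_bound[of "cmod (a k)" "cmod (b k)"] by (simp add: power2_sum)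
    finally have "w k * (cmod (a k + b k))\<^sup>2 \<le> w k * (2 * (cmod (a k))\<^sup>2 + 2 * (cmod (b k))\<^sup>2)"
      using w[of k] by (intro mult_left_mono) auto
    then show "norm (w k * (cmod ((a + b) k))\<^sup>2) \<le> 2 * (w k * (cmod (a k))\<^sup>2) + 2 * (w k * (cmod (b k))\<^sup>2)"
      using w[of k] by (simp add: algebra_simps)
  qed
  show "wl2_ip w b a = cnj (wl2_ip w a b)"
  proof -
    have "(\<lambda>k. cnj (a k * cnj (b k) * of_real (w k))) sums cnj (wl2_ip w a b)"
      unfolding sums_cnj wl2_ip_def by (rule summable_sums[OF wl2_ip_summable[OF w ab]])
    then show ?thesis unfolding wl2_ip_def[of w b a] by (simp add: sums_iff mult_ac)
  qed
  show "wl2_ip w (cscale c a) b = c * wl2_ip w a b" for c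
    using suminf_mult[OF wl2_ip_summable[OF w ab], of c]
    by (simp add: wl2_ip_def cscale_fun_def cscale_complex_def mult_ac)
  fix d assume d: "d \<in> wl2 w"
  show "wl2_ip w (a + b) d = wl2_ip w a d + wl2_ip w b d"
    using suminf_add[OF wl2_ip_summable[OF w ab(1) d] wl2_ip_summable[OF w ab(2) d]]
    by (simp add: wl2_ip_def algebra_simps)
next
  fix a c assume a: "a \<in> wl2 w"
  then have s: "summable (\<lambda>k. w k * (cmod (a k))\<^sup>2)" by (simp add: wl2_def)
  show "cscale c a \<in> wl2 w"
    using summable_mult[OF s, of "(cmod c)\<^sup>2"]
    by (simp add: wl2_def cscale_fun_def cscale_complex_def norm_mult power_mult_distrib mult_ac)
  show "0 \<le> Re (wl2_ip w a a)"
    unfolding Re_wl2_ip_self[OF a] using w s by (intro suminf_nonneg) (simp_all add: less_imp_le)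
  show "a = 0" if "wl2_ip w a a = 0"
  proof
    fix k
    have "(\<Sum>k. w k * (cmod (a k))\<^sup>2) = 0" using Re_wl2_ip_self[OF a] that by simp
    then have "\<forall>k. w k * (cmod (a k))\<^sup>2 = 0"
      using w by (subst (asm) suminf_eq_zero_iff[OF s]) (simp_all add: less_imp_le)
    then have "w k * (cmod (a k))\<^sup>2 = 0" by blast
    then show "a k = 0 k" using w[of k] by simp
  qed
qed (simp add: wl2_def)

text \<open>Coordinates converge, and the norm bounds survive the limit because they are applied to
  finite partial sums first and then for all lengths.\<close>

lemma hilbert_wl2:
  assumes w: "\<And>k. 0 < w k"
  shows "hilbert (wl2 w) (wl2_ip w)"
proof -
  interpret inner_space "wl2 w" "wl2_ip w" by (rule inner_space_wl2[OF w])
  have sq: "(nrm (wl2_ip w) a)\<^sup>2 = (\<Sum>k. w k * (cmod (a k))\<^sup>2)" if "a \<in> wl2 w" for a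
    using that by (simp add: nrm_sq Re_wl2_ip_self)
  have part: "(\<Sum>k<K. w k * (cmod (a k))\<^sup>2) \<le> (nrm (wl2_ip w) a)\<^sup>2" if "a \<in> wl2 w" for a K
    unfolding sq[OF that] using that w by (intro sum_le_suminf) (auto simp: wl2_def less_imp_le)
  show ?thesis
  proof
    fix X :: "nat \<Rightarrow> nat \<Rightarrow> complex"
    assume X: "\<And>n. X n \<in> wl2 w"
      and C: "\<And>e. e > 0 \<Longrightarrow> \<exists>N. \<forall>m\<ge>N. \<forall>n\<ge>N. nrm (wl2_ip w) (X m - X n) < e"
    have "convergent (\<lambda>n. X n k)" for k
    proof (rule Cauchy_convergent, rule metric_CauchyI)
      fix e :: real assume e: "e > 0"
      then have "sqrt (w k) * e > 0" using w[of k] by simp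
      then obtain N where N: "\<And>m n. m \<ge> N \<Longrightarrow> n \<ge> N \<Longrightarrow> nrm (wl2_ip w) (X m - X n) < sqrt (w k) * e"
        using C by blast
      have "dist (X m k) (X n k) < e" if "m \<ge> N" "n \<ge> N" for m n
      proof -
        have XX: "X m - X n \<in> wl2 w" by (intro diff_mem X)
        have "w k * (cmod (X m k - X n k))\<^sup>2 \<le> (\<Sum>j<Suc k. w j * (cmod ((X m - X n) j))\<^sup>2)"
          using member_le_sum[of k "{..<Suc k}" "\<lambda>j. w j * (cmod ((X m - X n) j))\<^sup>2"] w
          by (simp add: less_imp_le)
        also have "\<dots> \<le> (nrm (wl2_ip w) (X m - X n))\<^sup>2" by (rule part[OF XX])
        also have "\<dots> < (sqrt (w k) * e)\<^sup>2"
          using N[OF that] nrm_nonneg[OF XX] by (intro power_strict_mono) auto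
        also have "\<dots> = w k * e\<^sup>2" using w[of k] by (simp add: power_mult_distrib)
        finally have "(cmod (X m k - X n k))\<^sup>2 < e\<^sup>2" using w[of k] by simp
        then show ?thesis using e by (simp add: dist_norm power_less_imp_less_base)
      qed
      then show "\<exists>N. \<forall>m\<ge>N. \<forall>n\<ge>N. dist (X m k) (X n k) < e" by blast
    qed
    then obtain a where a: "\<And>k. (\<lambda>n. X n k) \<longlonglongrightarrow> a k" unfolding convergent_def by metis
    have bd: "(\<Sum>k<K. w k * (cmod ((X m - a) k))\<^sup>2) \<le> e\<^sup>2"
      if N: "\<And>n. n \<ge> N \<Longrightarrow> nrm (wl2_ip w) (X m - X n) < e" for m N e K
    proof (rule LIMSEQ_le_const2)
      show "(\<lambda>n. \<Sum>k<K. w k * (cmod ((X m - X n) k))\<^sup>2) \<longlonglongrightarrow> (\<Sum>k<K. w k * (cmod ((X m - a) k))\<^sup>2)"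
        using a by (auto intro!: tendsto_intros)
      have "(\<Sum>k<K. w k * (cmod ((X m - X n) k))\<^sup>2) \<le> e\<^sup>2" if "n \<ge> N" for n
      proof -
        have "(nrm (wl2_ip w) (X m - X n))\<^sup>2 \<le> e\<^sup>2"
          using N[OF that] by (intro power_mono nrm_nonneg diff_mem X less_imp_le)
        then show ?thesis using part[OF diff_mem[OF X X], of m n K] by linarith
      qed
      then show "\<exists>N. \<forall>n\<ge>N. (\<Sum>k<K. w k * (cmod ((X m - X n) k))\<^sup>2) \<le> e\<^sup>2" by blast
    qed
    have lim: "X m - a \<in> wl2 w \<and> nrm (wl2_ip w) (X m - a) \<le> e"
      if e: "e > 0" and N: "\<And>n. n \<ge> N \<Longrightarrow> nrm (wl2_ip w) (X m - X n) < e" for m N e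
    proof -
      have s: "summable (\<lambda>k. w k * (cmod ((X m - a) k))\<^sup>2)"
        using bd[OF N] w by (intro summableI_nonneg_bounded[where x = "e\<^sup>2"]) (auto simp: less_imp_le)
      then have mem: "X m - a \<in> wl2 w" by (simp add: wl2_def)
      have "(nrm (wl2_ip w) (X m - a))\<^sup>2 \<le> e\<^sup>2"
        unfolding sq[OF mem] by (intro suminf_le_const s bd[OF N])
      then show ?thesis using mem e by (simp add: power2_le_iff_abs_le)
    qed
    obtain N where "\<And>m n. m \<ge> N \<Longrightarrow> n \<ge> N \<Longrightarrow> nrm (wl2_ip w) (X m - X n) < 1"
      using C[of 1] by auto
    then have "X N - a \<in> wl2 w" using lim[of 1 N N] by simp
    \<comment> \<open>The coordinatewise limit belongs to the space because it differs from a member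
      by a member.\<close>
    then have "X N - (X N - a) \<in> wl2 w" by (rule diff_mem[OF X])
    moreover have "X N - (X N - a) = a" by (simp add: algebra_simps)
    ultimately have aw: "a \<in> wl2 w" by (simp only:)
    have "(\<lambda>n. nrm (wl2_ip w) (X n - a)) \<longlonglongrightarrow> 0"
    proof (rule LIMSEQ_I)
      fix e :: real assume "e > 0"
      then have e: "e / 2 > 0" by simp
      then obtain N where N: "\<And>m n. m \<ge> N \<Longrightarrow> n \<ge> N \<Longrightarrow> nrm (wl2_ip w) (X m - X n) < e / 2"
        using C by blast
      have "norm (nrm (wl2_ip w) (X m - a) - 0) < e" if "m \<ge> N" for m
      proof -
        have "nrm (wl2_ip w) (X m - a) \<le> e / 2" using lim[OF e, of N m] N[OF that] by blast
        then show ?thesis using nrm_nonneg[OF diff_mem[OF X aw], of m] e by simp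
      qed
      then show "\<exists>N. \<forall>m\<ge>N. norm (nrm (wl2_ip w) (X m - a) - 0) < e" by blast
    qed
    then show "\<exists>x. converges X x" using aw unfolding converges_def by blast
  qed
qed

text \<open>Applied to Taylor coefficients and to the inverse of \<open>Gamma_op\<close>.
  Surjectivity of \<phi> turns a limit of images into the image of a limit.\<close>

lemma hilbert_transport:
  fixes H :: "'a::cvec set" and K :: "'b::cvec set" and \<phi> :: "'a \<Rightarrow> 'b"
  assumes K: "hilbert K ipK" and zero: "0 \<in> H"
    and add: "\<And>x y. x \<in> H \<Longrightarrow> y \<in> H \<Longrightarrow> x + y \<in> H" and scale: "\<And>x c. x \<in> H \<Longrightarrow> cscale c x \<in> H"
    and lin: "linear_on H \<phi>" and im: "\<phi> ` H = K" and inj: "inj_on \<phi> H"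
    and ip: "\<And>x y. x \<in> H \<Longrightarrow> y \<in> H \<Longrightarrow> ip x y = ipK (\<phi> x) (\<phi> y)"
  shows "hilbert H ip"
proof -
  interpret K: hilbert K ipK by (rule K)
  have \<phi>: "x \<in> H \<Longrightarrow> \<phi> x \<in> K" for x using im by blast
  interpret semi_inner H ip
    by unfold_locales (simp_all add: zero add scale ip \<phi> linear_on_add[OF lin] linear_on_scale[OF lin]
        K.ip_add_left K.ip_scale_left K.ip_nonneg, rule K.ip_sym, simp_all add: \<phi>)
  have \<phi>0: "\<phi> 0 = 0" by (rule linear_on_zero[OF lin])
  interpret inner_space H ip
  proof
    fix x assume x: "x \<in> H" "ip x x = 0"
    then have "\<phi> x = \<phi> 0" using K.ip_definite[OF \<phi>] by (simp add: ip \<phi>0)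
    then show "x = 0" using inj x(1) zero by (simp add: inj_on_eq_iff)
  qed
  have nrm: "nrm ip (x - y) = nrm ipK (\<phi> x - \<phi> y)" if "x \<in> H" "y \<in> H" for x y
    using that by (simp add: nrm_def ip diff_mem linear_on_diff[OF lin])
  show ?thesis
  proof
    fix X :: "nat \<Rightarrow> 'a"
    assume X: "\<And>n. X n \<in> H"
      and C: "\<And>e. e > 0 \<Longrightarrow> \<exists>N. \<forall>m\<ge>N. \<forall>n\<ge>N. nrm ip (X m - X n) < e"
    have "\<exists>y. K.converges (\<lambda>n. \<phi> (X n)) y"
      by (rule K.complete) (use C X \<phi> in \<open>simp_all add: nrm\<close>)
    then obtain y where y: "y \<in> K" "(\<lambda>n. nrm ipK (\<phi> (X n) - y)) \<longlonglongrightarrow> 0" by (auto simp: K.converges_def)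
    obtain x where "x \<in> H" "y = \<phi> x" using y(1) im by blast
    then have "converges X x" using y(2) X by (simp add: converges_def nrm)
    then show "\<exists>x. converges X x" ..
  qed
qed

definition dsum :: "nat \<Rightarrow> (nat \<Rightarrow> 'a::cvec set) \<Rightarrow> (nat \<Rightarrow> 'a) set" where
  "dsum n K = {f. (\<forall>j<n. f j \<in> K j) \<and> (\<forall>j\<ge>n. f j = 0)}"

definition dsum_ip :: "nat \<Rightarrow> (nat \<Rightarrow> 'a \<Rightarrow> 'a \<Rightarrow> complex) \<Rightarrow> (nat \<Rightarrow> 'a) \<Rightarrow> (nat \<Rightarrow> 'a) \<Rightarrow> complex" where
  "dsum_ip n ip f g = (\<Sum>j<n. ip j (f j) (g j))"

lemma hilbert_dsum:
  fixes K :: "nat \<Rightarrow> 'a::cvec set"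
  assumes K: "\<And>j. j < n \<Longrightarrow> hilbert (K j) (ip j)"
  shows "hilbert (dsum n K) (dsum_ip n ip)"
proof -
  have K': "inner_space (K j) (ip j)" "semi_inner (K j) (ip j)" if "j < n" for j
    using K[OF that] by (auto simp: hilbert_def inner_space_def)
  interpret semi_inner "dsum n K" "dsum_ip n ip"
  proof
    fix f g h c assume f: "f \<in> dsum n K" and g: "g \<in> dsum n K"
    show "dsum_ip n ip g f = cnj (dsum_ip n ip f g)"
      unfolding dsum_ip_def cnj_sum
      by (intro sum.cong refl semi_inner.ip_sym[OF K'(2)]) (use f g in \<open>simp_all add: dsum_def\<close>)
    show "dsum_ip n ip (cscale c f) g = c * dsum_ip n ip f g"
      using f g by (simp add: dsum_def dsum_ip_def semi_inner.ip_scale_left[OF K'(2)] cscale_fun_def sum_distrib_left)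
    assume h: "h \<in> dsum n K"
    show "dsum_ip n ip (f + g) h = dsum_ip n ip f h + dsum_ip n ip g h"
      using f g h by (simp add: dsum_def dsum_ip_def semi_inner.ip_add_left[OF K'(2)] sum.distrib)
  qed (auto simp: dsum_def dsum_ip_def cscale_fun_def semi_inner.zero_mem[OF K'(2)] semi_inner.add_mem[OF K'(2)]
      semi_inner.scale_mem[OF K'(2)] semi_inner.ip_nonneg[OF K'(2)] intro!: sum_nonneg)
  have sq: "(nrm (dsum_ip n ip) f)\<^sup>2 = (\<Sum>j<n. (nrm (ip j) (f j))\<^sup>2)" if "f \<in> dsum n K" for f
    unfolding nrm_sq[OF that] dsum_ip_def Re_sum
    by (intro sum.cong refl semi_inner.nrm_sq[OF K'(2), symmetric]) (use that in \<open>simp_all add: dsum_def\<close>)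
  have comp: "nrm (ip j) (f j) \<le> nrm (dsum_ip n ip) f" if "f \<in> dsum n K" "j < n" for f j
  proof -
    have "(nrm (ip j) (f j))\<^sup>2 \<le> (\<Sum>j<n. (nrm (ip j) (f j))\<^sup>2)"
      using that by (intro member_le_sum) simp_all
    then show ?thesis unfolding sq[OF that(1), symmetric] using nrm_nonneg[OF that(1)] by (rule power2_le_imp_le)
  qed
  interpret inner_space "dsum n K" "dsum_ip n ip"
  proof
    fix f assume f: "f \<in> dsum n K" and 0: "dsum_ip n ip f f = 0"
    then have "nrm (dsum_ip n ip) f = 0" by (simp add: nrm_def)
    then have z: "f j = 0" if "j < n" for j
    proof -
      have "f j \<in> K j" using f that by (simp add: dsum_def)
      then show ?thesis
        using comp[OF f that] \<open>nrm (dsum_ip n ip) f = 0\<close> inner_space.nrm_eq_0[OF K'(1)[OF that], of "f j"]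
          semi_inner.nrm_nonneg[OF K'(2)[OF that], of "f j"] by linarith
    qed
    show "f = 0"
    proof
      show "f j = 0 j" for j using z f by (cases "j < n") (simp_all add: dsum_def)
    qed
  qed
  show ?thesis
  proof
    fix X :: "nat \<Rightarrow> nat \<Rightarrow> 'a"
    assume X: "\<And>i. X i \<in> dsum n K"
      and C: "\<And>e. e > 0 \<Longrightarrow> \<exists>N. \<forall>l\<ge>N. \<forall>m\<ge>N. nrm (dsum_ip n ip) (X l - X m) < e"
    have "\<exists>x. inner_space.converges (K j) (ip j) (\<lambda>i. X i j) x" if j: "j < n" for j
    proof (rule hilbert.complete[OF K[OF j]])
      show "X i j \<in> K j" for i using X[of i] j by (simp add: dsum_def)
      fix e :: real assume "e > 0"
      then obtain N where N: "\<And>l m. l \<ge> N \<Longrightarrow> m \<ge> N \<Longrightarrow> nrm (dsum_ip n ip) (X l - X m) < e"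
        using C by blast
      have "nrm (ip j) (X l j - X m j) < e" if "l \<ge> N" "m \<ge> N" for l m
        using comp[OF diff_mem[OF X X] j, of l m] N[OF that] by simp
      then show "\<exists>N. \<forall>l\<ge>N. \<forall>m\<ge>N. nrm (ip j) (X l j - X m j) < e" by blast
    qed
    then obtain x where x: "\<And>j. j < n \<Longrightarrow> inner_space.converges (K j) (ip j) (\<lambda>i. X i j) (x j)"
      by metis
    define y where "y j = (if j < n then x j else 0)" for j
    have y: "y \<in> dsum n K"
      using x by (auto simp: y_def dsum_def inner_space.converges_def[OF K'(1)])
    have "(\<lambda>i. (nrm (dsum_ip n ip) (X i - y))\<^sup>2) \<longlonglongrightarrow> (\<Sum>j<n. 0\<^sup>2)"
      unfolding sq[OF diff_mem[OF X y]]
      using x by (intro tendsto_sum tendsto_power) (auto simp: y_def inner_space.converges_def[OF K'(1)])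
    then have "(\<lambda>i. sqrt ((nrm (dsum_ip n ip) (X i - y))\<^sup>2)) \<longlonglongrightarrow> sqrt 0"
      by (intro tendsto_real_sqrt) simp
    then have "(\<lambda>i. nrm (dsum_ip n ip) (X i - y)) \<longlonglongrightarrow> 0"
      using nrm_nonneg[OF diff_mem[OF X y]] by simp
    then show "\<exists>x. converges X x" using y unfolding converges_def by blast
  qed
qed

section \<open>The spaces of holomorphic functions\<close>

text \<open>Squared norm of the k-th monomial in \<open>Hs \<nu>\<close>.\<close>

definition wt :: "real \<Rightarrow> nat \<Rightarrow> real" where
  "wt \<nu> k = fact k / pochhammer \<nu> k"

lemma wt_pos: "0 < \<nu> \<Longrightarrow> 0 < wt \<nu> k"
  by (simp add: wt_def pochhammer_pos)

lemma wt_Suc: "0 < \<nu> \<Longrightarrow> wt \<nu> (Suc k) = (real k + 1) / (\<nu> + real k) * wt \<nu> k"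
  by (simp add: wt_def pochhammer_Suc algebra_simps)

text \<open>The ratio of the two weights is the k-th diagonal entry of the adjoint of the inclusion
  of exponent \<nu>-1 into exponent \<nu>.\<close>

lemma wt_shift:
  assumes "1 < \<nu>"
  shows "wt \<nu> k = (\<nu> - 1) / (\<nu> - 1 + real k) * wt (\<nu> - 1) k"
proof -
  have "(\<nu> - 1) * pochhammer \<nu> k = pochhammer (\<nu> - 1) k * (\<nu> - 1 + real k)"
    using pochhammer_rec[of "\<nu> - 1" k] pochhammer_Suc[of "\<nu> - 1" k] by simp
  then have "pochhammer \<nu> k = pochhammer (\<nu> - 1) k * (\<nu> - 1 + real k) / (\<nu> - 1)"
    using assms by (simp add: eq_divide_eq mult.commute)
  then show ?thesis by (simp add: wt_def mult.commute)
qed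

text \<open>Source of the constant \<nu> (\<nu>-1): it matches the weights of exponents \<nu>-1 and
  \<nu>+1 under differentiation, the derivative accounting for k + 1 and its adjoint for 1 / (\<nu>
  + k).\<close>

lemma wt_shift2:
  assumes "1 < \<nu>"
  shows "wt (\<nu> + 1) k * ((real k + 1) * (\<nu> + real k)) = \<nu> * (\<nu> - 1) * wt (\<nu> - 1) (Suc k)"
proof -
  have "wt (\<nu> + 1) k = \<nu> / (\<nu> + real k) * ((\<nu> - 1) / (\<nu> - 1 + real k) * wt (\<nu> - 1) k)"
    using wt_shift[of "\<nu> + 1" k] wt_shift[of \<nu> k] assms by simp
  moreover have "wt (\<nu> - 1) (Suc k) = (real k + 1) / (\<nu> - 1 + real k) * wt (\<nu> - 1) k"
    using assms by (intro wt_Suc) simp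
  moreover have "\<nu> / a * (c / b * x) * (r * a) = \<nu> * c * (r / b * x)" if "a \<noteq> 0" for a b c r x :: real
    using that by simp
  moreover have "\<nu> + real k \<noteq> 0" using assms by simp
  ultimately show ?thesis by (simp only:)
qed

lemma kernel_sums:
  fixes x :: complex
  assumes "norm x < 1"
  shows "(\<lambda>k. of_real (1 / wt \<nu> k) * x ^ k) sums ((1 - x) powr (- of_real \<nu>))"
proof -
  have "(\<lambda>k. (- of_real \<nu> gchoose k) * (- x) ^ k) sums ((1 + - x) powr (- of_real \<nu>))"
    using assms by (intro gen_binomial_complex) simp
  moreover have "(- of_real \<nu> gchoose k) * (- x) ^ k = of_real (1 / wt \<nu> k) * x ^ k" for k
  proof -
    have "(-1 :: complex) ^ k * (-1) ^ k = 1" by (simp flip: power_mult_distrib)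
    then show ?thesis
      by (simp add: wt_def gbinomial_pochhammer power_minus[of x] pochhammer_of_real[symmetric])
  qed
  ultimately show ?thesis by simp
qed

lemma kernel_coeff_summable:
  assumes "0 \<le> r" "r < 1" "0 < \<nu>"
  shows "summable (\<lambda>k. r ^ k / wt \<nu> k)"
proof -
  have "summable (\<lambda>k. of_real (1 / wt \<nu> k) * of_real r ^ k :: complex)"
    using kernel_sums[of "of_real r" \<nu>] assms by (auto simp: sums_iff)
  then have "summable (\<lambda>k. of_real (r ^ k / wt \<nu> k) :: complex)" by simp
  then show ?thesis by (simp only: summable_of_real_iff)
qed

text \<open>Writing a term as sqrt (wt) |a_k| times |w|^k / sqrt (wt) and using u v \<le> u^2 + v^2
  leaves the norm series of \<open>a\<close> and the kernel series at |w|^2.\<close>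

lemma wl2_powser_summable:
  assumes a: "a \<in> wl2 (wt \<nu>)" and \<nu>: "0 < \<nu>" and w: "norm w < 1"
  shows "summable (\<lambda>k. norm (a k * w ^ k))"
proof (rule summable_comparison_test'[where N = 0])
  have "(norm w)\<^sup>2 < 1" using w by (simp add: abs_square_less_1)
  then show "summable (\<lambda>k. wt \<nu> k * (cmod (a k))\<^sup>2 + ((norm w)\<^sup>2) ^ k / wt \<nu> k)"
    using a \<nu> by (intro summable_add kernel_coeff_summable) (simp_all add: wl2_def)
  fix k
  have p: "0 < wt \<nu> k" using \<nu> by (rule wt_pos)
  define u where "u = sqrt (wt \<nu> k) * cmod (a k)"
  define v where "v = norm w ^ k / sqrt (wt \<nu> k)"
  have "0 \<le> u * v" using p by (simp add: u_def v_def)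
  then have "u * v \<le> u\<^sup>2 + v\<^sup>2"
    using sum_squares_bound[of u v] unfolding mult.assoc by linarith
  moreover have "u * v = norm (a k * w ^ k)" using p by (simp add: u_def v_def norm_mult norm_power)
  moreover have "u\<^sup>2 = wt \<nu> k * (cmod (a k))\<^sup>2" using p by (simp add: u_def power_mult_distrib)
  moreover have "v\<^sup>2 = ((norm w)\<^sup>2) ^ k / wt \<nu> k"
    using p by (simp add: v_def power_divide) (simp flip: power_mult add: mult.commute)
  ultimately show "norm (norm (a k * w ^ k)) \<le> wt \<nu> k * (cmod (a k))\<^sup>2 + ((norm w)\<^sup>2) ^ k / wt \<nu> k"
    by simp
qed

lemma tcoef_sums:
  assumes "f holomorphic_on ball 0 1" "norm w < 1"
  shows "(\<lambda>k. tcoef f k * w ^ k) sums f w"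
  using holomorphic_power_series[of f 0 1 w] assms by (simp add: tcoef_def)

text \<open>A series that represents \<open>f\<close> on the whole disc has radius at least 1 and is
  therefore the formal expansion of \<open>f\<close> at 0. Taylor coefficients of concrete functions
  are read off from convergent sums in this way.\<close>

lemma tcoef_eqI:
  assumes "\<And>w. norm w < 1 \<Longrightarrow> (\<lambda>k. a k * w ^ k) sums f w"
  shows "tcoef f = a"
proof
  fix k
  have r: "conv_radius a \<ge> 1"
  proof (rule conv_radius_geI_ex')
    fix r :: real assume "0 < r" "ereal r < 1"
    then show "summable (\<lambda>n. a n * of_real r ^ n)" using assms[of "of_real r"] by (auto simp: sums_iff)
  qed
  have "f has_fps_expansion Abs_fps a"
    unfolding has_fps_expansion_def
  proof
    show "0 < fps_conv_radius (Abs_fps a)" using r unfolding fps_conv_radius_def by (auto intro: less_le_trans[of _ 1])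
    have "\<forall>\<^sub>F w in nhds 0. w \<in> ball (0::complex) 1" by (intro eventually_nhds_in_open) auto
    then show "\<forall>\<^sub>F w in nhds 0. eval_fps (Abs_fps a) w = f w"
      by eventually_elim (use assms in \<open>simp add: eval_fps_def sums_iff\<close>)
  qed
  from fps_nth_fps_expansion[OF this, of k] show "tcoef f k = a k" by (simp add: tcoef_def)
qed

text \<open>Inverse of \<open>tcoef\<close>; the cut-off outside the disc gives the representative
  that \<open>Hs\<close> prescribes.\<close>

definition pser :: "(nat \<Rightarrow> complex) \<Rightarrow> complex \<Rightarrow> complex" where
  "pser a = dres (\<lambda>w. \<Sum>k. a k * w ^ k)"

lemma Hs_iff: "f \<in> Hs \<nu> \<longleftrightarrow> f holomorphic_on ball 0 1 \<and> (\<forall>w. w \<notin> ball 0 1 \<longrightarrow> f w = 0) \<and> tcoef f \<in> wl2 (wt \<nu>)"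
  by (simp add: Hs_def wl2_def wt_def mult.commute)

lemma Hip_eq: "Hip \<nu> f g = wl2_ip (wt \<nu>) (tcoef f) (tcoef g)"
  by (simp add: Hip_def wl2_ip_def wt_def)

lemma Hs_holomorphic: "f \<in> Hs \<nu> \<Longrightarrow> f holomorphic_on ball 0 1"
  and Hs_off: "f \<in> Hs \<nu> \<Longrightarrow> norm w \<ge> 1 \<Longrightarrow> f w = 0"
  and Hs_tcoef: "f \<in> Hs \<nu> \<Longrightarrow> tcoef f \<in> wl2 (wt \<nu>)"
  by (simp_all add: Hs_iff)

lemma pser_sums:
  assumes "a \<in> wl2 (wt \<nu>)" "0 < \<nu>" "norm w < 1"
  shows "(\<lambda>k. a k * w ^ k) sums pser a w"
  using summable_norm_cancel[OF wl2_powser_summable[OF assms]] assms(3)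
  by (simp add: pser_def dres_def summable_sums)

lemma tcoef_pser: "a \<in> wl2 (wt \<nu>) \<Longrightarrow> 0 < \<nu> \<Longrightarrow> tcoef (pser a) = a"
  by (rule tcoef_eqI) (rule pser_sums)

lemma pser_in_Hs:
  assumes "a \<in> wl2 (wt \<nu>)" "0 < \<nu>"
  shows "pser a \<in> Hs \<nu>"
  unfolding Hs_iff tcoef_pser[OF assms]
proof (intro conjI assms(1))
  show "pser a holomorphic_on ball 0 1"
    using pser_sums[OF assms] by (intro power_series_holomorphic[where a = a]) simp
qed (simp add: pser_def dres_def)

text \<open>Two exponents occur because the two sides are often known to lie in different spaces, as
  when an element of a smaller space is compared with 0.\<close>

lemma Hs_eqI:
  assumes "f \<in> Hs \<nu>" "g \<in> Hs \<nu>'" "\<And>k. tcoef f k = tcoef g k"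
  shows "f = g"
proof
  fix w
  show "f w = g w"
  proof (cases "norm w < 1")
    case True
    have "(\<lambda>k. tcoef f k * w ^ k) sums f w" "(\<lambda>k. tcoef g k * w ^ k) sums g w"
      using tcoef_sums[OF Hs_holomorphic True] assms(1,2) by blast+
    then show ?thesis using assms(3) by (simp add: sums_iff)
  qed (simp add: Hs_off[OF assms(1)] Hs_off[OF assms(2)])
qed

lemma tcoef_add:
  assumes "f holomorphic_on ball 0 1" "g holomorphic_on ball 0 1"
  shows "tcoef (f + g) k = tcoef f k + tcoef g k"
proof -
  have "tcoef (f + g) = (\<lambda>k. tcoef f k + tcoef g k)"
    using assms by (intro tcoef_eqI) (simp add: distrib_right tcoef_sums sums_add)
  then show ?thesis by simp
qed

lemma tcoef_scale:
  assumes "f holomorphic_on ball 0 1"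
  shows "tcoef (cscale c f) k = c * tcoef f k"
proof -
  have "tcoef (cscale c f) = (\<lambda>k. c * tcoef f k)"
    using assms by (intro tcoef_eqI) (simp add: cscale_fun_def cscale_complex_def mult.assoc tcoef_sums sums_mult)
  then show ?thesis by simp
qed

lemma tcoef_zero: "tcoef 0 = 0"
  by (rule tcoef_eqI) simp

lemma Hs_zero: "0 \<in> Hs \<nu>"
  by (simp add: Hs_iff tcoef_zero wl2_def) (simp add: zero_fun_def)

lemma
  assumes \<nu>: "0 < \<nu>"
  shows Hs_add: "f \<in> Hs \<nu> \<Longrightarrow> g \<in> Hs \<nu> \<Longrightarrow> f + g \<in> Hs \<nu>"
    and Hs_scale: "f \<in> Hs \<nu> \<Longrightarrow> cscale c f \<in> Hs \<nu>"
    and hilbert_Hs: "hilbert (Hs \<nu>) (Hip \<nu>)"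
proof -
  interpret W: hilbert "wl2 (wt \<nu>)" "wl2_ip (wt \<nu>)" by (rule hilbert_wl2) (rule wt_pos[OF \<nu>])
  show add: "f + g \<in> Hs \<nu>" if "f \<in> Hs \<nu>" "g \<in> Hs \<nu>" for f g
  proof -
    have "tcoef (f + g) = tcoef f + tcoef g" using that by (auto simp: tcoef_add Hs_holomorphic)
    then show ?thesis
      using that W.add_mem holomorphic_on_add[of f "ball 0 1" g]
      by (simp add: Hs_iff plus_fun_def)
  qed
  have ts: "tcoef (cscale c f) = cscale c (tcoef f)" if "f \<in> Hs \<nu>" for f c
    using that by (auto simp: tcoef_scale Hs_holomorphic cscale_fun_def[where 'a = nat] cscale_complex_def)
  show scale: "cscale c f \<in> Hs \<nu>" if "f \<in> Hs \<nu>" for f c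
  proof -
    have "(\<lambda>w. c * f w) holomorphic_on ball 0 1" using that by (intro holomorphic_intros Hs_holomorphic)
    moreover have "cscale c f = (\<lambda>w. c * f w)" by (simp add: cscale_fun_def cscale_complex_def)
    ultimately show ?thesis using ts[OF that, of c] W.scale_mem[OF Hs_tcoef[OF that], of c] that by (simp add: Hs_iff)
  qed
  show "hilbert (Hs \<nu>) (Hip \<nu>)"
  proof (rule hilbert_transport[OF W.hilbert_axioms Hs_zero add scale, where \<phi> = tcoef])
    show "linear_on (Hs \<nu>) tcoef"
      unfolding linear_on_def by (auto simp: ts) (auto simp: tcoef_add Hs_holomorphic)
    show "tcoef ` Hs \<nu> = wl2 (wt \<nu>)"
    proof
      show "tcoef ` Hs \<nu> \<subseteq> wl2 (wt \<nu>)" using Hs_tcoef by auto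
      show "wl2 (wt \<nu>) \<subseteq> tcoef ` Hs \<nu>"
        using pser_in_Hs tcoef_pser \<nu> by (metis (no_types, lifting) image_eqI subsetI)
    qed
    show "inj_on tcoef (Hs \<nu>)" by (rule inj_onI) (metis Hs_eqI)
  qed (simp_all add: Hip_eq)
qed

lemma tcoef_mult_id:
  assumes "f holomorphic_on ball 0 1"
  shows "tcoef (\<lambda>w. w * f w) = (\<lambda>k. if k = 0 then 0 else tcoef f (k - 1))"
proof (rule tcoef_eqI)
  fix w :: complex assume w: "norm w < 1"
  have "(\<lambda>k. w * (tcoef f k * w ^ k)) sums (w * f w)" using assms w by (intro sums_mult tcoef_sums)
  then have "(\<lambda>k. (if Suc k = 0 then 0 else tcoef f (Suc k - 1)) * w ^ Suc k) sums (w * f w)"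
    by (simp add: mult_ac)
  then show "(\<lambda>k. (if k = 0 then 0 else tcoef f (k - 1)) * w ^ k) sums (w * f w)"
    by (subst (asm) sums_Suc_iff) simp
qed

lemma dres_holomorphic:
  assumes "f holomorphic_on ball 0 1"
  shows "dres f holomorphic_on ball 0 1"
  using assms by (rule holomorphic_transform) (simp add: dres_def)

lemma tcoef_dres:
  assumes "f holomorphic_on ball 0 1"
  shows "tcoef (dres f) = tcoef f"
  using tcoef_sums[OF assms] by (intro tcoef_eqI) (simp add: dres_def)

lemma tcoef_dop1:
  assumes "f holomorphic_on ball 0 1"
  shows "tcoef (dop 1 f) k = of_nat (Suc k) * tcoef f (Suc k)"
proof -
  have "tcoef (dop 1 f) k = tcoef (deriv f) k"
    unfolding dop_def using assms by (simp add: tcoef_dres holomorphic_deriv)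
  also have "\<dots> = of_nat (Suc k) * tcoef f (Suc k)"
    unfolding tcoef_def fact_Suc of_nat_mult
    by (simp add: funpow_Suc_right del: funpow.simps(2) of_nat_Suc fact_Suc)
  finally show ?thesis .
qed

lemma dop_holomorphic: "f holomorphic_on ball 0 1 \<Longrightarrow> dop n f holomorphic_on ball 0 1"
  unfolding dop_def by (intro dres_holomorphic holomorphic_higher_deriv) auto

text \<open>\<open>dop\<close> cuts off after each application, but a derivative at a point of the
  open disc depends only on values nearby.\<close>

lemma dop_Suc:
  assumes "f holomorphic_on ball 0 1"
  shows "dop (Suc n) f = dop 1 (dop n f)"
proof
  fix w
  show "dop (Suc n) f w = dop 1 (dop n f) w"
  proof (cases "norm w < 1")
    case True
    have "deriv (dop n f) w = deriv ((deriv ^^ n) f) w"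
    proof (rule complex_derivative_transform_within_open)
      show "dop n f holomorphic_on ball 0 1" using assms by (rule dop_holomorphic)
      show "(deriv ^^ n) f holomorphic_on ball 0 1" using assms by (intro holomorphic_higher_deriv) auto
    qed (use True in \<open>simp_all add: dop_def dres_def\<close>)
    then show ?thesis using True by (simp add: dop_def dres_def)
  qed (simp add: dop_def dres_def)
qed

lemma dop_off: "norm w \<ge> 1 \<Longrightarrow> dop n f w = 0"
  by (simp add: dop_def dres_def)

section \<open>One weight: the unitary colligation of multiplication by the coordinate\<close>

lemma wl2_comparison:
  assumes a: "a \<in> wl2 w" and w': "\<And>k. 0 \<le> w' k"
    and le: "\<And>k. w' k * (cmod (b k))\<^sup>2 \<le> C * (w k * (cmod (a k))\<^sup>2)"
  shows "b \<in> wl2 w'"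
  unfolding wl2_def mem_Collect_eq
proof (rule summable_comparison_test'[where N = 0])
  show "summable (\<lambda>k. C * (w k * (cmod (a k))\<^sup>2))" using a by (intro summable_mult) (simp add: wl2_def)
  show "norm (w' k * (cmod (b k))\<^sup>2) \<le> C * (w k * (cmod (a k))\<^sup>2)" for k
    using le[of k] w'[of k] by simp
qed

lemma wl2_Suc_iff: "a \<in> wl2 w \<longleftrightarrow> (\<lambda>k. a (Suc k)) \<in> wl2 (\<lambda>k. w (Suc k))"
  by (simp add: wl2_def summable_Suc_iff[of "\<lambda>k. w k * (cmod (a k))\<^sup>2"])

lemma wl2_ip_Suc:
  assumes "\<And>k. 0 < w k" "a \<in> wl2 w" "b \<in> wl2 w" "a 0 * cnj (b 0) = 0"
  shows "wl2_ip w a b = wl2_ip (\<lambda>k. w (Suc k)) (\<lambda>k. a (Suc k)) (\<lambda>k. b (Suc k))"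
  unfolding wl2_ip_def using suminf_split_head[OF wl2_ip_summable[OF assms(1-3)]] assms(4) by simp

text \<open>The bound keeps the exponent \<nu>-1 of the input space positive.\<close>

locale weight =
  fixes \<nu> :: real
  assumes weight_gt_1: "1 < \<nu>"
begin

definition s :: real where "s = sqrt (\<nu> * (\<nu> - 1))"

lemma s_pos: "0 < s"
  using weight_gt_1 by (simp add: s_def)

lemma s_sq: "s * s = \<nu> * (\<nu> - 1)"
  using weight_gt_1 by (simp add: s_def)

lemma wt_\<nu>_pos: "0 < wt \<nu> k" "0 < wt (\<nu> - 1) k" "0 < wt (\<nu> + 1) k"
  using weight_gt_1 by (auto intro: wt_pos)

abbreviation Hm where "Hm \<equiv> Hs (\<nu> - 1)"
abbreviation H0 where "H0 \<equiv> Hs \<nu>"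
abbreviation Hp where "Hp \<equiv> Hs (\<nu> + 1)"

sublocale Hm: hilbert Hm "Hip (\<nu> - 1)" by (rule hilbert_Hs) (use weight_gt_1 in simp)
sublocale H0: hilbert H0 "Hip \<nu>" by (rule hilbert_Hs) (use weight_gt_1 in simp)
sublocale Hp: hilbert Hp "Hip (\<nu> + 1)" by (rule hilbert_Hs) (use weight_gt_1 in simp)

text \<open>Adjoint of the inclusion of \<open>Hm\<close> into \<open>H0\<close>. That inclusion is
  the input block J; it is the identity on functions and gets no name.\<close>

definition J' :: "(complex \<Rightarrow> complex) \<Rightarrow> complex \<Rightarrow> complex" where
  "J' f = pser (\<lambda>k. of_real ((\<nu> - 1) / (\<nu> - 1 + real k)) * tcoef f k)"

lemma J_mem: "f \<in> Hm \<Longrightarrow> f \<in> H0"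
proof -
  assume f: "f \<in> Hm"
  have "wt \<nu> k * (cmod (tcoef f k))\<^sup>2 \<le> 1 * (wt (\<nu> - 1) k * (cmod (tcoef f k))\<^sup>2)" for k
    unfolding wt_shift[OF weight_gt_1] mult_1 using weight_gt_1 wt_pos[of "\<nu> - 1" k]
    by (intro mult_right_mono mult_left_le_one_le) (auto simp: divide_simps)
  then have "tcoef f \<in> wl2 (wt \<nu>)"
    by (intro wl2_comparison[OF Hs_tcoef[OF f], of _ _ 1] less_imp_le[OF wt_\<nu>_pos(1)])
  then show ?thesis using f by (simp add: Hs_iff)
qed

lemma J'_aux:
  assumes f: "f \<in> H0"
  shows "(\<lambda>k. of_real ((\<nu> - 1) / (\<nu> - 1 + real k)) * tcoef f k) \<in> wl2 (wt (\<nu> - 1))"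
proof (rule wl2_comparison[OF Hs_tcoef[OF f]])
  show "0 \<le> wt (\<nu> - 1) k" for k using wt_pos[of "\<nu> - 1" k] weight_gt_1 by simp
  fix k
  define r where "r = (\<nu> - 1) / (\<nu> - 1 + real k)"
  have r: "0 \<le> r" "r \<le> 1" using weight_gt_1 by (auto simp: r_def divide_simps)
  have "wt (\<nu> - 1) k * (cmod (of_real r * tcoef f k))\<^sup>2 = r * (wt \<nu> k * (cmod (tcoef f k))\<^sup>2)"
    using r(1) by (simp add: wt_shift[OF weight_gt_1] r_def[symmetric] norm_mult power_mult_distrib power2_eq_square)
  also have "\<dots> \<le> 1 * (wt \<nu> k * (cmod (tcoef f k))\<^sup>2)"
    using r wt_pos[of \<nu> k] weight_gt_1 by (intro mult_right_mono) auto
  finally show "wt (\<nu> - 1) k * (cmod (of_real ((\<nu> - 1) / (\<nu> - 1 + real k)) * tcoef f k))\<^sup>2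
      \<le> 1 * (wt \<nu> k * (cmod (tcoef f k))\<^sup>2)" unfolding r_def .
qed

lemma J'_mem: "f \<in> H0 \<Longrightarrow> J' f \<in> Hm"
  unfolding J'_def using weight_gt_1 by (intro pser_in_Hs J'_aux) auto

lemma tcoef_J': "f \<in> H0 \<Longrightarrow> tcoef (J' f) k = of_real ((\<nu> - 1) / (\<nu> - 1 + real k)) * tcoef f k"
  unfolding J'_def using tcoef_pser[OF J'_aux] weight_gt_1 by simp

lemma J_adj: "f \<in> Hm \<Longrightarrow> g \<in> H0 \<Longrightarrow> Hip \<nu> f g = Hip (\<nu> - 1) f (J' g)"
  unfolding Hip_eq wl2_ip_def by (simp add: tcoef_J' wt_shift[OF weight_gt_1] mult_ac)

lemma weight_Suc: "weight (\<nu> + 1)"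
  using weight_gt_1 by unfold_locales simp

definition T :: "(complex \<Rightarrow> complex) \<Rightarrow> complex \<Rightarrow> complex" where "T f = (\<lambda>w. w * f w)"

text \<open>The factor is the quotient of consecutive weights, which makes this weighted backward
  shift the adjoint of \<open>T\<close>.\<close>

definition T' :: "(complex \<Rightarrow> complex) \<Rightarrow> complex \<Rightarrow> complex" where
  "T' f = pser (\<lambda>k. of_real ((real k + 1) / (\<nu> + real k)) * tcoef f (Suc k))"

text \<open>The factor is sqrt ((\<nu>-1) / \<nu>) in modulus, so that T' T + L' L = 1 becomes (k+1)
  / (\<nu>+k) + (\<nu>-1) / (\<nu>+k) = 1 on the k-th coefficient. The minus sign makes T' J + L' B
  vanish.\<close>

definition L :: "(complex \<Rightarrow> complex) \<Rightarrow> complex \<Rightarrow> complex" where "L f = cscale (- of_real ((\<nu> - 1) / s)) f"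

text \<open>The inclusion of \<open>H0\<close> into \<open>Hp\<close> is the block J of exponent
  \<nu>+1, so its adjoint is taken from there.\<close>

definition L' :: "(complex \<Rightarrow> complex) \<Rightarrow> complex \<Rightarrow> complex" where
  "L' g = cscale (- of_real ((\<nu> - 1) / s)) (weight.J' (\<nu> + 1) g)"

definition B :: "(complex \<Rightarrow> complex) \<Rightarrow> complex \<Rightarrow> complex" where "B f = cscale (of_real (1 / s)) (dop 1 f)"

text \<open>Adjoint of \<open>B\<close>: since differentiation lowers the degree, it raises the
  degree by one; the factor comes from \<open>wt_shift2\<close>.\<close>

definition B' :: "(complex \<Rightarrow> complex) \<Rightarrow> complex \<Rightarrow> complex" where
  "B' g = pser (\<lambda>k. if k = 0 then 0 else of_real (s / (\<nu> + real (k - 1))) * tcoef g (k - 1))"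

lemma tcoef_T: "f \<in> H0 \<Longrightarrow> tcoef (T f) k = (if k = 0 then 0 else tcoef f (k - 1))"
  unfolding T_def using tcoef_mult_id[OF Hs_holomorphic] by simp

lemma ratio_le: "0 \<le> (real k + 1) / (\<nu> + real k)" "(real k + 1) / (\<nu> + real k) \<le> 1"
  using weight_gt_1 by (auto simp: divide_simps)

lemma wt_\<nu>_Suc: "wt \<nu> (Suc k) = (real k + 1) / (\<nu> + real k) * wt \<nu> k"
  using weight_gt_1 by (intro wt_Suc) simp

lemma T_mem:
  assumes f: "f \<in> H0"
  shows "T f \<in> H0"
proof -
  have "tcoef (T f) \<in> wl2 (wt \<nu>)"
  proof (subst wl2_Suc_iff, rule wl2_comparison[OF Hs_tcoef[OF f]])
    show "0 \<le> wt \<nu> (Suc k)" for k using wt_\<nu>_pos(1)[of "Suc k"] by simp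
    show "wt \<nu> (Suc k) * (cmod (tcoef (T f) (Suc k)))\<^sup>2 \<le> 1 * (wt \<nu> k * (cmod (tcoef f k))\<^sup>2)" for k
    proof -
      have "wt \<nu> (Suc k) \<le> wt \<nu> k"
        unfolding wt_\<nu>_Suc using ratio_le[of k] wt_\<nu>_pos(1)[of k] by (intro mult_left_le_one_le) auto
      from mult_right_mono[OF this, of "(cmod (tcoef f k))\<^sup>2"] show ?thesis using f by (simp add: tcoef_T)
    qed
  qed
  then show ?thesis
    using f by (auto simp: Hs_iff T_def intro!: holomorphic_intros)
qed

lemma T'_aux:
  assumes f: "f \<in> H0"
  shows "(\<lambda>k. of_real ((real k + 1) / (\<nu> + real k)) * tcoef f (Suc k)) \<in> wl2 (wt \<nu>)"
proof (rule wl2_comparison[OF Hs_tcoef[OF f, unfolded wl2_Suc_iff[of "tcoef f"]]])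
  show "0 \<le> wt \<nu> k" for k using wt_\<nu>_pos(1)[of k] by simp
  fix k
  define r where "r = (real k + 1) / (\<nu> + real k)"
  have "0 \<le> r" "r \<le> 1" using ratio_le by (simp_all add: r_def)
  have "wt \<nu> k * (cmod (of_real r * tcoef f (Suc k)))\<^sup>2 = r * (wt \<nu> (Suc k) * (cmod (tcoef f (Suc k)))\<^sup>2)"
    using \<open>0 \<le> r\<close> unfolding wt_\<nu>_Suc r_def[symmetric]
    by (simp add: norm_mult power_mult_distrib power2_eq_square)
  also have "\<dots> \<le> 1 * (wt \<nu> (Suc k) * (cmod (tcoef f (Suc k)))\<^sup>2)"
    using \<open>r \<le> 1\<close> wt_\<nu>_pos(1)[of "Suc k"] by (intro mult_right_mono) auto
  finally show "wt \<nu> k * (cmod (of_real ((real k + 1) / (\<nu> + real k)) * tcoef f (Suc k)))\<^sup>2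
      \<le> 1 * (wt \<nu> (Suc k) * (cmod (tcoef f (Suc k)))\<^sup>2)" unfolding r_def .
qed

lemma T'_mem: "f \<in> H0 \<Longrightarrow> T' f \<in> H0"
  unfolding T'_def using weight_gt_1 by (intro pser_in_Hs T'_aux) auto

lemma tcoef_T': "f \<in> H0 \<Longrightarrow> tcoef (T' f) k = of_real ((real k + 1) / (\<nu> + real k)) * tcoef f (Suc k)"
  unfolding T'_def using tcoef_pser[OF T'_aux] weight_gt_1 by simp

lemma T_adj:
  assumes "f \<in> H0" "g \<in> H0"
  shows "Hip \<nu> (T f) g = Hip \<nu> f (T' g)"
proof -
  have "wl2_ip (wt \<nu>) (tcoef (T f)) (tcoef g)
      = wl2_ip (\<lambda>k. wt \<nu> (Suc k)) (\<lambda>k. tcoef (T f) (Suc k)) (\<lambda>k. tcoef g (Suc k))"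
    using assms by (intro wl2_ip_Suc wt_\<nu>_pos Hs_tcoef T_mem) (simp_all add: tcoef_T)
  then show ?thesis
    unfolding Hip_eq using assms by (simp add: wl2_ip_def tcoef_T tcoef_T' wt_\<nu>_Suc mult_ac)
qed

lemma L_mem: "f \<in> H0 \<Longrightarrow> L f \<in> Hp"
  unfolding L_def using weight.J_mem[OF weight_Suc, of f] Hp.scale_mem by simp

lemma tcoef_L: "f \<in> H0 \<Longrightarrow> tcoef (L f) k = - of_real ((\<nu> - 1) / s) * tcoef f k"
  unfolding L_def by (simp add: tcoef_scale Hs_holomorphic)

lemma L'_mem: "g \<in> Hp \<Longrightarrow> L' g \<in> H0"
  unfolding L'_def using weight.J'_mem[OF weight_Suc, of g] H0.scale_mem by simp

lemma tcoef_L': "g \<in> Hp \<Longrightarrow> tcoef (L' g) k = - of_real ((\<nu> - 1) / s) * (of_real (\<nu> / (\<nu> + real k)) * tcoef g k)"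
  unfolding L'_def using weight.tcoef_J'[OF weight_Suc, of g k] weight.J'_mem[OF weight_Suc, of g]
  by (simp add: tcoef_scale Hs_holomorphic)

lemma L_adj: "f \<in> H0 \<Longrightarrow> g \<in> Hp \<Longrightarrow> Hip (\<nu> + 1) (L f) g = Hip \<nu> f (L' g)"
  unfolding L_def L'_def
  using weight.J_adj[OF weight_Suc, of f g] weight.J_mem[OF weight_Suc, of f] weight.J'_mem[OF weight_Suc, of g]
  by (simp add: Hp.ip_scale_left H0.ip_scale_right)

text \<open>By \<open>wt_shift2\<close> the squared norm grows at most by \<nu> (\<nu>-1), the
  remaining factor (k+1) / (\<nu>+k) being at most 1.\<close>

lemma dop1_mem:
  assumes f: "f \<in> Hm"
  shows "dop 1 f \<in> Hp"
proof -
  have "tcoef (dop 1 f) \<in> wl2 (wt (\<nu> + 1))"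
  proof (rule wl2_comparison[OF Hs_tcoef[OF f, unfolded wl2_Suc_iff[of "tcoef f"]]])
    show "0 \<le> wt (\<nu> + 1) k" for k using wt_\<nu>_pos(3)[of k] by simp
    fix k
    define r where "r = (real k + 1) / (\<nu> + real k)"
    have "wt (\<nu> + 1) k * (real k + 1)\<^sup>2 = r * (\<nu> * (\<nu> - 1) * wt (\<nu> - 1) (Suc k))"
      unfolding wt_shift2[OF weight_gt_1, symmetric] r_def using weight_gt_1 by (simp add: power2_eq_square)
    also have "\<dots> \<le> \<nu> * (\<nu> - 1) * wt (\<nu> - 1) (Suc k)"
      using ratio_le[of k] weight_gt_1 wt_\<nu>_pos(2)[of "Suc k"] unfolding r_def by (intro mult_left_le_one_le) auto
    finally have "wt (\<nu> + 1) k * (real k + 1)\<^sup>2 * (cmod (tcoef f (Suc k)))\<^sup>2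
        \<le> \<nu> * (\<nu> - 1) * wt (\<nu> - 1) (Suc k) * (cmod (tcoef f (Suc k)))\<^sup>2"
      by (rule mult_right_mono) simp
    moreover have "cmod (tcoef (dop 1 f) k) = (real k + 1) * cmod (tcoef f (Suc k))"
      unfolding tcoef_dop1[OF Hs_holomorphic[OF f]] norm_mult norm_of_nat by simp
    ultimately show "wt (\<nu> + 1) k * (cmod (tcoef (dop 1 f) k))\<^sup>2
        \<le> \<nu> * (\<nu> - 1) * (wt (\<nu> - 1) (Suc k) * (cmod (tcoef f (Suc k)))\<^sup>2)"
      by (simp add: power_mult_distrib mult_ac)
  qed
  then show ?thesis
    using dop_holomorphic[OF Hs_holomorphic[OF f]] dop_off by (auto simp: Hs_iff)
qed

lemma B_mem: "f \<in> Hm \<Longrightarrow> B f \<in> Hp"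
  unfolding B_def by (intro Hp.scale_mem dop1_mem)

lemma tcoef_B: "f \<in> Hm \<Longrightarrow> tcoef (B f) k = of_real (1 / s) * (of_nat (Suc k) * tcoef f (Suc k))"
  unfolding B_def using tcoef_dop1[OF Hs_holomorphic, of f] by (simp add: tcoef_scale dop_holomorphic Hs_holomorphic)

lemma B'_aux:
  assumes g: "g \<in> Hp"
  shows "(\<lambda>k. if k = 0 then 0 else of_real (s / (\<nu> + real (k - 1))) * tcoef g (k - 1)) \<in> wl2 (wt (\<nu> - 1))"
proof (subst wl2_Suc_iff, rule wl2_comparison[OF Hs_tcoef[OF g]])
  show "0 \<le> wt (\<nu> - 1) (Suc k)" for k using wt_\<nu>_pos(2)[of "Suc k"] by simp
  fix k
  have "wt (\<nu> - 1) (Suc k) * (s / (\<nu> + real k))\<^sup>2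
      = (\<nu> * (\<nu> - 1) * wt (\<nu> - 1) (Suc k)) / ((\<nu> + real k) * (\<nu> + real k))"
    by (simp add: power2_eq_square s_sq mult_ac)
  also have "\<dots> = (real k + 1) / (\<nu> + real k) * wt (\<nu> + 1) k"
    unfolding wt_shift2[OF weight_gt_1, symmetric] using weight_gt_1 by simp
  also have "\<dots> \<le> wt (\<nu> + 1) k"
    using ratio_le[of k] wt_\<nu>_pos(3)[of k] by (intro mult_left_le_one_le) auto
  finally have "wt (\<nu> - 1) (Suc k) * (s / (\<nu> + real k))\<^sup>2 * (cmod (tcoef g k))\<^sup>2
      \<le> wt (\<nu> + 1) k * (cmod (tcoef g k))\<^sup>2"
    by (rule mult_right_mono) simp
  moreover have "(cmod (of_real (s / (\<nu> + real k)) * tcoef g k))\<^sup>2 = (s / (\<nu> + real k))\<^sup>2 * (cmod (tcoef g k))\<^sup>2"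
    by (simp only: norm_mult power_mult_distrib norm_of_real power2_abs)
  ultimately show "wt (\<nu> - 1) (Suc k)
      * (cmod (if Suc k = 0 then 0 else of_real (s / (\<nu> + real (Suc k - 1))) * tcoef g (Suc k - 1)))\<^sup>2
      \<le> 1 * (wt (\<nu> + 1) k * (cmod (tcoef g k))\<^sup>2)"
    by (simp only: nat.simps if_False diff_Suc_1 mult.assoc mult_1)
qed

lemma B'_mem: "g \<in> Hp \<Longrightarrow> B' g \<in> Hm"
  unfolding B'_def using weight_gt_1 by (intro pser_in_Hs B'_aux) auto

lemma tcoef_B': "g \<in> Hp \<Longrightarrow>
    tcoef (B' g) k = (if k = 0 then 0 else of_real (s / (\<nu> + real (k - 1))) * tcoef g (k - 1))"
  unfolding B'_def using tcoef_pser[OF B'_aux] weight_gt_1 by simp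

lemma B_adj:
  assumes f: "f \<in> Hm" and g: "g \<in> Hp"
  shows "Hip (\<nu> + 1) (B f) g = Hip (\<nu> - 1) f (B' g)"
proof -
  have "wl2_ip (wt (\<nu> - 1)) (tcoef f) (tcoef (B' g))
      = wl2_ip (\<lambda>k. wt (\<nu> - 1) (Suc k)) (\<lambda>k. tcoef f (Suc k)) (\<lambda>k. tcoef (B' g) (Suc k))"
    using f g by (intro wl2_ip_Suc wt_\<nu>_pos Hs_tcoef B'_mem) (simp_all add: tcoef_B')
  also have "\<dots> = wl2_ip (wt (\<nu> + 1)) (tcoef (B f)) (tcoef g)"
  proof -
    have "1 / s * (real k + 1) * wt (\<nu> + 1) k = s / (\<nu> + real k) * wt (\<nu> - 1) (Suc k)" for k
    proof -
      have "wt (\<nu> + 1) k * ((real k + 1) * (\<nu> + real k)) = s * s * wt (\<nu> - 1) (Suc k)"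
        unfolding s_sq by (rule wt_shift2[OF weight_gt_1])
      then show ?thesis using s_pos weight_gt_1 by (simp add: field_simps)
    qed
    from arg_cong[OF this, of complex_of_real]
    have eq: "of_real (1 / s) * of_nat (Suc k) * of_real (wt (\<nu> + 1) k)
        = (of_real (s / (\<nu> + real k)) * of_real (wt (\<nu> - 1) (Suc k)) :: complex)" for k
      by (simp add: add.commute)
    have "tcoef f (Suc k) * cnj (of_real (s / (\<nu> + real k)) * tcoef g k) * of_real (wt (\<nu> - 1) (Suc k))
        = of_real (1 / s) * (of_nat (Suc k) * tcoef f (Suc k)) * cnj (tcoef g k) * of_real (wt (\<nu> + 1) k)" for k
    proof -
      have "tcoef f (Suc k) * cnj (of_real (s / (\<nu> + real k)) * tcoef g k) * of_real (wt (\<nu> - 1) (Suc k))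
          = (of_real (s / (\<nu> + real k)) * of_real (wt (\<nu> - 1) (Suc k))) * (tcoef f (Suc k) * cnj (tcoef g k))"
        by (simp only: complex_cnj_mult complex_cnj_complex_of_real mult_ac)
      then show ?thesis unfolding eq[symmetric] by (simp only: mult_ac)
    qed
    then show ?thesis unfolding wl2_ip_def using f g by (simp only: tcoef_B tcoef_B') simp
  qed
  finally show ?thesis by (simp add: Hip_eq)
qed

end

text \<open>A vector is determined by its inner products, so the adjoint relation forces linearity.
  This replaces coefficient computations for the maps defined through \<open>pser\<close>.\<close>

lemma adjoint_linear_on:
  assumes H: "inner_space H ipH" and K: "semi_inner K ipK"
    and S: "\<And>x. x \<in> H \<Longrightarrow> S x \<in> K" and S': "\<And>y. y \<in> K \<Longrightarrow> S' y \<in> H"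
    and adj: "\<And>x y. x \<in> H \<Longrightarrow> y \<in> K \<Longrightarrow> ipK (S x) y = ipH x (S' y)"
  shows "linear_on K S'"
proof -
  interpret H: inner_space H ipH by (rule H)
  interpret K: semi_inner K ipK by (rule K)
  show ?thesis
    unfolding linear_on_def
  proof (intro conjI ballI allI; rule H.eq_if_ip_eq)
    fix x y u assume "x \<in> K" "y \<in> K" "u \<in> H"
    then show "ipH u (S' (x + y)) = ipH u (S' x + S' y)"
      by (simp add: S S' adj[symmetric] K.add_mem H.ip_add_right K.ip_add_right)
  next
    fix x c u assume "x \<in> K" "u \<in> H"
    then show "ipH u (S' (cscale c x)) = ipH u (cscale c (S' x))"
      by (simp add: S S' adj[symmetric] K.scale_mem H.ip_scale_right K.ip_scale_right)
  qed (simp_all add: S' K.add_mem K.scale_mem H.add_mem H.scale_mem)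
qed

section \<open>Unitarity of the one-weight block operator\<close>

context weight
begin

lemma s_neq_0 [simp]: "s \<noteq> 0"
  using s_pos by simp

lemma J'_linear: "linear_on H0 J'"
  by (rule adjoint_linear_on[where S = "\<lambda>f. f" and S' = J', OF Hm.inner_space_axioms H0.semi_inner_axioms])
    (auto simp: J_mem J'_mem J_adj)

lemma T'_linear: "linear_on H0 T'"
  by (rule adjoint_linear_on[where S = T and S' = T', OF H0.inner_space_axioms H0.semi_inner_axioms])
    (auto simp: T_mem T'_mem T_adj)

lemma L'_linear: "linear_on Hp L'"
  by (rule adjoint_linear_on[where S = L and S' = L', OF H0.inner_space_axioms Hp.semi_inner_axioms])
    (auto simp: L_mem L'_mem L_adj)

lemma B'_linear: "linear_on Hp B'"
  by (rule adjoint_linear_on[where S = B and S' = B', OF Hm.inner_space_axioms Hp.semi_inner_axioms])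
    (auto simp: B_mem B'_mem B_adj)

lemma T_linear: "linear_on H0 T"
  by (auto simp: linear_on_def T_def cscale_fun_def cscale_complex_def distrib_left mult_ac)

lemma L_linear: "linear_on H0 L"
  by (auto simp: linear_on_def L_def cscale_add_right cscale_cscale mult.commute)

lemma B_linear: "linear_on Hm B"
proof (rule adjoint_linear_on[where S = B' and S' = B, OF Hp.inner_space_axioms Hm.semi_inner_axioms])
  show "Hip (\<nu> - 1) (B' g) f = Hip (\<nu> + 1) g (B f)" if "g \<in> Hp" "f \<in> Hm" for g f
    using that Hm.ip_sym[of f "B' g"] Hp.ip_sym[of "B f" g] by (simp add: B_adj B_mem B'_mem)
qed (auto simp: B_mem B'_mem)

lemma of_real_lincomb:
  fixes a :: complex
  assumes "r1 + r2 = r"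
  shows "of_real r1 * a + of_real r2 * a = of_real r * a"
  unfolding assms[symmetric] by (simp add: distrib_right)

lemma tcoef_sum: "f \<in> Hs \<nu>1 \<Longrightarrow> g \<in> Hs \<nu>2 \<Longrightarrow> tcoef (f + g) k = tcoef f k + tcoef g k"
  by (rule tcoef_add[OF Hs_holomorphic Hs_holomorphic])

lemma q_s: "(\<nu> - 1) / s * s = \<nu> - 1" and q_\<nu>: "(\<nu> - 1) / s * \<nu> = s"
  using s_pos s_sq by (simp_all add: divide_eq_eq mult.commute)

text \<open>With U = (T, J; L, B) and U' its adjoint, this and the next three identities are the
  entries of U' U = 1, and the four after them those of U U' = 1. Each is checked on Taylor
  coefficients, where it becomes a relation between real factors.\<close>

lemma T'_T_L'_L: "x \<in> H0 \<Longrightarrow> T' (T x) + L' (L x) = x"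
proof (rule Hs_eqI[of _ \<nu> _ \<nu>])
  assume x: "x \<in> H0"
  show "T' (T x) + L' (L x) \<in> H0" using x by (intro H0.add_mem T'_mem T_mem L'_mem L_mem)
  fix k
  define q where "q = (\<nu> - 1) / s"
  have q: "q * q * \<nu> = \<nu> - 1" using q_s q_\<nu> unfolding q_def by (metis mult.assoc)
  have "(real k + 1) / (\<nu> + real k) + q * q * \<nu> / (\<nu> + real k) = 1"
    unfolding q using weight_gt_1 by (simp add: add_divide_distrib[symmetric])
  from of_real_lincomb[OF this, of "tcoef x k"]
  show "tcoef (T' (T x) + L' (L x)) k = tcoef x k"
    unfolding tcoef_sum[OF T'_mem[OF T_mem[OF x]] L'_mem[OF L_mem[OF x]]]
      tcoef_T'[OF T_mem[OF x]] tcoef_T[OF x] tcoef_L'[OF L_mem[OF x]] tcoef_L[OF x] q_def[symmetric]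
    by (simp add: mult_ac)
qed

lemma T'_L'_B: "u \<in> Hm \<Longrightarrow> T' u + L' (B u) = 0"
proof (rule Hs_eqI[of _ \<nu> _ \<nu>])
  assume u: "u \<in> Hm"
  show "T' u + L' (B u) \<in> H0" using u by (intro H0.add_mem T'_mem J_mem L'_mem B_mem)
  fix k
  define q where "q = (\<nu> - 1) / s"
  have q: "q * \<nu> * (1 / s) = 1" using q_\<nu> s_pos unfolding q_def by simp
  have "q * (\<nu> / (\<nu> + real k)) * (1 / s * (real k + 1))
      = (q * \<nu> * (1 / s)) * ((real k + 1) / (\<nu> + real k))" by simp
  also have "\<dots> = (real k + 1) / (\<nu> + real k)" unfolding q by simp
  finally have "(real k + 1) / (\<nu> + real k) + - (q * (\<nu> / (\<nu> + real k)) * (1 / s * (real k + 1))) = 0"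
    by (simp only: add.right_inverse)
  from of_real_lincomb[OF this, of "tcoef u (Suc k)"]
  show "tcoef (T' u + L' (B u)) k = tcoef 0 k"
    unfolding tcoef_sum[OF T'_mem[OF J_mem[OF u]] L'_mem[OF B_mem[OF u]]]
      tcoef_T'[OF J_mem[OF u]] tcoef_L'[OF B_mem[OF u]] tcoef_B[OF u] q_def[symmetric] tcoef_zero
    by (simp add: mult_ac add.commute)
qed (rule Hs_zero)

lemma J'_T_B'_L: "x \<in> H0 \<Longrightarrow> J' (T x) + B' (L x) = 0"
proof (rule Hs_eqI[of _ "\<nu> - 1" _ \<nu>])
  assume x: "x \<in> H0"
  show "J' (T x) + B' (L x) \<in> Hm" using x by (intro Hm.add_mem T_mem J'_mem L_mem B'_mem)
  fix k
  define q where "q = (\<nu> - 1) / s"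
  show "tcoef (J' (T x) + B' (L x)) k = tcoef 0 k"
  proof (cases k)
    case (Suc j)
    have "(\<nu> - 1) / (\<nu> + real j) + - (s / (\<nu> + real j) * q) = 0"
      using s_pos by (simp add: q_def)
    from of_real_lincomb[OF this, of "tcoef x j"] show ?thesis
      unfolding tcoef_sum[OF J'_mem[OF T_mem[OF x]] B'_mem[OF L_mem[OF x]]]
        tcoef_J'[OF T_mem[OF x]] tcoef_T[OF x] tcoef_B'[OF L_mem[OF x]] tcoef_L[OF x] q_def[symmetric] tcoef_zero
      by (simp add: Suc mult_ac)
  qed (simp add: tcoef_sum[OF J'_mem[OF T_mem[OF x]] B'_mem[OF L_mem[OF x]]] x
        tcoef_J' T_mem tcoef_T tcoef_B' L_mem tcoef_zero)
qed (rule Hs_zero)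

lemma J'_B'_B: "u \<in> Hm \<Longrightarrow> J' u + B' (B u) = u"
proof (rule Hs_eqI[of _ "\<nu> - 1" _ "\<nu> - 1"])
  assume u: "u \<in> Hm"
  show "J' u + B' (B u) \<in> Hm" using u by (intro Hm.add_mem J'_mem J_mem B_mem B'_mem)
  fix k
  show "tcoef (J' u + B' (B u)) k = tcoef u k"
  proof (cases k)
    case (Suc j)
    have "(\<nu> - 1) / (\<nu> + real j) + s / (\<nu> + real j) * (1 / s * (real j + 1)) = 1"
      using weight_gt_1 s_pos by (simp add: add_divide_distrib[symmetric])
    from of_real_lincomb[OF this, of "tcoef u k"] show ?thesis
      unfolding tcoef_sum[OF J'_mem[OF J_mem[OF u]] B'_mem[OF B_mem[OF u]]]
        tcoef_J'[OF J_mem[OF u]] tcoef_B'[OF B_mem[OF u]] tcoef_B[OF u]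
      by (simp add: Suc mult_ac add.commute)
  qed (use weight_gt_1 in \<open>simp add: tcoef_sum[OF J'_mem[OF J_mem[OF u]] B'_mem[OF B_mem[OF u]]] u
        tcoef_J' J_mem tcoef_B' B_mem\<close>)
qed

lemma T_T'_J': "y \<in> H0 \<Longrightarrow> T (T' y) + J' y = y"
proof (rule Hs_eqI[of _ \<nu> _ \<nu>])
  assume y: "y \<in> H0"
  show "T (T' y) + J' y \<in> H0" using y by (intro H0.add_mem T'_mem T_mem J_mem[OF J'_mem])
  fix k
  show "tcoef (T (T' y) + J' y) k = tcoef y k"
  proof (cases k)
    case (Suc j)
    have "(real j + 1) / (\<nu> + real j) + (\<nu> - 1) / (\<nu> + real j) = 1"
      using weight_gt_1 by (simp add: add_divide_distrib[symmetric])
    from of_real_lincomb[OF this, of "tcoef y k"] show ?thesis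
      unfolding tcoef_sum[OF T_mem[OF T'_mem[OF y]] J'_mem[OF y]]
        tcoef_T[OF T'_mem[OF y]] tcoef_T'[OF y] tcoef_J'[OF y]
      by (simp add: Suc)
  qed (use weight_gt_1 in \<open>simp add: tcoef_sum[OF T_mem[OF T'_mem[OF y]] J'_mem[OF y]] y tcoef_T T'_mem tcoef_J'\<close>)
qed

lemma T_L'_B': "v \<in> Hp \<Longrightarrow> T (L' v) + B' v = 0"
proof (rule Hs_eqI[of _ \<nu> _ \<nu>])
  assume v: "v \<in> Hp"
  show "T (L' v) + B' v \<in> H0" using v by (intro H0.add_mem T_mem L'_mem J_mem[OF B'_mem])
  fix k
  show "tcoef (T (L' v) + B' v) k = tcoef 0 k"
  proof (cases k)
    case (Suc j)
    have "- ((\<nu> - 1) / s * (\<nu> / (\<nu> + real j))) = - ((\<nu> - 1) / s * \<nu>) / (\<nu> + real j)" by simp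
    then have "- ((\<nu> - 1) / s * (\<nu> / (\<nu> + real j))) + s / (\<nu> + real j) = 0"
      unfolding q_\<nu> by simp
    from of_real_lincomb[OF this, of "tcoef v j"] show ?thesis
      unfolding tcoef_sum[OF T_mem[OF L'_mem[OF v]] B'_mem[OF v]]
        tcoef_T[OF L'_mem[OF v]] tcoef_L'[OF v] tcoef_B'[OF v] tcoef_zero
      by (simp add: Suc)
  qed (simp add: tcoef_sum[OF T_mem[OF L'_mem[OF v]] B'_mem[OF v]] v tcoef_T L'_mem tcoef_B' tcoef_zero)
qed (rule Hs_zero)

lemma L_T'_B_J': "y \<in> H0 \<Longrightarrow> L (T' y) + B (J' y) = 0"
proof (rule Hs_eqI[of _ "\<nu> + 1" _ \<nu>])
  assume y: "y \<in> H0"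
  show "L (T' y) + B (J' y) \<in> Hp" using y by (intro Hp.add_mem L_mem T'_mem B_mem J'_mem)
  fix k
  have "- ((\<nu> - 1) / s * ((real k + 1) / (\<nu> + real k)))
      + 1 / s * ((real k + 1) * ((\<nu> - 1) / (\<nu> + real k))) = 0" by simp
  from of_real_lincomb[OF this, of "tcoef y (Suc k)"]
  show "tcoef (L (T' y) + B (J' y)) k = tcoef 0 k"
    unfolding tcoef_sum[OF L_mem[OF T'_mem[OF y]] B_mem[OF J'_mem[OF y]]]
      tcoef_L[OF T'_mem[OF y]] tcoef_T'[OF y] tcoef_B[OF J'_mem[OF y]] tcoef_J'[OF y] tcoef_zero
    by (simp add: mult_ac add.commute)
qed (rule Hs_zero)

lemma L_L'_B_B': "v \<in> Hp \<Longrightarrow> L (L' v) + B (B' v) = v"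
proof (rule Hs_eqI[of _ "\<nu> + 1" _ "\<nu> + 1"])
  assume v: "v \<in> Hp"
  show "L (L' v) + B (B' v) \<in> Hp" using v by (intro Hp.add_mem L_mem L'_mem B_mem B'_mem)
  fix k
  define q where "q = (\<nu> - 1) / s"
  have q: "q * q * \<nu> = \<nu> - 1" using q_s q_\<nu> unfolding q_def by (metis mult.assoc)
  have "q * (q * (\<nu> / (\<nu> + real k))) = (q * q * \<nu>) / (\<nu> + real k)" by simp
  then have "q * (q * (\<nu> / (\<nu> + real k))) + 1 / s * ((real k + 1) * (s / (\<nu> + real k))) = 1"
    unfolding q using weight_gt_1 s_pos by (simp add: add_divide_distrib[symmetric])
  from of_real_lincomb[OF this, of "tcoef v k"]
  show "tcoef (L (L' v) + B (B' v)) k = tcoef v k"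
    unfolding tcoef_sum[OF L_mem[OF L'_mem[OF v]] B_mem[OF B'_mem[OF v]]]
      tcoef_L[OF L'_mem[OF v]] tcoef_L'[OF v] tcoef_B[OF B'_mem[OF v]] tcoef_B'[OF v] q_def[symmetric]
    by (simp add: mult_ac add.commute)
qed

lemma nrm_T_le: "x \<in> H0 \<Longrightarrow> nrm (Hip \<nu>) (T x) \<le> nrm (Hip \<nu>) x"
proof -
  assume x: "x \<in> H0"
  have "Hip \<nu> x x = Hip \<nu> x (T' (T x) + L' (L x))" using T'_T_L'_L[OF x] by simp
  also have "\<dots> = Hip \<nu> (T x) (T x) + Hip (\<nu> + 1) (L x) (L x)"
    using x by (simp add: H0.ip_add_right T_mem T'_mem L_mem L'_mem T_adj L_adj)
  finally show ?thesis using Hp.ip_nonneg[OF L_mem[OF x]] by (simp add: nrm_def)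
qed

lemma nrm_T'_le: "y \<in> H0 \<Longrightarrow> nrm (Hip \<nu>) (T' y) \<le> nrm (Hip \<nu>) y"
proof -
  assume y: "y \<in> H0"
  have "Hip \<nu> y y = Hip \<nu> (T (T' y) + J' y) y" using T_T'_J'[OF y] by simp
  also have "\<dots> = Hip \<nu> (T' y) (T' y) + Hip (\<nu> - 1) (J' y) (J' y)"
    using y by (simp add: H0.ip_add_left T_mem T'_mem J_mem J'_mem T_adj J_adj)
  finally show ?thesis using Hm.ip_nonneg[OF J'_mem[OF y]] by (simp add: nrm_def)
qed

end

section \<open>The projective representation\<close>

lemma mobius_eq_Moebius: "mobius z w = - Moebius_function 0 z w"
  by (simp add: mobius_def Moebius_function_simple minus_divide_left)

lemma norm_mobius: "norm z < 1 \<Longrightarrow> norm w < 1 \<Longrightarrow> norm (mobius z w) < 1"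
  using Moebius_function_norm_lt_1[of z w 0] by (simp add: mobius_eq_Moebius)

lemma Re_one_minus_pos:
  assumes "norm z < 1" "norm w < 1"
  shows "0 < Re (1 - cnj z * w)"
proof -
  have "norm (cnj z * w) < 1 * 1" unfolding norm_mult by (rule mult_strict_mono') (use assms in auto)
  then show ?thesis using complex_Re_le_cmod[of "cnj z * w"] by simp
qed

lemma one_minus_neq_0:
  assumes "norm z < 1" "norm w < 1"
  shows "1 - cnj z * w \<noteq> 0"
  using Re_one_minus_pos[OF assms] by (metis less_irrefl zero_complex.simps(1))

text \<open>Covariance of the reproducing kernel, before powers are taken.\<close>

lemma one_minus_mobius:
  assumes "norm z < 1" "norm w < 1" "norm a < 1"
  shows "(1 - cnj z * w) * (1 - cnj a * mobius z w) = (1 - cnj a * z) * (1 - cnj (mobius z a) * w)"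
proof -
  have "1 - cnj z * w \<noteq> 0" "1 - cnj a * z \<noteq> 0" "1 - z * cnj a \<noteq> 0"
    using one_minus_neq_0 assms by (metis mult.commute)+
  then show ?thesis by (simp add: mobius_def field_simps)
qed

lemma one_minus_mobius_self:
  assumes "norm z < 1" "norm w < 1"
  shows "(1 - cnj z * w) * (1 - cnj z * mobius z w) = of_real (1 - (norm z)\<^sup>2)"
proof -
  have "1 - cnj z * w \<noteq> 0" using one_minus_neq_0 assms by blast
  then have "(1 - cnj z * w) * (1 - cnj z * mobius z w) = 1 - cnj z * z"
    by (simp add: mobius_def field_simps)
  also have "cnj z * z = of_real ((norm z)\<^sup>2)" by (metis complex_norm_square mult.commute of_real_power)
  finally show ?thesis by simp
qed

lemma norm_sq_less_1: "norm z < 1 \<Longrightarrow> 0 < 1 - (norm (z::complex))\<^sup>2"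
  by (simp add: abs_square_less_1)

lemma mobius_mobius:
  assumes "norm z < 1" "norm w < 1"
  shows "mobius z (mobius z w) = w"
proof -
  have n: "1 - cnj z * w \<noteq> 0" "1 - cnj z * mobius z w \<noteq> 0"
    using one_minus_neq_0 norm_mobius assms by blast+
  have "z - mobius z w = w * (1 - cnj z * mobius z w)"
    using n(1) by (simp add: mobius_def field_simps)
  then show ?thesis using n(2) by (simp add: mobius_def[of z "mobius z w"])
qed

section \<open>Powers with the principal branch and the operators of the representation\<close>

definition pw :: "real \<Rightarrow> complex \<Rightarrow> complex" where
  "pw \<nu> u = exp (- complex_of_real \<nu> * Ln u)"

text \<open>In the right half-plane the arguments add up to less than \<open>\<pi>\<close>, so no branch jump occurs.\<close>
lemma pw_mult:
  assumes pos: "0 < Re A" "0 < Re B" "0 < Re C" "0 < Re D" and eq: "A * B = C * D"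
  shows "pw \<nu> A * pw \<nu> B = pw \<nu> C * pw \<nu> D"
proof -
  have nz: "A \<noteq> 0" "B \<noteq> 0" "C \<noteq> 0" "D \<noteq> 0" using pos by auto
  have "Ln A + Ln B = Ln C + Ln D"
  proof (rule exp_complex_eqI)
    show "\<bar>Im (Ln A + Ln B) - Im (Ln C + Ln D)\<bar> < 2 * pi"
      using pos[THEN Re_Ln_pos_lt_imp] unfolding abs_less_iff plus_complex.simps by linarith
    show "exp (Ln A + Ln B) = exp (Ln C + Ln D)" using nz eq by (simp add: exp_add)
  qed
  then show ?thesis by (simp only: pw_def exp_add[symmetric] distrib_left[symmetric])
qed

lemma cnj_pw: "0 < Re u \<Longrightarrow> cnj (pw \<nu> u) = pw \<nu> (cnj u)"
  by (simp add: pw_def exp_cnj cnj_Ln complex_nonpos_Reals_iff)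

lemma pw_of_real: "0 < x \<Longrightarrow> pw \<nu> (of_real x) = of_real (x powr (- \<nu>))"
  by (simp add: pw_def powr_def Ln_of_real exp_of_real[symmetric])

lemma pw_one [simp]: "pw \<nu> 1 = 1"
  by (simp add: pw_def)

definition dplus_const :: "real \<Rightarrow> complex \<Rightarrow> complex" where
  "dplus_const \<nu> z = cis (pi * \<nu> / 2) * complex_of_real ((1 - (cmod z)\<^sup>2) powr (\<nu> / 2))"

lemma Dplus_eq: "Dplus \<nu> z f = dres (\<lambda>w. dplus_const \<nu> z * pw \<nu> (1 - cnj z * w) * f (mobius z w))"
  by (simp add: Dplus_def pw_def dplus_const_def)

lemma Dplus_in: "norm w < 1 \<Longrightarrow> Dplus \<nu> z f w = dplus_const \<nu> z * pw \<nu> (1 - cnj z * w) * f (mobius z w)"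
  and Dplus_off: "norm w \<ge> 1 \<Longrightarrow> Dplus \<nu> z f w = 0"
  by (simp_all add: Dplus_eq dres_def)

lemma cnj_dplus_const: "cnj (dplus_const \<nu> z) = cis (- pi * \<nu>) * dplus_const \<nu> z"
proof -
  have "cis (- pi * \<nu>) * cis (pi * \<nu> / 2) = cnj (cis (pi * \<nu> / 2))"
    by (simp add: cis_cnj cis_mult)
  then show ?thesis by (simp add: dplus_const_def flip: mult.assoc)
qed

lemma dplus_const_sq:
  assumes "norm z < 1"
  shows "dplus_const \<nu> z * dplus_const \<nu> z = cis (pi * \<nu>) * of_real ((1 - (cmod z)\<^sup>2) powr \<nu>)"
proof -
  have "dplus_const \<nu> z * dplus_const \<nu> z = (cis (pi * \<nu> / 2) * cis (pi * \<nu> / 2))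
      * of_real ((1 - (cmod z)\<^sup>2) powr (\<nu> / 2) * (1 - (cmod z)\<^sup>2) powr (\<nu> / 2))"
    by (simp add: dplus_const_def mult_ac)
  also have "(1 - (cmod z)\<^sup>2) powr (\<nu> / 2) * (1 - (cmod z)\<^sup>2) powr (\<nu> / 2) = (1 - (cmod z)\<^sup>2) powr \<nu>"
    by (simp flip: powr_add)
  finally show ?thesis by (simp add: cis_mult)
qed

lemma pw_holomorphic: "norm z < 1 \<Longrightarrow> (\<lambda>w. pw \<nu> (1 - cnj z * w)) holomorphic_on ball 0 1"
  unfolding pw_def using Re_one_minus_pos[of z]
  by (intro holomorphic_intros) (force simp: complex_nonpos_Reals_iff)

lemma Dplus_add: "Dplus \<nu> z (f + g) = Dplus \<nu> z f + Dplus \<nu> z g"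
  by (auto simp: Dplus_eq dres_def distrib_left fun_eq_iff)

lemma Dplus_scale: "Dplus \<nu> z (cscale c f) = cscale c (Dplus \<nu> z f)"
  by (auto simp: Dplus_eq dres_def cscale_fun_def cscale_complex_def fun_eq_iff)

lemma Dplus_linear: "linear_on S (Dplus \<nu> z)"
  by (simp add: linear_on_def Dplus_add Dplus_scale)

text \<open>\<phi>_z is an involution, but the chosen branch contributes the unimodular constant cis
  (pi \<nu>): the representation is only projective, and \<open>Dplus\<close> is inverted by cis (-
  pi \<nu>) times itself.\<close>

lemma Dplus_Dplus:
  assumes z: "norm z < 1" and f: "\<And>w. norm w \<ge> 1 \<Longrightarrow> f w = 0"
  shows "Dplus \<nu> z (Dplus \<nu> z f) = cscale (cis (pi * \<nu>)) f"
proof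
  fix w
  show "Dplus \<nu> z (Dplus \<nu> z f) w = cscale (cis (pi * \<nu>)) f w"
  proof (cases "norm w < 1")
    case w: True
    have p: "0 < 1 - (norm z)\<^sup>2" by (rule norm_sq_less_1[OF z])
    have "pw \<nu> (1 - cnj z * w) * pw \<nu> (1 - cnj z * mobius z w) = pw \<nu> (of_real (1 - (norm z)\<^sup>2)) * pw \<nu> 1"
      using one_minus_mobius_self[OF z w] p z w norm_mobius[OF z w]
      by (intro pw_mult Re_one_minus_pos) auto
    also have "\<dots> = of_real ((1 - (norm z)\<^sup>2) powr (- \<nu>))" using p by (simp only: pw_of_real pw_one mult_1_right)
    finally have "Dplus \<nu> z (Dplus \<nu> z f) w
        = (dplus_const \<nu> z * dplus_const \<nu> z) * of_real ((1 - (norm z)\<^sup>2) powr (- \<nu>)) * f w"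
      using z w norm_mobius[OF z w] by (simp add: Dplus_in mobius_mobius mult_ac)
    also have "\<dots> = cis (pi * \<nu>) * of_real ((1 - (norm z)\<^sup>2) powr \<nu> * (1 - (norm z)\<^sup>2) powr (- \<nu>)) * f w"
      unfolding dplus_const_sq[OF z] by (simp add: mult.assoc)
    also have "(1 - (norm z)\<^sup>2) powr \<nu> * (1 - (norm z)\<^sup>2) powr (- \<nu>) = 1"
      using p by (simp flip: powr_add)
    finally show ?thesis by (simp add: cscale_fun_def cscale_complex_def)
  qed (simp add: Dplus_off f cscale_fun_def cscale_complex_def)
qed

section \<open>Reproducing kernels and the density of their span\<close>

definition kern :: "real \<Rightarrow> complex \<Rightarrow> complex \<Rightarrow> complex" where
  "kern \<nu> a = dres (\<lambda>w. pw \<nu> (1 - cnj a * w))"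

lemma kern_holomorphic: "norm a < 1 \<Longrightarrow> kern \<nu> a holomorphic_on ball 0 1"
  unfolding kern_def by (intro dres_holomorphic pw_holomorphic)

lemma tcoef_kern:
  assumes a: "norm a < 1"
  shows "tcoef (kern \<nu> a) = (\<lambda>k. of_real (1 / wt \<nu> k) * cnj a ^ k)"
proof (rule tcoef_eqI)
  fix w :: complex assume w: "norm w < 1"
  have "norm (cnj a * w) < 1 * 1" unfolding norm_mult by (rule mult_strict_mono') (use a w in auto)
  then have "(\<lambda>k. of_real (1 / wt \<nu> k) * (cnj a * w) ^ k) sums ((1 - cnj a * w) powr (- of_real \<nu>))"
    by (intro kernel_sums) simp
  then show "(\<lambda>k. of_real (1 / wt \<nu> k) * cnj a ^ k * w ^ k) sums kern \<nu> a w"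
    using w one_minus_neq_0[OF a w] by (simp add: kern_def dres_def powr_def pw_def power_mult_distrib mult.assoc)
qed

lemma kern_in_Hs:
  assumes \<nu>: "0 < \<nu>" and a: "norm a < 1"
  shows "kern \<nu> a \<in> Hs \<nu>"
proof -
  have "wt \<nu> k * (cmod (of_real (1 / wt \<nu> k) * cnj a ^ k))\<^sup>2 = ((norm a)\<^sup>2) ^ k / wt \<nu> k" for k
    using wt_pos[OF \<nu>, of k]
    by (simp add: norm_mult norm_power norm_divide power_mult_distrib power_divide power2_eq_square)
  moreover have "summable (\<lambda>k. ((norm a)\<^sup>2) ^ k / wt \<nu> k)"
    using a \<nu> by (intro kernel_coeff_summable) (simp_all add: abs_square_less_1)
  ultimately have "tcoef (kern \<nu> a) \<in> wl2 (wt \<nu>)" unfolding tcoef_kern[OF a] wl2_def by simp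
  then show ?thesis using a by (simp add: Hs_iff kern_holomorphic) (simp add: kern_def dres_def)
qed

lemma Hip_kern:
  assumes \<nu>: "0 < \<nu>" and f: "f \<in> Hs \<nu>" and a: "norm a < 1"
  shows "Hip \<nu> f (kern \<nu> a) = f a"
proof -
  have "tcoef f k * cnj (of_real (1 / wt \<nu> k) * cnj a ^ k) * of_real (wt \<nu> k) = tcoef f k * a ^ k" for k
    using wt_pos[OF \<nu>, of k] by simp
  then have "Hip \<nu> f (kern \<nu> a) = (\<Sum>k. tcoef f k * a ^ k)"
    unfolding Hip_eq wl2_ip_def tcoef_kern[OF a] by simp
  then show ?thesis using tcoef_sums[OF Hs_holomorphic[OF f] a] by (simp add: sums_iff)
qed

text \<open>At this point \<open>Dplus\<close> is not known to preserve the space, so it is first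
  controlled on kernel functions, by \<open>one_minus_mobius\<close> and the absence of branch
  jumps.\<close>

lemma Dplus_kern:
  assumes z: "norm z < 1" and a: "norm a < 1"
  shows "Dplus \<nu> z (kern \<nu> a) = cscale (dplus_const \<nu> z * pw \<nu> (1 - cnj a * z)) (kern \<nu> (mobius z a))"
proof
  fix w
  show "Dplus \<nu> z (kern \<nu> a) w = cscale (dplus_const \<nu> z * pw \<nu> (1 - cnj a * z)) (kern \<nu> (mobius z a)) w"
  proof (cases "norm w < 1")
    case w: True
    have "pw \<nu> (1 - cnj z * w) * pw \<nu> (1 - cnj a * mobius z w) = pw \<nu> (1 - cnj a * z) * pw \<nu> (1 - cnj (mobius z a) * w)"
      using one_minus_mobius[OF z w a] z w a norm_mobius[OF z] by (intro pw_mult Re_one_minus_pos) auto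
    then show ?thesis
      using w norm_mobius[OF z w] by (simp add: Dplus_in kern_def dres_def cscale_fun_def cscale_complex_def mult.assoc)
  qed (simp add: Dplus_off kern_def dres_def cscale_fun_def cscale_complex_def)
qed

text \<open>By the reproducing property, pairing with the image of a kernel function is a point
  evaluation of \<open>Dplus z y\<close>, up to the projective factor. This stands in for an adjoint
  relation while membership of \<open>Dplus z y\<close> is still open.\<close>

lemma Hip_Dplus_kern:
  assumes \<nu>: "0 < \<nu>" and z: "norm z < 1" and a: "norm a < 1" and y: "y \<in> Hs \<nu>"
  shows "Hip \<nu> y (Dplus \<nu> z (kern \<nu> a)) = cis (- pi * \<nu>) * Dplus \<nu> z y a"
proof -
  interpret hilbert "Hs \<nu>" "Hip \<nu>" by (rule hilbert_Hs[OF \<nu>])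
  have "Hip \<nu> y (Dplus \<nu> z (kern \<nu> a)) = cnj (dplus_const \<nu> z * pw \<nu> (1 - cnj a * z)) * y (mobius z a)"
    unfolding Dplus_kern[OF z a] using \<nu> y norm_mobius[OF z a]
    by (simp add: ip_scale_right kern_in_Hs Hip_kern)
  also have "cnj (pw \<nu> (1 - cnj a * z)) = pw \<nu> (1 - cnj z * a)"
    using Re_one_minus_pos[OF a z] by (simp add: cnj_pw mult.commute)
  then have "cnj (dplus_const \<nu> z * pw \<nu> (1 - cnj a * z)) = cis (- pi * \<nu>) * dplus_const \<nu> z * pw \<nu> (1 - cnj z * a)"
    by (simp add: cnj_dplus_const)
  finally show ?thesis using a by (simp add: Dplus_in mult.assoc)
qed

text \<open>The span is generated inductively so that facts about kernel functions spread to it by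
  rule induction.\<close>

inductive_set kern_span :: "real \<Rightarrow> (complex \<Rightarrow> complex) set" for \<nu> where
  kern_span_zero: "0 \<in> kern_span \<nu>"
| kern_span_kern: "norm a < 1 \<Longrightarrow> kern \<nu> a \<in> kern_span \<nu>"
| kern_span_add: "f \<in> kern_span \<nu> \<Longrightarrow> g \<in> kern_span \<nu> \<Longrightarrow> f + g \<in> kern_span \<nu>"
| kern_span_scale: "f \<in> kern_span \<nu> \<Longrightarrow> cscale c f \<in> kern_span \<nu>"

context inner_space
begin

lemma clos_subset: "clos H ip S \<subseteq> H"
  by (auto simp: clos_def)

lemma clos_superset: "S \<subseteq> H \<Longrightarrow> S \<subseteq> clos H ip S"
proof
  fix x assume "S \<subseteq> H" "x \<in> S"
  then show "x \<in> clos H ip S" unfolding clos_def by (auto intro!: bexI[of _ x])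
qed

lemma clos_clos:
  assumes S: "S \<subseteq> H" and x: "x \<in> H" and e: "\<And>e. e > 0 \<Longrightarrow> \<exists>y\<in>clos H ip S. nrm ip (x - y) < e"
  shows "x \<in> clos H ip S"
  unfolding clos_def
proof (intro CollectI conjI allI impI x)
  fix d :: real assume "d > 0"
  then have d: "d / 2 > 0" by simp
  obtain y where y: "y \<in> clos H ip S" "nrm ip (x - y) < d / 2" using e[OF d] by blast
  then obtain u where u: "u \<in> S" "nrm ip (y - u) < d / 2" using d unfolding clos_def by blast
  have "nrm ip (x - u) \<le> nrm ip (x - y) + nrm ip (y - u)"
    using x y(1) u(1) S clos_subset by (intro nrm_triangle_diff) auto
  then have "nrm ip (x - u) < d" using y u by linarith
  then show "\<exists>y\<in>S. nrm ip (x - y) < d" using u by blast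
qed

lemma clos_add:
  assumes S: "S \<subseteq> H" "\<And>x y. x \<in> S \<Longrightarrow> y \<in> S \<Longrightarrow> x + y \<in> S"
    and xy: "x \<in> clos H ip S" "y \<in> clos H ip S"
  shows "x + y \<in> clos H ip S"
proof -
  obtain X Y where X: "\<And>n. X n \<in> S" "converges X x" "\<And>n. Y n \<in> S" "converges Y y"
    using xy unfolding clos_iff[OF S(1)] by blast
  have "converges (\<lambda>n. X n + Y n) (x + y)" using X S by (intro converges_add) auto
  then show ?thesis unfolding clos_iff[OF S(1)] using X S(2) by (intro exI[of _ "\<lambda>n. X n + Y n"]) simp
qed

lemma clos_scale:
  assumes S: "S \<subseteq> H" "\<And>x. x \<in> S \<Longrightarrow> cscale c x \<in> S" and x: "x \<in> clos H ip S"
  shows "cscale c x \<in> clos H ip S"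
proof -
  obtain X where X: "\<And>n. X n \<in> S" "converges X x" using x unfolding clos_iff[OF S(1)] by blast
  have "converges (\<lambda>n. cscale c (X n)) (cscale c x)" using X S by (intro converges_scale) auto
  then show ?thesis unfolding clos_iff[OF S(1)] using X S(2) by (intro exI[of _ "\<lambda>n. cscale c (X n)"]) simp
qed

end

lemma kern_span_subset:
  assumes "0 < \<nu>"
  shows "kern_span \<nu> \<subseteq> Hs \<nu>"
proof
  fix f assume "f \<in> kern_span \<nu>"
  then show "f \<in> Hs \<nu>"
    by induction (blast intro: Hs_zero kern_in_Hs Hs_add Hs_scale assms)+
qed

lemma Hip_nrm_sq: "0 < \<nu> \<Longrightarrow> f \<in> Hs \<nu> \<Longrightarrow> (nrm (Hip \<nu>) f)\<^sup>2 = (\<Sum>k. wt \<nu> k * (cmod (tcoef f k))\<^sup>2)"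
proof -
  assume \<nu>: "0 < \<nu>" and f: "f \<in> Hs \<nu>"
  interpret hilbert "Hs \<nu>" "Hip \<nu>" by (rule hilbert_Hs[OF \<nu>])
  show ?thesis using nrm_sq[OF f] Re_wl2_ip_self[OF Hs_tcoef[OF f]] by (simp add: Hip_eq)
qed

lemma tcoef_diff:
  assumes "f holomorphic_on ball 0 1" "g holomorphic_on ball 0 1"
  shows "tcoef (f - g) k = tcoef f k - tcoef g k"
proof -
  have "tcoef (f - g) = (\<lambda>k. tcoef f k - tcoef g k)"
    using assms by (intro tcoef_eqI) (simp add: left_diff_distrib tcoef_sums sums_diff)
  then show ?thesis by simp
qed

definition monomial :: "nat \<Rightarrow> complex \<Rightarrow> complex" where
  "monomial m = pser (\<lambda>k. if k = m then 1 else 0)"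

lemma monomial_aux: "(\<lambda>k. if k = m then 1 else 0) \<in> wl2 (wt \<nu>)"
  unfolding wl2_def mem_Collect_eq by (rule summable_finite[of "{m}"]) auto

lemma monomial_mem: "0 < \<nu> \<Longrightarrow> monomial m \<in> Hs \<nu>"
  unfolding monomial_def by (rule pser_in_Hs[OF monomial_aux])

lemma tcoef_monomial: "tcoef (monomial m) k = (if k = m then 1 else 0)"
  unfolding monomial_def using tcoef_pser[OF monomial_aux, of 1] by simp

text \<open>Taylor polynomials converge in norm. \<open>S\<close> will be the closed span of the
  kernel functions, and later the range of the output block of a system or of its adjoint.\<close>

lemma Hs_clos_monomials:
  assumes \<nu>: "0 < \<nu>" and S: "\<And>m. monomial m \<in> S" "\<And>f g. f \<in> S \<Longrightarrow> g \<in> S \<Longrightarrow> f + g \<in> S"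
    "\<And>f c. f \<in> S \<Longrightarrow> cscale c f \<in> S" and f: "f \<in> Hs \<nu>"
  shows "f \<in> clos (Hs \<nu>) (Hip \<nu>) S"
  unfolding clos_def
proof (intro CollectI conjI allI impI f)
  interpret hilbert "Hs \<nu>" "Hip \<nu>" by (rule hilbert_Hs[OF \<nu>])
  have S0: "0 \<in> S" using S(3)[OF S(1), of 0] by simp
  define p where "p n = (\<Sum>m<n. cscale (tcoef f m) (monomial m))" for n
  have pS: "p n \<in> S" for n unfolding p_def
    by (induction n) (simp_all only: sum.lessThan_Suc lessThan_0 sum.empty S S0)
  have pH: "p n \<in> Hs \<nu>" for n unfolding p_def by (intro sum_mem scale_mem monomial_mem \<nu>)
  have tp: "tcoef (p n) k = (if k < n then tcoef f k else 0)" for n k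
  proof (induction n)
    case (Suc n)
    have "tcoef (p (Suc n)) k = tcoef (p n) k + tcoef f n * tcoef (monomial n) k"
      using pH[of n] monomial_mem[OF \<nu>, of n] scale_mem[OF monomial_mem[OF \<nu>]]
      by (simp add: p_def tcoef_add tcoef_scale Hs_holomorphic[where \<nu> = \<nu>])
    then show ?case using Suc by (auto simp: tcoef_monomial less_Suc_eq)
  qed (simp add: p_def tcoef_zero del: zero_fun_apply, simp)
  fix e :: real assume e: "e > 0"
  have s: "summable (\<lambda>k. wt \<nu> k * (cmod (tcoef f k))\<^sup>2)" using Hs_tcoef[OF f] by (simp add: wl2_def)
  obtain n where n: "norm (\<Sum>i. wt \<nu> (i + n) * (cmod (tcoef f (i + n)))\<^sup>2) < e\<^sup>2"
    using suminf_exist_split[OF _ s, of "e\<^sup>2"] e by auto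
  have d: "f - p n \<in> Hs \<nu>" by (intro diff_mem f pH)
  have td: "tcoef (f - p n) k = (if k < n then 0 else tcoef f k)" for k
    using tcoef_diff[OF Hs_holomorphic[OF f] Hs_holomorphic[OF pH]] tp by simp
  have "(nrm (Hip \<nu>) (f - p n))\<^sup>2 = (\<Sum>k. wt \<nu> k * (cmod (tcoef (f - p n) k))\<^sup>2)" by (rule Hip_nrm_sq[OF \<nu> d])
  also have "\<dots> = (\<Sum>i. wt \<nu> (i + n) * (cmod (tcoef (f - p n) (i + n)))\<^sup>2)
      + (\<Sum>k<n. wt \<nu> k * (cmod (tcoef (f - p n) k))\<^sup>2)"
    using Hs_tcoef[OF d] by (intro suminf_split_initial_segment) (simp add: wl2_def)
  also have "\<dots> = (\<Sum>i. wt \<nu> (i + n) * (cmod (tcoef f (i + n)))\<^sup>2)" by (simp add: td)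
  also have "\<dots> < e\<^sup>2" using n by simp
  finally have "nrm (Hip \<nu>) (f - p n) < e" using e by (simp add: power_less_imp_less_base)
  then show "\<exists>y\<in>S. nrm (Hip \<nu>) (f - y) < e" using pS by blast
qed

text \<open>By induction on \<open>m\<close>: after removing the terms of degree below \<open>m\<close> from the power series of the
  kernel function at a small point \<open>t\<close>, what remains is a multiple of the monomial up to \<open>O(t)\<close>.\<close>
lemma monomial_in_clos_kern_span:
  assumes \<nu>: "0 < \<nu>"
  shows "monomial m \<in> clos (Hs \<nu>) (Hip \<nu>) (kern_span \<nu>)"
proof (induction m rule: less_induct)
  case (less m)
  interpret hilbert "Hs \<nu>" "Hip \<nu>" by (rule hilbert_Hs[OF \<nu>])
  let ?C = "clos (Hs \<nu>) (Hip \<nu>) (kern_span \<nu>)"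
  note sub = kern_span_subset[OF \<nu>]
  have Cadd: "f + g \<in> ?C" if "f \<in> ?C" "g \<in> ?C" for f g
    using that by (intro clos_add sub kern_span_add)
  have Cscale: "cscale c f \<in> ?C" if "f \<in> ?C" for c f
    using that by (intro clos_scale sub kern_span_scale)
  have C0: "0 \<in> ?C" using clos_superset[OF sub] kern_span_zero by blast
  show ?case
  proof (rule clos_clos[OF sub monomial_mem[OF \<nu>]])
    fix e :: real assume e: "e > 0"
    define r where "r k = wt \<nu> m / wt \<nu> (m + 1 + k)" for k
    have wp: "wt \<nu> k > 0" for k by (rule wt_pos[OF \<nu>])
    \<comment> \<open>Bounds the squared norm of the remainder divided by t^2; the ratio 1/4 is
      (1/2)^2, since t will be at most 1/2.\<close>
    define K where "K = (\<Sum>k. wt \<nu> m * r k * (1/4) ^ k)"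
    have sK: "summable (\<lambda>k. wt \<nu> m * r k * (1/4) ^ k)"
    proof -
      have "summable (\<lambda>k. (1/4::real) ^ (k + (m + 1)) / wt \<nu> (k + (m + 1)))"
        using kernel_coeff_summable[of "1/4" \<nu>] \<nu> by (subst summable_iff_shift) auto
      then have "summable (\<lambda>k. wt \<nu> m * wt \<nu> m * 4 ^ (m + 1) * ((1/4::real) ^ (k + (m + 1)) / wt \<nu> (k + (m + 1))))"
        by (rule summable_mult)
      moreover have "wt \<nu> m * wt \<nu> m * 4 ^ (m + 1) * ((1/4::real) ^ (k + (m + 1)) / wt \<nu> (k + (m + 1)))
          = wt \<nu> m * r k * (1/4) ^ k" for k
        by (simp add: r_def power_add power_one_over field_simps)
      ultimately show ?thesis by simp
    qed
    have K0: "0 \<le> K" unfolding K_def using wp by (intro suminf_nonneg sK) (simp add: r_def less_imp_le)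
    \<comment> \<open>The summand 1 keeps the denominator positive when K = 0 and makes the
      resulting estimate t * sqrt K < e strict.\<close>
    define t where "t = min (1/2) (e / (sqrt K + 1))"
    have K1: "0 < sqrt K + 1" using K0 by (simp add: add_nonneg_pos)
    have t: "0 < t" "t \<le> 1/2" unfolding t_def using e K1 by (simp_all only: min_less_iff_conj) auto
    have tK: "t * sqrt K < e"
    proof -
      have "t \<le> e / (sqrt K + 1)" unfolding t_def by (rule min.cobounded2)
      then have "t * (sqrt K + 1) \<le> e" unfolding pos_le_divide_eq[OF K1] .
      then show ?thesis using t by (simp add: algebra_simps)
    qed
    have t1: "norm (complex_of_real t) < 1" using t by simp
    define p where "p n = (\<Sum>j<n. cscale (of_real (t ^ j / wt \<nu> j)) (monomial j))" for n
    have pC: "n \<le> m \<Longrightarrow> p n \<in> ?C" for n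
      unfolding p_def
      by (induction n) (simp_all only: sum.lessThan_Suc lessThan_0 sum.empty Cadd Cscale C0 less Suc_le_eq less_imp_le)
    have pH: "p n \<in> Hs \<nu>" for n unfolding p_def by (intro sum_mem scale_mem monomial_mem \<nu>)
    have tp: "tcoef (p n) k = (if k < n then of_real (t ^ k / wt \<nu> k) else 0)" for n k
    proof (induction n)
      case (Suc n)
      have "tcoef (p (Suc n)) k = tcoef (p n) k + of_real (t ^ n / wt \<nu> n) * tcoef (monomial n) k"
        using pH[of n] monomial_mem[OF \<nu>, of n] scale_mem[OF monomial_mem[OF \<nu>]]
        by (simp add: p_def tcoef_add tcoef_scale Hs_holomorphic[where \<nu> = \<nu>])
      then show ?case using Suc by (auto simp: tcoef_monomial less_Suc_eq)
    qed (simp add: p_def tcoef_zero del: zero_fun_apply, simp)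
    \<comment> \<open>The factor normalises the coefficient of degree m to 1; lower degrees have
      been subtracted.\<close>
    define g where "g = cscale (of_real (wt \<nu> m / t ^ m)) (kern \<nu> (of_real t) - p m)"
    have gC: "g \<in> ?C"
    proof -
      have "kern \<nu> (of_real t) + cscale (-1) (p m) \<in> ?C"
        using clos_superset[OF sub] kern_span_kern[OF t1] pC[of m] by (intro Cadd Cscale) auto
      then show ?thesis unfolding g_def by (intro Cscale) (simp add: cscale_neg_one)
    qed
    have kH: "kern \<nu> (of_real t) \<in> Hs \<nu>" by (rule kern_in_Hs[OF \<nu> t1])
    have d: "monomial m - g \<in> Hs \<nu>" using gC clos_subset by (intro diff_mem monomial_mem \<nu>) auto
    have td: "tcoef (monomial m - g) k = (if k \<le> m then 0 else - of_real (wt \<nu> m / t ^ m * (t ^ k / wt \<nu> k)))" for k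
    proof -
      have "tcoef g k = of_real (wt \<nu> m / t ^ m) * (tcoef (kern \<nu> (of_real t)) k - tcoef (p m) k)"
        unfolding g_def using diff_mem[OF kH pH]
        by (simp only: tcoef_scale Hs_holomorphic[where \<nu> = \<nu>] tcoef_diff kH pH)
      moreover have "tcoef (monomial m - g) k = tcoef (monomial m) k - tcoef g k"
        using gC clos_subset by (intro tcoef_diff Hs_holomorphic[where \<nu> = \<nu>] monomial_mem \<nu>) auto
      ultimately show ?thesis
        using t wp[of m] unfolding tcoef_monomial tp tcoef_kern[OF t1] by (auto simp: mult_ac)
    qed
    have "(nrm (Hip \<nu>) (monomial m - g))\<^sup>2 = (\<Sum>k. wt \<nu> k * (cmod (tcoef (monomial m - g) k))\<^sup>2)"
      by (rule Hip_nrm_sq[OF \<nu> d])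
    also have "\<dots> = (\<Sum>i. wt \<nu> (i + (m + 1)) * (cmod (tcoef (monomial m - g) (i + (m + 1))))\<^sup>2)
        + (\<Sum>k<m + 1. wt \<nu> k * (cmod (tcoef (monomial m - g) k))\<^sup>2)"
      using Hs_tcoef[OF d] by (intro suminf_split_initial_segment) (simp add: wl2_def)
    also have "\<dots> = (\<Sum>i. wt \<nu> (i + (m + 1)) * (cmod (tcoef (monomial m - g) (i + (m + 1))))\<^sup>2)"
      by (simp add: td)
    also have "\<dots> \<le> (\<Sum>i. t\<^sup>2 * (wt \<nu> m * r i * (1/4) ^ i))"
    proof (rule suminf_le)
      have "summable (\<lambda>k. wt \<nu> k * (cmod (tcoef (monomial m - g) k))\<^sup>2)"
        using Hs_tcoef[OF d] by (simp add: wl2_def)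
      then show "summable (\<lambda>i. wt \<nu> (i + (m + 1)) * (cmod (tcoef (monomial m - g) (i + (m + 1))))\<^sup>2)"
        by (subst summable_iff_shift)
      fix i
      have "cmod (tcoef (monomial m - g) (i + (m + 1))) = wt \<nu> m / t ^ m * (t ^ (i + (m + 1)) / wt \<nu> (i + (m + 1)))"
        unfolding td using t wp[of m] wp[of "i + (m + 1)"] by (simp add: norm_mult norm_divide norm_power)
      also have "\<dots> = t * (t ^ i * r i)" using t by (simp add: r_def power_add field_simps)
      finally have "wt \<nu> (i + (m + 1)) * (cmod (tcoef (monomial m - g) (i + (m + 1))))\<^sup>2
          = t\<^sup>2 * ((wt \<nu> (i + (m + 1)) * r i) * r i * (t\<^sup>2) ^ i)"
        by (simp add: power_mult_distrib power2_eq_square mult_ac flip: power_mult)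
      also have "wt \<nu> (i + (m + 1)) * r i = wt \<nu> m" using wp[of "i + (m + 1)"] by (simp add: r_def add.commute)
      also have "t\<^sup>2 * (wt \<nu> m * r i * (t\<^sup>2) ^ i) \<le> t\<^sup>2 * (wt \<nu> m * r i * (1/4) ^ i)"
      proof -
        have "t\<^sup>2 \<le> (1/2)\<^sup>2" using t by (intro power_mono) auto
        then have "t\<^sup>2 \<le> 1/4" by (simp add: power_divide)
        then have "(t\<^sup>2) ^ i \<le> (1/4) ^ i" by (rule power_mono) (rule zero_le_power2)
        moreover have "0 \<le> wt \<nu> m * r i" unfolding r_def by (intro mult_nonneg_nonneg divide_nonneg_nonneg less_imp_le wp)
        ultimately show ?thesis by (intro mult_left_mono zero_le_power2)
      qed
      finally show "wt \<nu> (i + (m + 1)) * (cmod (tcoef (monomial m - g) (i + (m + 1))))\<^sup>2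
          \<le> t\<^sup>2 * (wt \<nu> m * r i * (1/4) ^ i)" .
    qed (intro summable_mult sK)
    also have "\<dots> = (t * sqrt K)\<^sup>2"
      unfolding suminf_mult[OF sK] K_def[symmetric] power_mult_distrib real_sqrt_pow2[OF K0] by (rule refl)
    finally have "nrm (Hip \<nu>) (monomial m - g) \<le> t * sqrt K"
      by (rule power2_le_imp_le) (use t K0 in simp)
    then have "nrm (Hip \<nu>) (monomial m - g) < e" using tK by linarith
    then show "\<exists>y\<in>?C. nrm (Hip \<nu>) (monomial m - y) < e" using gC by blast
  qed
qed

lemma kern_span_dense:
  assumes \<nu>: "0 < \<nu>" and f: "f \<in> Hs \<nu>"
  shows "f \<in> clos (Hs \<nu>) (Hip \<nu>) (kern_span \<nu>)"
proof -
  interpret hilbert "Hs \<nu>" "Hip \<nu>" by (rule hilbert_Hs[OF \<nu>])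
  note sub = kern_span_subset[OF \<nu>]
  have "f \<in> clos (Hs \<nu>) (Hip \<nu>) (clos (Hs \<nu>) (Hip \<nu>) (kern_span \<nu>))"
  proof (rule Hs_clos_monomials[OF \<nu> monomial_in_clos_kern_span[OF \<nu>] _ _ f])
    show "g + h \<in> clos (Hs \<nu>) (Hip \<nu>) (kern_span \<nu>)"
      if "g \<in> clos (Hs \<nu>) (Hip \<nu>) (kern_span \<nu>)" "h \<in> clos (Hs \<nu>) (Hip \<nu>) (kern_span \<nu>)" for g h
      using clos_add[OF sub kern_span_add that] .
    show "cscale c g \<in> clos (Hs \<nu>) (Hip \<nu>) (kern_span \<nu>)"
      if "g \<in> clos (Hs \<nu>) (Hip \<nu>) (kern_span \<nu>)" for c g
      using clos_scale[OF sub kern_span_scale that] .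
  qed
  then show ?thesis by (intro clos_clos[OF sub f]) (auto simp: clos_def)
qed

section \<open>Unitarity of the representation\<close>

lemma Dplus_zero: "Dplus \<nu> z 0 = 0"
  using Dplus_scale[of \<nu> z 0 0] by simp

text \<open>The isometry relation is stated for every \<open>u\<close> whose image lies in the
  space: this is first known for the span, and for all \<open>u\<close> once
  \<open>Dplus_mem\<close> is available. On a kernel function it follows from applying
  \<open>Dplus\<close> twice, the projective factors cancelling.\<close>

lemma kern_span_Dplus:
  assumes \<nu>: "0 < \<nu>" and z: "norm z < 1" and v: "v \<in> kern_span \<nu>"
  shows "Dplus \<nu> z v \<in> Hs \<nu>"
    and "u \<in> Hs \<nu> \<Longrightarrow> Dplus \<nu> z u \<in> Hs \<nu> \<Longrightarrow> Hip \<nu> (Dplus \<nu> z u) (Dplus \<nu> z v) = Hip \<nu> u v"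
proof -
  interpret hilbert "Hs \<nu>" "Hip \<nu>" by (rule hilbert_Hs[OF \<nu>])
  have "Dplus \<nu> z v \<in> Hs \<nu> \<and>
      (\<forall>u. u \<in> Hs \<nu> \<longrightarrow> Dplus \<nu> z u \<in> Hs \<nu> \<longrightarrow> Hip \<nu> (Dplus \<nu> z u) (Dplus \<nu> z v) = Hip \<nu> u v)"
    using v
  proof induction
    case (kern_span_kern a)
    have "Hip \<nu> (Dplus \<nu> z u) (Dplus \<nu> z (kern \<nu> a)) = Hip \<nu> u (kern \<nu> a)"
      if u: "u \<in> Hs \<nu>" "Dplus \<nu> z u \<in> Hs \<nu>" for u
    proof -
      have "Hip \<nu> (Dplus \<nu> z u) (Dplus \<nu> z (kern \<nu> a)) = cis (- pi * \<nu>) * Dplus \<nu> z (Dplus \<nu> z u) a"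
        by (rule Hip_Dplus_kern[OF \<nu> z kern_span_kern u(2)])
      also have "\<dots> = (cis (- pi * \<nu>) * cis (pi * \<nu>)) * u a"
        using Dplus_Dplus[OF z, of u \<nu>] Hs_off[OF u(1)] by (simp add: cscale_fun_def cscale_complex_def)
      also have "\<dots> = Hip \<nu> u (kern \<nu> a)" by (simp add: cis_mult Hip_kern[OF \<nu> u(1) kern_span_kern])
      finally show ?thesis .
    qed
    moreover have "Dplus \<nu> z (kern \<nu> a) \<in> Hs \<nu>"
      unfolding Dplus_kern[OF z kern_span_kern] by (intro scale_mem kern_in_Hs \<nu> norm_mobius z kern_span_kern)
    ultimately show ?case by blast
  next
    case (kern_span_add f g)
    then show ?case using kern_span_subset[OF \<nu>] by (auto simp: Dplus_add add_mem ip_add_right subset_iff simp del: plus_fun_apply)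
  next
    case (kern_span_scale f c)
    then show ?case using kern_span_subset[OF \<nu>] by (auto simp: Dplus_scale scale_mem ip_scale_right subset_iff)
  qed (simp add: Dplus_zero zero_mem del: zero_fun_apply)
  then show "Dplus \<nu> z v \<in> Hs \<nu>"
    and "u \<in> Hs \<nu> \<Longrightarrow> Dplus \<nu> z u \<in> Hs \<nu> \<Longrightarrow> Hip \<nu> (Dplus \<nu> z u) (Dplus \<nu> z v) = Hip \<nu> u v"
    by blast+
qed

text \<open>Point evaluation is pairing with a kernel function, hence continuous.\<close>

lemma converges_eval:
  assumes \<nu>: "0 < \<nu>" and X: "\<And>n. X n \<in> Hs \<nu>" "inner_space.converges (Hs \<nu>) (Hip \<nu>) X f" and a: "norm a < 1"
  shows "(\<lambda>n. X n a) \<longlonglongrightarrow> f a"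
proof -
  interpret hilbert "Hs \<nu>" "Hip \<nu>" by (rule hilbert_Hs[OF \<nu>])
  have "f \<in> Hs \<nu>" using X(2) by (simp add: converges_def)
  then show ?thesis
    using converges_ip[OF X(1,2) kern_in_Hs[OF \<nu> a]] X(1) by (simp add: Hip_kern[OF \<nu> _ a])
qed

text \<open>The isometry on the dense span extends abstractly; norm limits are pointwise limits, so
  the extension is given by the same formula.\<close>

lemma Dplus_limit:
  assumes \<nu>: "0 < \<nu>" and z: "norm z < 1" and f: "f \<in> Hs \<nu>"
  shows "\<exists>X. (\<forall>n. X n \<in> kern_span \<nu>) \<and> inner_space.converges (Hs \<nu>) (Hip \<nu>) X f
      \<and> inner_space.converges (Hs \<nu>) (Hip \<nu>) (\<lambda>n. Dplus \<nu> z (X n)) (Dplus \<nu> z f)"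
proof -
  interpret hilbert "Hs \<nu>" "Hip \<nu>" by (rule hilbert_Hs[OF \<nu>])
  note sub = kern_span_subset[OF \<nu>]
  have subD: "u \<in> Hs \<nu>" if "u \<in> kern_span \<nu>" for u using sub that by blast
  interpret isometric_pair "kern_span \<nu>" "Hip \<nu>" "Hs \<nu>" "Hip \<nu>" "Hs \<nu>" "Hip \<nu>" "\<lambda>f. f" "Dplus \<nu> z"
  proof unfold_locales
    show "linear_on (kern_span \<nu>) (\<lambda>f. f)" by (simp add: linear_on_def)
    show "linear_on (kern_span \<nu>) (Dplus \<nu> z)" by (rule Dplus_linear)
    show "Hip \<nu> y x = cnj (Hip \<nu> x y)" if "x \<in> kern_span \<nu>" "y \<in> kern_span \<nu>" for x y
      by (intro ip_sym subD that)
  qed (simp_all only: kern_span_zero kern_span_add kern_span_scale subD ip_add_left ip_scale_left ip_nonneg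
      kern_span_Dplus[OF \<nu> z])
  obtain g where "limit_pair (Hs \<nu>) (Hip \<nu>) (Hs \<nu>) (Hip \<nu>) (kern_span \<nu>) (\<lambda>f. f) (Dplus \<nu> z) f g"
    using limit_pair_total[of f] kern_span_dense[OF \<nu> f] by auto
  then obtain X where X: "\<And>n. X n \<in> kern_span \<nu>" "converges X f" "converges (\<lambda>n. Dplus \<nu> z (X n)) g"
    unfolding limit_pair_def by blast
  have XH: "X n \<in> Hs \<nu>" "Dplus \<nu> z (X n) \<in> Hs \<nu>" for n using X(1)[of n] sub kern_span_Dplus[OF \<nu> z] by auto
  have g: "g \<in> Hs \<nu>" using X(3) by (simp add: converges_def)
  have "g = Dplus \<nu> z f"
  proof
    fix w
    show "g w = Dplus \<nu> z f w"
    proof (cases "norm w < 1")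
      case w: True
      have "(\<lambda>n. Dplus \<nu> z (X n) w) \<longlonglongrightarrow> g w" by (rule converges_eval[OF \<nu> XH(2) X(3) w])
      moreover have "(\<lambda>n. Dplus \<nu> z (X n) w) \<longlonglongrightarrow> Dplus \<nu> z f w"
        unfolding Dplus_in[OF w]
        by (intro tendsto_mult tendsto_const converges_eval[OF \<nu> XH(1) X(2)] norm_mobius z w)
      ultimately show ?thesis by (rule LIMSEQ_unique)
    qed (use g in \<open>simp add: Dplus_off Hs_off\<close>)
  qed
  then show ?thesis using X by blast
qed

lemma Dplus_mem:
  assumes "0 < \<nu>" "norm z < 1" "f \<in> Hs \<nu>"
  shows "Dplus \<nu> z f \<in> Hs \<nu>"
proof -
  interpret hilbert "Hs \<nu>" "Hip \<nu>" by (rule hilbert_Hs[OF assms(1)])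
  show ?thesis using Dplus_limit[OF assms] by (auto simp: converges_def)
qed

lemma Dplus_isometric:
  assumes \<nu>: "0 < \<nu>" and z: "norm z < 1" and f: "f \<in> Hs \<nu>" and g: "g \<in> Hs \<nu>"
  shows "Hip \<nu> (Dplus \<nu> z f) (Dplus \<nu> z g) = Hip \<nu> f g"
proof -
  interpret hilbert "Hs \<nu>" "Hip \<nu>" by (rule hilbert_Hs[OF \<nu>])
  obtain Y where Y: "\<And>n. Y n \<in> kern_span \<nu>" "converges Y g" "converges (\<lambda>n. Dplus \<nu> z (Y n)) (Dplus \<nu> z g)"
    using Dplus_limit[OF \<nu> z g] by blast
  have YH: "Y n \<in> Hs \<nu>" for n using Y(1)[of n] kern_span_subset[OF \<nu>] by auto
  have Df: "Dplus \<nu> z f \<in> Hs \<nu>" by (rule Dplus_mem[OF \<nu> z f])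
  have const: "converges (\<lambda>n. u) u" if "u \<in> Hs \<nu>" for u using that by (simp add: converges_def)
  have "(\<lambda>n. Hip \<nu> (Dplus \<nu> z f) (Dplus \<nu> z (Y n))) \<longlonglongrightarrow> Hip \<nu> (Dplus \<nu> z f) (Dplus \<nu> z g)"
    by (intro converges_ip2[OF Df _ const[OF Df] Y(3)] Dplus_mem \<nu> z YH)
  moreover have "(\<lambda>n. Hip \<nu> f (Y n)) \<longlonglongrightarrow> Hip \<nu> f g"
    by (intro converges_ip2[OF f YH const[OF f] Y(2)])
  moreover have "Hip \<nu> (Dplus \<nu> z f) (Dplus \<nu> z (Y n)) = Hip \<nu> f (Y n)" for n
    by (rule kern_span_Dplus(2)[OF \<nu> z Y(1) f Df])
  ultimately show ?thesis using LIMSEQ_unique by simp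
qed

text \<open>For an invertible isometry the adjoint is the inverse, which \<open>Dplus_Dplus\<close>
  supplies.\<close>

lemma Dplus_adjoint:
  assumes \<nu>: "0 < \<nu>" and z: "norm z < 1" and y: "y \<in> Hs \<nu>"
  shows "cscale (cis (- pi * \<nu>)) (Dplus \<nu> z y) \<in> Hs \<nu>"
    and "u \<in> Hs \<nu> \<Longrightarrow> Hip \<nu> (Dplus \<nu> z u) y = Hip \<nu> u (cscale (cis (- pi * \<nu>)) (Dplus \<nu> z y))"
    and "Dplus \<nu> z (cscale (cis (- pi * \<nu>)) (Dplus \<nu> z y)) = y"
    and "adjoint (Hs \<nu>) (Hip \<nu>) (Hs \<nu>) (Hip \<nu>) (Dplus \<nu> z) y = cscale (cis (- pi * \<nu>)) (Dplus \<nu> z y)"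
proof -
  interpret hilbert "Hs \<nu>" "Hip \<nu>" by (rule hilbert_Hs[OF \<nu>])
  let ?y = "cscale (cis (- pi * \<nu>)) (Dplus \<nu> z y)"
  show mem: "?y \<in> Hs \<nu>" by (intro scale_mem Dplus_mem \<nu> z y)
  have "Dplus \<nu> z (Dplus \<nu> z y) = cscale (cis (pi * \<nu>)) y"
    by (rule Dplus_Dplus[OF z]) (rule Hs_off[OF y])
  then show inv: "Dplus \<nu> z ?y = y"
    by (simp add: Dplus_scale cscale_cscale cis_mult cscale_one)
  show adj: "Hip \<nu> (Dplus \<nu> z u) y = Hip \<nu> u ?y" if "u \<in> Hs \<nu>" for u
    using Dplus_isometric[OF \<nu> z that mem] by (simp only: inv)
  show "adjoint (Hs \<nu>) (Hip \<nu>) (Hs \<nu>) (Hip \<nu>) (Dplus \<nu> z) y = ?y"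
    by (rule adjoint_eqI) (rule mem, erule adj)
qed

section \<open>Characteristic functions of a single weight and their products\<close>

lemma pw_has_field_derivative:
  assumes "0 < Re (1 - cnj z * w)"
  shows "((\<lambda>w. pw \<mu> (1 - cnj z * w)) has_field_derivative
      of_real \<mu> * cnj z * pw \<mu> (1 - cnj z * w) / (1 - cnj z * w)) (at w)"
proof -
  have "1 - cnj z * w \<notin> \<real>\<^sub>\<le>\<^sub>0" using assms by (auto simp: complex_nonpos_Reals_iff)
  then show ?thesis
    unfolding pw_def by (auto intro!: derivative_eq_intros simp: divide_inverse mult_ac)
qed

lemma mobius_has_field_derivative:
  assumes "1 - cnj z * w \<noteq> 0"
  shows "(mobius z has_field_derivative - (1 - cnj z * z) / (1 - cnj z * w)\<^sup>2) (at w)"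
  unfolding mobius_def[abs_def] using assms
  by (auto intro!: derivative_eq_intros simp: power2_eq_square algebra_simps)

lemma pw_Suc: "u \<noteq> 0 \<Longrightarrow> pw (\<mu> + 2) u = pw \<mu> u / u\<^sup>2"
proof -
  assume "u \<noteq> 0"
  then have "exp (2 * Ln u) = u\<^sup>2" using exp_of_nat_mult[of 2 "Ln u"] by simp
  moreover have "pw (\<mu> + 2) u = exp (- complex_of_real \<mu> * Ln u - 2 * Ln u)"
    by (simp add: pw_def algebra_simps)
  ultimately show ?thesis by (simp add: pw_def exp_diff)
qed

text \<open>The sign is cis pi. Together with 1 - |z|^2 it forms the numerator of the derivative of
  \<phi>_z, by which the multiplier changes when the exponent grows by 2.\<close>

lemma dplus_const_add2:
  assumes "norm z < 1"
  shows "dplus_const (\<mu> + 2) z = - (dplus_const \<mu> z * (1 - cnj z * z))"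
proof -
  have p: "0 < 1 - (norm z)\<^sup>2" by (rule norm_sq_less_1[OF assms])
  have "pi * (\<mu> + 2) / 2 = pi * \<mu> / 2 + pi" by (simp add: field_simps)
  then have "cis (pi * (\<mu> + 2) / 2) = cis (pi * \<mu> / 2) * cis pi" by (simp only: cis_mult)
  then have "cis (pi * (\<mu> + 2) / 2) = - cis (pi * \<mu> / 2)" by simp
  moreover have "(1 - (norm z)\<^sup>2) powr ((\<mu> + 2) / 2) = (1 - (norm z)\<^sup>2) powr (\<mu> / 2) * (1 - (norm z)\<^sup>2)"
    using p by (simp add: add_divide_distrib powr_add)
  moreover have "of_real (1 - (norm z)\<^sup>2) = 1 - cnj z * z"
    by (simp only: of_real_diff of_real_1 complex_norm_square mult.commute)
  ultimately show ?thesis unfolding dplus_const_def by (simp only: of_real_mult mult_minus_left mult.assoc)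
qed

text \<open>Product rule: differentiating f o \<phi>_z gives the multiplier of exponent \<mu>+2
  applied to the derivative of f; differentiating the multiplier gives a term which, pulled back
  through \<phi>_z by \<open>one_minus_mobius_self\<close>, is a multiple of f / (1 - cnj z w). The
  quotient is prescribed on the disc alone so that a solution of a Neumann equation can be
  inserted.\<close>

lemma dop1_Dplus:
  assumes z: "norm z < 1" and f: "f holomorphic_on ball 0 1"
    and h: "\<And>w. norm w < 1 \<Longrightarrow> h w = f w / (1 - cnj z * w)"
  shows "dop 1 (Dplus \<mu> z f) = Dplus (\<mu> + 2) z (dop 1 f - cscale (of_real \<mu> * cnj z) h)"
proof
  fix w
  show "dop 1 (Dplus \<mu> z f) w = Dplus (\<mu> + 2) z (dop 1 f - cscale (of_real \<mu> * cnj z) h) w"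
  proof (cases "norm w < 1")
    case w: True
    define u where "u = 1 - cnj z * w"
    define v where "v = mobius z w"
    define d where "d = 1 - cnj z * z"
    have v1: "norm v < 1" unfolding v_def by (rule norm_mobius[OF z w])
    have u0: "u \<noteq> 0" unfolding u_def by (rule one_minus_neq_0[OF z w])
    have d0: "d \<noteq> 0" unfolding d_def by (rule one_minus_neq_0[OF z z])
    have uv: "u * (1 - cnj z * v) = d"
      using one_minus_mobius_self[OF z w] unfolding u_def v_def d_def
      by (simp only: of_real_diff of_real_1 complex_norm_square mult.commute)
    have df: "(f has_field_derivative deriv f v) (at v)"
      using f v1 by (intro holomorphic_derivI[of f "ball 0 1"]) auto
    have dm: "(mobius z has_field_derivative - d / u\<^sup>2) (at w)"
      using mobius_has_field_derivative[of z w] u0 unfolding u_def d_def by simp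
    have dc: "((\<lambda>w. f (mobius z w)) has_field_derivative deriv f v * (- d / u\<^sup>2)) (at w)"
      using DERIV_chain2[of f "deriv f v" "mobius z" w "- d / u\<^sup>2" UNIV] df dm unfolding v_def by simp
    have dp: "((\<lambda>w. pw \<mu> (1 - cnj z * w)) has_field_derivative of_real \<mu> * cnj z * pw \<mu> u / u) (at w)"
      unfolding u_def by (rule pw_has_field_derivative[OF Re_one_minus_pos[OF z w]])
    have "((\<lambda>w. dplus_const \<mu> z * pw \<mu> (1 - cnj z * w) * f (mobius z w)) has_field_derivative
        dplus_const \<mu> z * (of_real \<mu> * cnj z * pw \<mu> u / u * f v + deriv f v * (- d / u\<^sup>2) * pw \<mu> u)) (at w)"
      using DERIV_cmult[OF DERIV_mult[OF dp dc], of "dplus_const \<mu> z"]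
      unfolding u_def[symmetric] v_def[symmetric] by (simp add: mult.assoc)
    then have "(Dplus \<mu> z f has_field_derivative
        dplus_const \<mu> z * (of_real \<mu> * cnj z * pw \<mu> u / u * f v + deriv f v * (- d / u\<^sup>2) * pw \<mu> u)) (at w)"
      by (rule has_field_derivative_transform_within_open[of _ _ _ "ball 0 1"]) (use w in \<open>auto simp: Dplus_in\<close>)
    then have lhs: "dop 1 (Dplus \<mu> z f) w
        = dplus_const \<mu> z * (of_real \<mu> * cnj z * pw \<mu> u / u * f v + deriv f v * (- d / u\<^sup>2) * pw \<mu> u)"
      using w by (simp add: dop_def dres_def DERIV_imp_deriv)
    have hv: "h v = f v * u / d"
    proof -
      have "1 - cnj z * v = d / u" using uv u0 by (simp add: field_simps)
      then show ?thesis by (simp add: h[OF v1])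
    qed
    have "Dplus (\<mu> + 2) z (dop 1 f - cscale (of_real \<mu> * cnj z) h) w
        = - (dplus_const \<mu> z * d) * (pw \<mu> u / u\<^sup>2) * (deriv f v - of_real \<mu> * cnj z * (f v * u / d))"
      using v1 u0 by (simp add: Dplus_in[OF w] pw_Suc dplus_const_add2[OF z] u_def[symmetric] v_def[symmetric]
          d_def[symmetric] dop_def dres_def cscale_fun_def cscale_complex_def hv)
    also have "\<dots> = dplus_const \<mu> z * (of_real \<mu> * cnj z * pw \<mu> u / u * f v + deriv f v * (- d / u\<^sup>2) * pw \<mu> u)"
      using u0 d0 by (simp add: field_simps power2_eq_square)
    finally show ?thesis using lhs by simp
  qed (simp add: dop_def dres_def Dplus_off)
qed

section \<open>The characteristic function of one weight as a transfer function\<close>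

context weight
begin

lemma adjoint_dop1: "g \<in> Hp \<Longrightarrow> adjoint Hm (Hip (\<nu> - 1)) Hp (Hip (\<nu> + 1)) (dop 1) g = cscale (of_real s) (B' g)"
proof -
  assume g: "g \<in> Hp"
  have "Hip (\<nu> + 1) (dop 1 f) g = Hip (\<nu> - 1) f (cscale (of_real s) (B' g))" if f: "f \<in> Hm" for f
  proof -
    have "dop 1 f = cscale (of_real s) (B f)" by (simp add: B_def cscale_cscale cscale_one)
    then show ?thesis using f g by (simp add: Hp.ip_scale_left Hm.ip_scale_right B_mem B'_mem B_adj)
  qed
  then show ?thesis using g by (intro Hm.adjoint_eqI Hm.scale_mem B'_mem)
qed

abbreviation Dm_inv where "Dm_inv z f \<equiv> cscale (cis (- pi * (\<nu> - 1))) (Dplus (\<nu> - 1) z f)"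

text \<open>The norming constant 1/s cancels the s in the adjoint of \<open>dop 1\<close>, and the
  adjoint of \<open>Dplus\<close> becomes its inverse.\<close>

lemma theta1_eq:
  assumes z: "norm z < 1" and g: "g \<in> Hp"
  shows "theta1 \<nu> z g = Dm_inv z (B' (Dplus (\<nu> + 1) z g))"
proof -
  have \<nu>: "0 < \<nu> - 1" "0 < \<nu> + 1" using weight_gt_1 by simp_all
  have Dg: "Dplus (\<nu> + 1) z g \<in> Hp" by (rule Dplus_mem[OF \<nu>(2) z g])
  have "theta1 \<nu> z g = cscale (of_real (1 / s)) (Dm_inv z (cscale (of_real s) (B' (Dplus (\<nu> + 1) z g))))"
    unfolding theta1_def s_def[symmetric] adjoint_dop1[OF Dg]
    by (subst Dplus_adjoint(4)[OF \<nu>(1) z]) (simp_all add: Hm.scale_mem B'_mem[OF Dg])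
  then show ?thesis by (simp add: Dplus_scale cscale_cscale mult.commute)
qed

lemma theta1_mem:
  assumes "norm z < 1" and "g \<in> Hp"
  shows "theta1 \<nu> z g \<in> Hm"
  unfolding theta1_eq[OF assms] using assms weight_gt_1
  by (intro Dplus_adjoint(1) B'_mem Dplus_mem) simp_all

text \<open>Tested against f in \<open>Hm\<close>, the left side is an inner product of two images
  under \<open>Dplus (\<nu> + 1) z\<close>, once \<open>B\<close> has been moved past
  \<open>Dplus\<close> at the cost of the term cnj z L h with h = f / (1 - cnj z w). The isometry
  removes both images, and the extra term becomes the contribution of the state.\<close>

lemma theta1_transfer:
  assumes z: "norm z < 1" and g: "g \<in> Hp"
  shows "\<exists>x\<in>H0. x = T' (cscale z x) + L' g \<and> theta1 \<nu> z g = J' (cscale z x) + B' g"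
proof -
  have \<nu>: "0 < \<nu> - 1" "0 < \<nu> + 1" using weight_gt_1 by simp_all
  have zc: "norm (cnj z) < 1" using z by simp
  obtain x where x: "x \<in> H0" "x - cscale z (T' x) = L' g"
    using H0.neumann[OF T'_mem T'_linear nrm_T'_le z L'_mem[OF g]] by blast
  have zx: "cscale z x \<in> H0" by (rule H0.scale_mem[OF x(1)])
  have "x = T' (cscale z x) + L' g"
    using x by (simp add: linear_on_scale[OF T'_linear] algebra_simps)
  moreover have "theta1 \<nu> z g = J' (cscale z x) + B' g"
  proof (rule Hm.eq_if_ip_eq)
    show "theta1 \<nu> z g \<in> Hm" by (rule theta1_mem[OF z g])
    show "J' (cscale z x) + B' g \<in> Hm" by (intro Hm.add_mem J'_mem zx B'_mem g)
    fix f assume f: "f \<in> Hm"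
    \<comment> \<open>The quotient of f by 1 - cnj z w is obtained from a Neumann series, which also
      shows that it lies in \<open>H0\<close>.\<close>
    obtain h where h: "h \<in> H0" "h - cscale (cnj z) (T h) = f"
      using H0.neumann[OF T_mem T_linear nrm_T_le zc J_mem[OF f]] by blast
    have hw: "h w = f w / (1 - cnj z * w)" if "norm w < 1" for w
    proof -
      have "h w * (1 - cnj z * w) = f w"
        using fun_cong[OF h(2), of w] by (simp add: T_def cscale_fun_def cscale_complex_def algebra_simps)
      then show ?thesis using one_minus_neq_0[OF z that] by (simp add: field_simps)
    qed
    \<comment> \<open>The constant of \<open>L\<close> is exactly the one left by
      \<open>dop1_Dplus\<close> for \<mu> = \<nu>-1 after division by s.\<close>
    have Lh: "cscale (of_real (1 / s)) (cscale (of_real (\<nu> - 1) * cnj z) h) = - cscale (cnj z) (L h)"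
      by (simp add: L_def cscale_cscale cscale_minus_left[symmetric] mult_ac)
    have Df: "Dplus (\<nu> - 1) z f \<in> Hm" by (rule Dplus_mem[OF \<nu>(1) z f])
    have Dg: "Dplus (\<nu> + 1) z g \<in> Hp" by (rule Dplus_mem[OF \<nu>(2) z g])
    have zL: "cscale (cnj z) (L h) \<in> Hp" by (intro Hp.scale_mem L_mem h(1))
    have BD: "B (Dplus (\<nu> - 1) z f) = Dplus (\<nu> + 1) z (B f + cscale (cnj z) (L h))"
    proof -
      have "dop 1 (Dplus (\<nu> - 1) z f) = Dplus (\<nu> - 1 + 2) z (dop 1 f - cscale (of_real (\<nu> - 1) * cnj z) h)"
        by (rule dop1_Dplus[OF z Hs_holomorphic[OF f] hw])
      then have "B (Dplus (\<nu> - 1) z f)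
          = Dplus (\<nu> + 1) z (cscale (of_real (1 / s)) (dop 1 f - cscale (of_real (\<nu> - 1) * cnj z) h))"
        unfolding B_def Dplus_scale by (simp add: add.commute)
      then show ?thesis unfolding cscale_diff_right Lh by (simp add: B_def)
    qed
    have "Hip (\<nu> - 1) f (theta1 \<nu> z g) = Hip (\<nu> - 1) (Dplus (\<nu> - 1) z f) (B' (Dplus (\<nu> + 1) z g))"
      unfolding theta1_eq[OF z g] by (rule Dplus_adjoint(2)[OF \<nu>(1) z B'_mem[OF Dg] f, symmetric])
    also have "\<dots> = Hip (\<nu> + 1) (Dplus (\<nu> + 1) z (B f + cscale (cnj z) (L h))) (Dplus (\<nu> + 1) z g)"
      unfolding B_adj[OF Df Dg, symmetric] BD ..
    also have "\<dots> = Hip (\<nu> + 1) (B f + cscale (cnj z) (L h)) g"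
      by (intro Dplus_isometric \<nu>(2) z g Hp.add_mem B_mem f zL)
    also have "\<dots> = Hip (\<nu> - 1) f (B' g) + cnj z * Hip \<nu> h (L' g)"
      using f g h(1) zL by (simp add: Hp.ip_add_left Hp.ip_scale_left B_mem L_mem B_adj L_adj)
    \<comment> \<open>The equations for x and for h are adjoint to each other, so h can be traded
      for f and \<open>L' g\<close> for x.\<close>
    also have "Hip \<nu> h (L' g) = Hip \<nu> h x - cnj z * Hip \<nu> (T h) x"
      using x h(1) unfolding x(2)[symmetric]
      by (simp add: H0.ip_diff_right H0.ip_scale_right H0.scale_mem T'_mem T_adj)
    also have "\<dots> = Hip \<nu> f x"
      using x h(1) unfolding h(2)[symmetric]
      by (simp add: H0.ip_diff_left H0.ip_scale_left H0.scale_mem T_mem)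
    also have "cnj z * Hip \<nu> f x = Hip (\<nu> - 1) f (J' (cscale z x))"
      using J_adj[OF f zx] H0.ip_scale_right[OF J_mem[OF f] x(1)] by simp
    finally show "Hip (\<nu> - 1) f (theta1 \<nu> z g) = Hip (\<nu> - 1) f (J' (cscale z x) + B' g)"
      using f g zx by (simp add: Hm.ip_add_right J'_mem B'_mem add.commute)
  qed
  ultimately show ?thesis using x(1) by blast
qed

end

section \<open>The adjoint of the n-fold derivative and the factorisation of the characteristic
  function\<close>

primrec dop_adj :: "real \<Rightarrow> nat \<Rightarrow> (complex \<Rightarrow> complex) \<Rightarrow> complex \<Rightarrow> complex" where
  "dop_adj lam 0 g = g"
| "dop_adj lam (Suc n) g = dop_adj lam n
      (cscale (of_real (weight.s (lam + 2 * real n))) (weight.B' (lam + 2 * real n) g))"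

text \<open>The last derivative is undone first, by the adjoint at exponent lam + 2n. The induction
  for the adjoint relation uses both memberships, hence the joint proof.\<close>

lemma dop_adj_correct:
  assumes lam: "1 < lam"
  shows "f \<in> Hs (lam - 1) \<Longrightarrow> dop n f \<in> Hs (lam + 2 * real n - 1)"
    and "g \<in> Hs (lam + 2 * real n - 1) \<Longrightarrow> dop_adj lam n g \<in> Hs (lam - 1)"
    and "f \<in> Hs (lam - 1) \<Longrightarrow> g \<in> Hs (lam + 2 * real n - 1)
      \<Longrightarrow> Hip (lam + 2 * real n - 1) (dop n f) g = Hip (lam - 1) f (dop_adj lam n g)"
proof (induction n arbitrary: g)
  case 0
  { case 1
    have "dop 0 f = f" using Hs_off[OF 1] by (auto simp: dop_def dres_def fun_eq_iff)
    then show ?case using 1 by simp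
  next
    case 2
    then show ?case by simp
  next
    case 3
    have "dop 0 f = f" using Hs_off[OF 3(1)] by (auto simp: dop_def dres_def fun_eq_iff)
    then show ?case by simp }
next
  case (Suc n)
  interpret weight "lam + 2 * real n" using lam by unfold_locales simp
  have eq: "lam + 2 * real (Suc n) - 1 = lam + 2 * real n + 1" by simp
  have B: "cscale (of_real s) (B' g) \<in> Hs (lam + 2 * real n - 1)" if "g \<in> Hs (lam + 2 * real n + 1)" for g
    by (intro Hm.scale_mem B'_mem that)
  { case 1
    show ?case unfolding eq dop_Suc[OF Hs_holomorphic[OF 1]] by (rule dop1_mem[OF Suc.IH(1)[OF 1]])
  next
    case 2
    then show ?case unfolding eq dop_adj.simps by (intro Suc.IH(2) B)
  next
    case 3
    have "dop 1 (dop n f) = cscale (of_real s) (B (dop n f))" by (simp add: B_def cscale_cscale cscale_one)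
    then have "Hip (lam + 2 * real n + 1) (dop (Suc n) f) g = of_real s * Hip (lam + 2 * real n + 1) (B (dop n f)) g"
      using 3 Suc.IH(1)[OF 3(1)] unfolding eq dop_Suc[OF Hs_holomorphic[OF 3(1)]]
      by (simp add: Hp.ip_scale_left B_mem)
    also have "\<dots> = Hip (lam + 2 * real n - 1) (dop n f) (cscale (of_real s) (B' g))"
      using 3 Suc.IH(1)[OF 3(1)] unfolding eq by (simp add: B_adj Hm.ip_scale_right B'_mem)
    also have "\<dots> = Hip (lam - 1) f (dop_adj lam (Suc n) g)"
      unfolding dop_adj.simps using 3 B[of g] unfolding eq by (intro Suc.IH(3)) auto
    finally show ?case unfolding eq . }
qed

lemma adjoint_dop:
  assumes lam: "1 < lam" and g: "g \<in> Hs (lam + 2 * real n - 1)"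
  shows "adjoint (Hs (lam - 1)) (Hip (lam - 1)) (Hs (lam + 2 * real n - 1)) (Hip (lam + 2 * real n - 1)) (dop n) g
      = dop_adj lam n g"
proof -
  interpret hilbert "Hs (lam - 1)" "Hip (lam - 1)" using lam by (intro hilbert_Hs) simp
  show ?thesis
    by (rule adjoint_eqI) (rule dop_adj_correct(2)[OF lam g], erule dop_adj_correct(3)[OF lam _ g])
qed

lemma dop_adj_scale:
  assumes lam: "1 < lam" and g: "g \<in> Hs (lam + 2 * real n - 1)"
  shows "dop_adj lam n (cscale c g) = cscale c (dop_adj lam n g)"
proof -
  interpret A: hilbert "Hs (lam - 1)" "Hip (lam - 1)" using lam by (intro hilbert_Hs) simp
  interpret K: hilbert "Hs (lam + 2 * real n - 1)" "Hip (lam + 2 * real n - 1)" using lam by (intro hilbert_Hs) simp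
  have "linear_on (Hs (lam + 2 * real n - 1)) (dop_adj lam n)"
    by (rule adjoint_linear_on[where S = "dop n" and S' = "dop_adj lam n", OF A.inner_space_axioms K.semi_inner_axioms])
      (auto simp: dop_adj_correct[OF lam])
  then show ?thesis using g by (rule linear_on_scale)
qed

lemma theta_n_eq:
  assumes lam: "1 < lam" and z: "norm z < 1" and g: "g \<in> Hs (lam + 2 * real n - 1)"
  shows "theta_n lam n z g = cscale (of_real (1 / sqrt (pochhammer (lam - 1) (2 * n))))
      (cscale (cis (- pi * (lam - 1))) (Dplus (lam - 1) z (dop_adj lam n (Dplus (lam + 2 * real n - 1) z g))))"
proof -
  have "Dplus (lam + 2 * real n - 1) z g \<in> Hs (lam + 2 * real n - 1)" using lam by (intro Dplus_mem z g) simp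
  moreover from this have "dop_adj lam n (Dplus (lam + 2 * real n - 1) z g) \<in> Hs (lam - 1)"
    by (rule dop_adj_correct(2)[OF lam])
  ultimately show ?thesis
    unfolding theta_n_def using lam by (simp only: adjoint_dop[OF lam]) (subst Dplus_adjoint(4), simp_all add: z)
qed

text \<open>At exponent \<nu>-1 = lam + 2n - 1 the \<open>Dplus\<close> in \<open>theta_n\<close>
  meets the inverse \<open>Dplus\<close> that ends the next \<open>theta1\<close>, and they cancel.
  The pochhammer symbol gains \<nu> (\<nu>-1), the square of the new norming constant.\<close>

lemma theta_n_eq_theta_prod:
  assumes lam: "1 < lam" and z: "norm z < 1"
  shows "g \<in> Hs (lam + 2 * real n - 1) \<Longrightarrow> theta_n lam n z g = theta_prod lam n z g"
proof (induction n arbitrary: g)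
  case 0
  then have g: "g \<in> Hs (lam - 1)" by simp
  have "Dplus (lam - 1) z (Dplus (lam - 1) z g) = cscale (cis (pi * (lam - 1))) g"
    by (rule Dplus_Dplus[OF z]) (rule Hs_off[OF g])
  then show ?case using theta_n_eq[OF lam z, of g 0] g by (simp add: cscale_cscale cis_mult cscale_one)
next
  case (Suc n)
  define \<nu> where "\<nu> = lam + 2 * real n"
  interpret weight \<nu> using lam unfolding \<nu>_def by unfold_locales simp
  have eq: "lam + 2 * real (Suc n) - 1 = \<nu> + 1" "lam + 2 * real n - 1 = \<nu> - 1" by (simp_all add: \<nu>_def)
  have \<nu>: "0 < \<nu> - 1" "0 < \<nu> + 1" using weight_gt_1 by simp_all
  have g: "g \<in> Hp" using Suc.prems unfolding eq .
  have Dg: "Dplus (\<nu> + 1) z g \<in> Hp" by (rule Dplus_mem[OF \<nu>(2) z g])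
  let ?b = "B' (Dplus (\<nu> + 1) z g)"
  have b: "?b \<in> Hm" by (rule B'_mem[OF Dg])
  have t: "theta1 \<nu> z g \<in> Hs (lam + 2 * real n - 1)" unfolding eq by (rule theta1_mem[OF z g])
  have P: "0 < pochhammer (lam - 1) (2 * n)" using lam by (intro pochhammer_pos) simp
  have poch: "sqrt (pochhammer (lam - 1) (2 * Suc n)) = sqrt (pochhammer (lam - 1) (2 * n)) * s"
  proof -
    have "pochhammer (lam - 1) (2 * Suc n) = pochhammer (lam - 1) (2 * n) * (\<nu> * (\<nu> - 1))"
      by (simp add: pochhammer_Suc \<nu>_def algebra_simps)
    then show ?thesis by (simp add: real_sqrt_mult s_def)
  qed
  have "theta_prod lam (Suc n) z g = theta_n lam n z (theta1 \<nu> z g)"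
    using Suc.IH[OF t] by (simp add: \<nu>_def)
  also have "\<dots> = cscale (of_real (1 / sqrt (pochhammer (lam - 1) (2 * n))))
      (cscale (cis (- pi * (lam - 1))) (Dplus (lam - 1) z (dop_adj lam n ?b)))"
    unfolding theta_n_eq[OF lam z t] unfolding eq theta1_eq[OF z g] Dplus_adjoint(3)[OF \<nu>(1) z b] ..
  finally have prod: "theta_prod lam (Suc n) z g = \<dots>" .
  have "dop_adj lam (Suc n) (Dplus (\<nu> + 1) z g) = cscale (of_real s) (dop_adj lam n ?b)"
    using dop_adj_scale[OF lam, of ?b n "of_real s"] b unfolding eq by (simp add: \<nu>_def)
  then have "theta_n lam (Suc n) z g = cscale (of_real (1 / (sqrt (pochhammer (lam - 1) (2 * n)) * s) * s))
      (cscale (cis (- pi * (lam - 1))) (Dplus (lam - 1) z (dop_adj lam n ?b)))"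
    unfolding theta_n_eq[OF lam z Suc.prems] unfolding eq poch by (simp add: Dplus_scale cscale_cscale mult_ac)
  then show ?case unfolding prod using P by simp
qed

section \<open>The cascade of the weights\<close>

text \<open>As rewrite rules these also expand sums of functions that are not applied to an argument.\<close>
declare plus_fun_apply [simp del] zero_fun_apply [simp del]

text \<open>The series connection of the unitary colligations of the weights \<open>lam + 2 l\<close> for \<open>l < n\<close>: the
  output of one stage is the input of the next. \<open>up\<close> is the signal running through the stages for
  state \<open>x\<close> and input \<open>e\<close>, \<open>down\<close> that of the adjoint system, which runs through them backwards.\<close>
locale cascade =
  fixes lam :: real and n :: nat
  assumes lam_gt_1: "1 < lam"
begin

definition nu :: "nat \<Rightarrow> real" where "nu l = lam + 2 * real l"

lemma nu_0 [simp]: "nu 0 = lam"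
  and nu_Suc [simp]: "nu (Suc l) = nu l + 2"
  by (simp_all add: nu_def)

sublocale W: weight "nu l" for l
  using lam_gt_1 by unfold_locales (simp add: nu_def)

abbreviation St where "St \<equiv> dsum n (\<lambda>l. Hs (nu l))"
abbreviation ip where "ip \<equiv> dsum_ip n (\<lambda>l. Hip (nu l))"
abbreviation Sg where "Sg l \<equiv> Hs (nu l - 1)"

sublocale St: hilbert St ip
  by (rule hilbert_dsum) (rule W.H0.hilbert_axioms)

lemma Sg_Suc [simp]: "Sg (Suc l) = Hs (nu l + 1)" "Hip (nu (Suc l) - 1) = Hip (nu l + 1)"
  by (simp_all add: nu_def add.commute)

lemma St_mem: "x \<in> St \<Longrightarrow> l < n \<Longrightarrow> x l \<in> Hs (nu l)"
  and St_off: "x \<in> St \<Longrightarrow> n \<le> l \<Longrightarrow> x l = 0"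
  by (simp_all add: dsum_def)

primrec up :: "(nat \<Rightarrow> complex \<Rightarrow> complex) \<Rightarrow> (complex \<Rightarrow> complex) \<Rightarrow> nat \<Rightarrow> complex \<Rightarrow> complex" where
  "up x e 0 = e"
| "up x e (Suc l) = W.L l (x l) + W.B l (up x e l)"

text \<open>Stages are counted from the output end, which makes the backward recursion primitive;
  \<open>down\<close> restores the stage index.\<close>

primrec down_aux :: "(nat \<Rightarrow> complex \<Rightarrow> complex) \<Rightarrow> (complex \<Rightarrow> complex) \<Rightarrow> nat \<Rightarrow> complex \<Rightarrow> complex" where
  "down_aux y g 0 = g"
| "down_aux y g (Suc k) = W.J' (n - Suc k) (y (n - Suc k)) + W.B' (n - Suc k) (down_aux y g k)"

definition down where "down y g l = down_aux y g (n - l)"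

lemma down_n: "down y g n = g"
  by (simp add: down_def)

lemma down_step:
  assumes "l < n"
  shows "down y g l = W.J' l (y l) + W.B' l (down y g (Suc l))"
proof -
  have "n - l = Suc (n - Suc l)" "n - Suc (n - Suc l) = l" using assms by auto
  then show ?thesis by (simp add: down_def)
qed

lemma backwards_induct [consumes 1, case_names base step]:
  assumes "l \<le> n" "P n" "\<And>l. l < n \<Longrightarrow> P (Suc l) \<Longrightarrow> P l"
  shows "P l"
  using assms by (induction rule: inc_induct) auto

text \<open>\<open>A\<close> and \<open>A'\<close> are the state components of the block operator
  and of its adjoint; the other components are \<open>up x e n\<close> and
  \<open>down y g 0\<close>. The block J is an inclusion, so the incoming signal is added to the
  state as it stands.\<close>

definition A where "A x e = (\<lambda>l. if l < n then W.T (x l) + up x e l else 0)"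
definition A' where "A' y g = (\<lambda>l. if l < n then W.T' l (y l) + W.L' l (down y g (Suc l)) else 0)"

lemma up_mem: "x \<in> St \<Longrightarrow> e \<in> Sg 0 \<Longrightarrow> l \<le> n \<Longrightarrow> up x e l \<in> Sg l"
  by (induction l) (auto simp del: nu_Suc intro!: W.Hp.add_mem W.L_mem W.B_mem St_mem)

lemma down_mem: "l \<le> n \<Longrightarrow> y \<in> St \<Longrightarrow> g \<in> Sg n \<Longrightarrow> down y g l \<in> Sg l"
  by (induction rule: backwards_induct)
    (auto simp: down_n down_step simp del: nu_Suc intro!: W.Hm.add_mem W.J'_mem W.B'_mem St_mem)

lemma down_Suc_mem: "l < n \<Longrightarrow> y \<in> St \<Longrightarrow> g \<in> Sg n \<Longrightarrow> down y g (Suc l) \<in> Hs (nu l + 1)"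
  using down_mem[of "Suc l" y g] by (simp del: nu_Suc)

lemma A_mem: "x \<in> St \<Longrightarrow> e \<in> Sg 0 \<Longrightarrow> A x e \<in> St"
  by (auto simp: dsum_def[of n "\<lambda>l. Hs (nu l)"] A_def
      intro!: W.H0.add_mem W.T_mem W.J_mem[OF up_mem] simp del: plus_fun_apply)

lemma A'_mem: "y \<in> St \<Longrightarrow> g \<in> Sg n \<Longrightarrow> A' y g \<in> St"
  using down_Suc_mem[of _ y g]
  by (auto simp: dsum_def[of n "\<lambda>l. Hs (nu l)"] A'_def
      intro!: W.H0.add_mem W.T'_mem W.L'_mem simp del: plus_fun_apply)

lemma up_add:
  assumes "x \<in> St" "x' \<in> St" "e \<in> Sg 0" "e' \<in> Sg 0"
  shows "l \<le> n \<Longrightarrow> up (x + x') (e + e') l = up x e l + up x' e' l"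
proof (induction l)
  case (Suc l)
  then have "l < n" by simp
  then show ?case
    using Suc assms
    by (simp add: linear_on_add[OF W.L_linear] linear_on_add[OF W.B_linear] St_mem up_mem plus_fun_apply[of x x' l])
qed simp

lemma up_scale:
  assumes "x \<in> St" "e \<in> Sg 0"
  shows "l \<le> n \<Longrightarrow> up (cscale c x) (cscale c e) l = cscale c (up x e l)"
proof (induction l)
  case (Suc l)
  then have "l < n" by simp
  then show ?case
    using Suc assms
    by (simp add: linear_on_scale[OF W.L_linear] linear_on_scale[OF W.B_linear] St_mem up_mem cscale_add_right
        fun_cong[OF cscale_fun_def[of c x], of l])
qed simp

lemma down_add:
  assumes "l \<le> n" "y \<in> St" "y' \<in> St" "g \<in> Sg n" "g' \<in> Sg n"
  shows "down (y + y') (g + g') l = down y g l + down y' g' l"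
  using assms
proof (induction rule: backwards_induct)
  case (step l)
  then show ?case
    by (simp add: down_step linear_on_add[OF W.J'_linear] linear_on_add[OF W.B'_linear] St_mem down_Suc_mem
        plus_fun_apply[of y y' l] del: nu_Suc)
qed (simp add: down_n)

lemma down_scale:
  assumes "l \<le> n" "y \<in> St" "g \<in> Sg n"
  shows "down (cscale c y) (cscale c g) l = cscale c (down y g l)"
  using assms
proof (induction rule: backwards_induct)
  case (step l)
  then show ?case
    by (simp add: down_step linear_on_scale[OF W.J'_linear] linear_on_scale[OF W.B'_linear] St_mem down_Suc_mem
        cscale_add_right fun_cong[OF cscale_fun_def[of c y], of l] del: nu_Suc)
qed (simp add: down_n)

lemma A_add:
  assumes "x \<in> St" "x' \<in> St" "e \<in> Sg 0" "e' \<in> Sg 0"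
  shows "A (x + x') (e + e') = A x e + A x' e'"
proof
  fix l
  show "A (x + x') (e + e') l = (A x e + A x' e') l"
  proof (cases "l < n")
    case True
    then show ?thesis
      using assms linear_on_add[OF W.T_linear St_mem St_mem, of x l x'] up_add[OF assms, of l]
      by (simp add: A_def plus_fun_apply[where x = l] add.assoc add.left_commute)
  qed (simp add: A_def plus_fun_apply[where x = l])
qed

lemma A_scale:
  assumes "x \<in> St" "e \<in> Sg 0"
  shows "A (cscale c x) (cscale c e) = cscale c (A x e)"
proof
  fix l
  show "A (cscale c x) (cscale c e) l = cscale c (A x e) l"
  proof (cases "l < n")
    case True
    then show ?thesis using assms up_scale[OF assms, of l c] linear_on_scale[OF W.T_linear St_mem[OF assms(1) True], of c]
      unfolding fun_cong[OF cscale_fun_def[of c "A x e"], of l]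
      by (simp add: A_def cscale_add_right fun_cong[OF cscale_fun_def[of c x], of l])
  qed (simp add: A_def fun_cong[OF cscale_fun_def, of c _ l])
qed

lemma A'_add:
  assumes "y \<in> St" "y' \<in> St" "g \<in> Sg n" "g' \<in> Sg n"
  shows "A' (y + y') (g + g') = A' y g + A' y' g'"
proof
  fix l
  show "A' (y + y') (g + g') l = (A' y g + A' y' g') l"
  proof (cases "l < n")
    case True
    have "W.L' l (down (y + y') (g + g') (Suc l)) = W.L' l (down y g (Suc l)) + W.L' l (down y' g' (Suc l))"
      using down_add[of "Suc l" y y' g g'] True assms linear_on_add[OF W.L'_linear down_Suc_mem down_Suc_mem, of l y g y' g'] by simp
    then show ?thesis
      using assms True by (simp add: A'_def linear_on_add[OF W.T'_linear] St_mem plus_fun_apply[where x = l])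
  qed (simp add: A'_def plus_fun_apply[where x = l])
qed

lemma A'_scale:
  assumes "y \<in> St" "g \<in> Sg n"
  shows "A' (cscale c y) (cscale c g) = cscale c (A' y g)"
proof
  fix l
  show "A' (cscale c y) (cscale c g) l = cscale c (A' y g) l"
  proof (cases "l < n")
    case True
    have "W.L' l (down (cscale c y) (cscale c g) (Suc l)) = cscale c (W.L' l (down y g (Suc l)))"
      using down_scale[of "Suc l" y g c] True assms linear_on_scale[OF W.L'_linear down_Suc_mem, of l y g c] by simp
    moreover have "W.T' l (cscale c (y l)) = cscale c (W.T' l (y l))"
      by (rule linear_on_scale[OF W.T'_linear St_mem[OF assms(1) True]])
    ultimately show ?thesis using True
      unfolding fun_cong[OF cscale_fun_def[of c "A' y g"], of l]
      by (simp add: A'_def cscale_add_right fun_cong[OF cscale_fun_def[of c y], of l])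
  qed (simp add: A'_def fun_cong[OF cscale_fun_def, of c _ l])
qed

lemma stage_duality:
  assumes "x \<in> Hs (nu l)" "u \<in> Sg l" "y \<in> Hs (nu l)" "v \<in> Hs (nu l + 1)"
  shows "Hip (nu l) (W.T x + u) y + Hip (nu l + 1) (W.L l x + W.B l u) v
      = Hip (nu l) x (W.T' l y + W.L' l v) + Hip (nu l - 1) u (W.J' l y + W.B' l v)"
  using assms
  by (simp add: W.H0.ip_add_left W.H0.ip_add_right W.Hp.ip_add_left W.Hm.ip_add_right W.T_mem W.J_mem W.L_mem W.B_mem
      W.T'_mem W.L'_mem W.J'_mem W.B'_mem W.T_adj W.J_adj W.L_adj W.B_adj)

text \<open>Cut the chain before stage m: the pairings of the states so far are balanced by the
  pairing of the signals at the cut. Each use of \<open>stage_duality\<close> moves the cut by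
  one.\<close>

lemma duality:
  assumes x: "x \<in> St" and e: "e \<in> Sg 0" and y: "y \<in> St" and g: "g \<in> Sg n"
  shows "ip (A x e) y + Hip (nu n - 1) (up x e n) g = ip x (A' y g) + Hip (nu 0 - 1) e (down y g 0)"
proof -
  have "(\<Sum>l<m. Hip (nu l) (A x e l) (y l)) + Hip (nu m - 1) (up x e m) (down y g m)
      = (\<Sum>l<m. Hip (nu l) (x l) (A' y g l)) + Hip (nu 0 - 1) e (down y g 0)" if "m \<le> n" for m
    using that
  proof (induction m)
    case (Suc m)
    then have m: "m < n" by simp
    have "Hip (nu m) (A x e m) (y m) + Hip (nu m + 1) (up x e (Suc m)) (down y g (Suc m))
        = Hip (nu m) (x m) (A' y g m) + Hip (nu m - 1) (up x e m) (down y g m)"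
      using stage_duality[of "x m" m "up x e m" "y m" "down y g (Suc m)"] m x e y g
      by (simp add: A_def A'_def down_step[OF m] St_mem up_mem down_Suc_mem del: nu_Suc)
    moreover have "(\<Sum>l<m. Hip (nu l) (A x e l) (y l)) + Hip (nu m - 1) (up x e m) (down y g m)
        = (\<Sum>l<m. Hip (nu l) (x l) (A' y g l)) + Hip (nu 0 - 1) e (down y g 0)"
      using Suc.IH m by simp
    moreover have "s1 + a + b = s2 + c + d" if "a + b = c + f" "s1 + f = s2 + d" for s1 s2 a b c d f :: complex
      using that by algebra
    ultimately show ?case unfolding Sg_Suc sum.lessThan_Suc by blast
  qed simp
  from this[of n] show ?thesis by (simp add: down_n dsum_ip_def del: nu_0)
qed

text \<open>Fed with its own outputs, the adjoint system reproduces every internal signal, because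
  J' T + B' L = 0 and J' J + B' B = 1 in each stage.\<close>

lemma down_up:
  assumes "x \<in> St" "e \<in> Sg 0"
  shows "l \<le> n \<Longrightarrow> down (A x e) (up x e n) l = up x e l"
proof (induction rule: backwards_induct)
  case (step l)
  have x: "x l \<in> Hs (nu l)" and u: "up x e l \<in> Sg l" using step(1) assms St_mem up_mem by auto
  have "down (A x e) (up x e n) l = W.J' l (W.T (x l) + up x e l) + W.B' l (W.L l (x l) + W.B l (up x e l))"
    using step by (simp add: down_step A_def)
  also have "\<dots> = (W.J' l (W.T (x l)) + W.B' l (W.L l (x l))) + (W.J' l (up x e l) + W.B' l (W.B l (up x e l)))"
    using x u by (simp add: linear_on_add[OF W.J'_linear] linear_on_add[OF W.B'_linear] W.T_mem W.J_mem W.L_mem W.B_mem)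
  also have "\<dots> = up x e l" using x u by (simp only: W.J'_T_B'_L W.J'_B'_B add_0)
  finally show ?case .
qed (simp add: down_n)

lemma A'_A:
  assumes "x \<in> St" "e \<in> Sg 0"
  shows "A' (A x e) (up x e n) = x"
proof
  fix l
  show "A' (A x e) (up x e n) l = x l"
  proof (cases "l < n")
    case True
    have x: "x l \<in> Hs (nu l)" and u: "up x e l \<in> Sg l" using True assms St_mem up_mem by auto
    have "A' (A x e) (up x e n) l = W.T' l (W.T (x l) + up x e l) + W.L' l (W.L l (x l) + W.B l (up x e l))"
      using True down_up[OF assms, of "Suc l"] by (simp add: A'_def A_def)
    also have "\<dots> = (W.T' l (W.T (x l)) + W.L' l (W.L l (x l))) + (W.T' l (up x e l) + W.L' l (W.B l (up x e l)))"
      using x u by (simp add: linear_on_add[OF W.T'_linear] linear_on_add[OF W.L'_linear] W.T_mem W.J_mem W.L_mem W.B_mem)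
    also have "\<dots> = x l" using x u by (simp only: W.T'_T_L'_L W.T'_L'_B add_0_right)
    finally show ?thesis .
  qed (use assms in \<open>simp add: A'_def St_off\<close>)
qed

text \<open>Mirror image of \<open>down_up\<close>, from the second row of U U' = 1 in each
  stage.\<close>

lemma up_down:
  assumes "y \<in> St" "g \<in> Sg n"
  shows "l \<le> n \<Longrightarrow> up (A' y g) (down y g 0) l = down y g l"
proof (induction l)
  case (Suc l)
  then have l: "l < n" by simp
  have y: "y l \<in> Hs (nu l)" and v: "down y g (Suc l) \<in> Hs (nu l + 1)" using l assms St_mem down_Suc_mem by auto
  have "up (A' y g) (down y g 0) (Suc l)
      = W.L l (W.T' l (y l) + W.L' l (down y g (Suc l))) + W.B l (W.J' l (y l) + W.B' l (down y g (Suc l)))"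
    using l Suc by (simp add: A'_def down_step[OF l])
  also have "\<dots> = (W.L l (W.T' l (y l)) + W.B l (W.J' l (y l)))
      + (W.L l (W.L' l (down y g (Suc l))) + W.B l (W.B' l (down y g (Suc l))))"
    using y v by (simp add: linear_on_add[OF W.L_linear] linear_on_add[OF W.B_linear] W.T'_mem W.L'_mem W.J'_mem W.B'_mem)
  also have "\<dots> = down y g (Suc l)" using y v by (simp only: W.L_T'_B_J' W.L_L'_B_B' add_0)
  finally show ?case .
qed simp

lemma A_A':
  assumes "y \<in> St" "g \<in> Sg n"
  shows "A (A' y g) (down y g 0) = y"
proof
  fix l
  show "A (A' y g) (down y g 0) l = y l"
  proof (cases "l < n")
    case True
    have y: "y l \<in> Hs (nu l)" and v: "down y g (Suc l) \<in> Hs (nu l + 1)" using True assms St_mem down_Suc_mem by auto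
    have "A (A' y g) (down y g 0) l
        = W.T (W.T' l (y l) + W.L' l (down y g (Suc l))) + (W.J' l (y l) + W.B' l (down y g (Suc l)))"
      using True up_down[OF assms, of l] by (simp add: A'_def A_def down_step)
    also have "\<dots> = (W.T (W.T' l (y l)) + W.J' l (y l)) + (W.T (W.L' l (down y g (Suc l))) + W.B' l (down y g (Suc l)))"
      using y v by (simp add: linear_on_add[OF W.T_linear[of l]] W.T'_mem W.L'_mem)
    also have "\<dots> = y l" using y v by (simp only: W.T_T'_J' W.T_L'_B' add_0_right)
    finally show ?thesis .
  qed (use assms in \<open>simp add: A_def St_off\<close>)
qed

end

section \<open>Dense ranges and the unitary colligation of the cascade\<close>

lemma range_dense:
  assumes \<nu>: "0 < \<nu>" and H: "semi_inner H ipH" and lin: "linear_on H S"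
    and mon: "\<And>m. monomial m \<in> S ` H"
  shows "Hs \<nu> \<subseteq> clos (Hs \<nu>) (Hip \<nu>) (S ` H)"
proof
  interpret semi_inner H ipH by (rule H)
  fix f assume "f \<in> Hs \<nu>"
  then show "f \<in> clos (Hs \<nu>) (Hip \<nu>) (S ` H)"
  proof (rule Hs_clos_monomials[OF \<nu> mon, rotated 2])
    fix f g assume "f \<in> S ` H" "g \<in> S ` H"
    then obtain x y where "x \<in> H" "y \<in> H" "f = S x" "g = S y" by blast
    then show "f + g \<in> S ` H" by (intro image_eqI[of _ _ "x + y"]) (simp_all add: linear_on_add[OF lin] add_mem)
  next
    fix f c assume "f \<in> S ` H"
    then obtain x where "x \<in> H" "f = S x" by blast
    then show "cscale c f \<in> S ` H"
      by (intro image_eqI[of _ _ "cscale c x"]) (simp_all add: linear_on_scale[OF lin] scale_mem)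
  qed
qed

context cascade
begin

lemma Sg_pos: "0 < nu l - 1"
  using W.weight_gt_1[of l] by simp

lemma hilbert_Sg: "hilbert (Sg l) (Hip (nu l - 1))"
  by (rule W.Hm.hilbert_axioms)

lemma zeros: "0 \<in> St" "0 \<in> Hs \<mu>"
  by (rule St.zero_mem, rule Hs_zero)

text \<open>Setting one argument to 0 isolates a single block, so this turns facts about the
  two-argument maps into the relations of a colligation.\<close>

lemma split_A: "x \<in> St \<Longrightarrow> e \<in> Sg 0 \<Longrightarrow> A x e = A x 0 + A 0 e"
  using A_add[of x 0 0 e] zeros by simp

lemma split_A': "y \<in> St \<Longrightarrow> g \<in> Sg n \<Longrightarrow> A' y g = A' y 0 + A' 0 g"
  using A'_add[of y 0 0 g] zeros by simp

lemma split_down: "y \<in> St \<Longrightarrow> g \<in> Sg n \<Longrightarrow> down y g 0 = down y 0 0 + down 0 g 0"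
  using down_add[of 0 y 0 0 g] zeros by simp

lemma single_mem:
  assumes "l < n" "f \<in> Hs (nu l)"
  shows "(\<lambda>j. if j = l then f else 0) \<in> St"
  using assms by (auto simp: dsum_def Hs_zero)

text \<open>A state concentrated in the last stage reaches the output through \<open>W.L\<close>
  alone, which is a nonzero multiple of the inclusion.\<close>

lemma L_dense:
  assumes n: "0 < n"
  shows "Sg n \<subseteq> clos (Sg n) (Hip (nu n - 1)) ((\<lambda>x. up x 0 n) ` St)"
proof (rule range_dense[OF Sg_pos St.semi_inner_axioms])
  show "linear_on St (\<lambda>x. up x 0 n)"
    unfolding linear_on_def
  proof (intro conjI ballI allI)
    show "up (x + y) 0 n = up x 0 n + up y 0 n" if "x \<in> St" "y \<in> St" for x y
      using up_add[OF that zeros(2) zeros(2), of n] by simp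
    show "up (cscale c x) 0 n = cscale c (up x 0 n)" if "x \<in> St" for c x
      using up_scale[OF that zeros(2), of n c] by simp
  qed
  fix m
  obtain k where k: "n = Suc k" using n by (cases n) auto
  define q where "q = - complex_of_real ((nu k - 1) / W.s k)"
  have q: "q \<noteq> 0" using W.weight_gt_1[of k] W.s_pos[of k] by (simp add: q_def)
  define f where "f = cscale (1 / q) (monomial m)"
  define x where "x = (\<lambda>j. if j = k then f else 0)"
  have f: "f \<in> Hs (nu k)" using W.weight_gt_1[of k] unfolding f_def by (intro W.H0.scale_mem monomial_mem) simp
  have x: "x \<in> St" unfolding x_def using k f by (intro single_mem) auto
  have "up x 0 l = 0" if "l \<le> k" for l
    using that
  proof (induction l)
    case (Suc l)
    have "W.L l 0 = 0" "W.B l 0 = 0"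
      using W.H0.linear_on_zero[OF W.L_linear] W.Hm.linear_on_zero[OF W.B_linear] by auto
    then show ?case using Suc by (simp add: x_def)
  qed simp
  moreover have "W.B k 0 = 0" using W.Hm.linear_on_zero[OF W.B_linear] by auto
  ultimately have "up x 0 n = W.L k f" by (simp add: k x_def)
  also have "\<dots> = monomial m"
    unfolding W.L_def f_def q_def[symmetric] using q by (simp add: cscale_cscale cscale_one)
  finally show "monomial m \<in> (\<lambda>x. up x 0 n) ` St" using x by (intro image_eqI[of _ _ x]) simp_all
qed

text \<open>Stage 0 is the last one met by the backward signal, so a state concentrated there leaves
  through \<open>W.J'\<close> alone, which is diagonal with nonzero entries.\<close>

lemma J'_dense:
  assumes n: "0 < n"
  shows "Sg 0 \<subseteq> clos (Sg 0) (Hip (nu 0 - 1)) ((\<lambda>y. down y 0 0) ` St)"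
proof (rule range_dense[OF Sg_pos St.semi_inner_axioms])
  show "linear_on St (\<lambda>y. down y 0 0)"
    unfolding linear_on_def
  proof (intro conjI ballI allI)
    show "down (x + y) 0 0 = down x 0 0 + down y 0 0" if "x \<in> St" "y \<in> St" for x y
      using down_add[of 0 x y 0 0] that zeros by simp
    show "down (cscale c x) 0 0 = cscale c (down x 0 0)" if "x \<in> St" for c x
      using down_scale[of 0 x 0 c] that zeros by simp
  qed
  fix m
  define q where "q = (nu 0 - 1) / (nu 0 - 1 + real m)"
  have q: "q \<noteq> 0" using W.weight_gt_1[of 0] by (simp add: q_def del: nu_0)
  define f where "f = cscale (of_real (1 / q)) (monomial m)"
  define y where "y = (\<lambda>j :: nat. if j = 0 then f else 0 :: complex \<Rightarrow> complex)"
  have f: "f \<in> Hs (nu 0)" using W.weight_gt_1[of 0] unfolding f_def by (intro W.H0.scale_mem monomial_mem) simp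
  have y: "y \<in> St" unfolding y_def using n f by (intro single_mem) auto
  have zJ: "W.J' l 0 = 0" and zB: "W.B' l 0 = 0" for l
    using W.H0.linear_on_zero[OF W.J'_linear] W.Hp.linear_on_zero[OF W.B'_linear] by auto
  have "0 < l \<longrightarrow> down y 0 l = 0" if "l \<le> n" for l
    using that
  proof (induction rule: backwards_induct)
    case (step l)
    then show ?case by (simp add: down_step y_def zJ zB)
  qed (simp add: down_n)
  then have "down y 0 (Suc 0) = 0" using n by simp
  then have "down y 0 0 = W.J' 0 f" using n by (simp add: down_step y_def zB del: nu_0)
  also have "\<dots> = monomial m"
  proof (rule Hs_eqI[OF W.J'_mem[OF f] monomial_mem[of 1]])
    fix k
    have "tcoef f k = of_real (1 / q) * tcoef (monomial m) k"
      unfolding f_def by (rule tcoef_scale[OF Hs_holomorphic[OF monomial_mem[of 1]]]) simp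
    then show "tcoef (W.J' 0 f) k = tcoef (monomial m) k"
      using q by (cases "k = m") (simp_all only: W.tcoef_J'[OF f] q_def[symmetric], simp_all add: tcoef_monomial)
  qed simp
  finally show "monomial m \<in> (\<lambda>y. down y 0 0) ` St" using y by (intro image_eqI[of _ _ y]) simp_all
qed

theorem colligation:
  assumes n: "0 < n"
  shows "colligation St ip (Sg 0) (Hip (nu 0 - 1)) (Sg n) (Hip (nu n - 1))
    (\<lambda>x. A x 0) (\<lambda>y. A' y 0) (\<lambda>e. A 0 e) (\<lambda>y. down y 0 0) (\<lambda>x. up x 0 n) (\<lambda>g. A' 0 g) (\<lambda>g. down 0 g 0)"
proof -
  note mems = A_mem A'_mem zeros up_mem[OF _ _ order_refl] down_mem[OF le0]
  show ?thesis
  proof (intro colligation.intro St.hilbert_axioms hilbert_Sg colligation_axioms.intro)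
    show "linear_on St (\<lambda>x. A x 0)"
      using A_add[where e = 0 and e' = 0] A_scale[where e = 0] zeros by (simp add: linear_on_def)
    show "linear_on St (\<lambda>y. A' y 0)"
      using A'_add[where g = 0 and g' = 0] A'_scale[where g = 0] zeros by (simp add: linear_on_def)
    show "linear_on St (\<lambda>y. down y 0 0)"
      using down_add[where g = 0 and g' = 0 and l = 0] down_scale[where g = 0 and l = 0] zeros by (simp add: linear_on_def)
    show "linear_on St (\<lambda>x. up x 0 n)"
      using up_add[where e = 0 and e' = 0 and l = n] up_scale[where e = 0 and l = n] zeros by (simp add: linear_on_def)
    show "ip (A x 0) y = ip x (A' y 0)" if "x \<in> St" "y \<in> St" for x y
      using duality[OF that(1) zeros(2) that(2) zeros(2)] that mems by (simp del: nu_0)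
    show "ip (A 0 e) x = Hip (nu 0 - 1) e (down x 0 0)" if "e \<in> Sg 0" "x \<in> St" for e x
      using duality[OF zeros(1) that zeros(2)] that mems by (simp del: nu_0)
    show "Hip (nu n - 1) (up x 0 n) g = ip x (A' 0 g)" if "x \<in> St" "g \<in> Sg n" for x g
      using duality[OF that(1) zeros(2) zeros(1) that(2)] that mems by (simp del: nu_0)
    show "A' (A x 0) 0 + A' 0 (up x 0 n) = x" if "x \<in> St" for x
      using A'_A[OF that zeros(2)] split_A'[of "A x 0" "up x 0 n"] that mems by simp
    show "A (A' y 0) 0 + A 0 (down y 0 0) = y" if "y \<in> St" for y
      using A_A'[OF that zeros(2)] split_A[of "A' y 0" "down y 0 0"] that mems by simp
    show "down (A x 0) 0 0 + down 0 (up x 0 n) 0 = 0" if "x \<in> St" for x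
      using down_up[OF that zeros(2), of 0] split_down[of "A x 0" "up x 0 n"] that mems by simp
    show "Sg 0 \<subseteq> clos (Sg 0) (Hip (nu 0 - 1)) ((\<lambda>y. down y 0 0) ` St)" by (rule J'_dense[OF n])
    show "Sg n \<subseteq> clos (Sg n) (Hip (nu n - 1)) ((\<lambda>x. up x 0 n) ` St)" by (rule L_dense[OF n])
  qed (use mems in auto)
qed

text \<open>Feeding \<open>z\<close> times the state back into the adjoint system turns each stage into \<open>theta1\<close>.\<close>
lemma transfer:
  assumes z: "norm z < 1" and g: "g \<in> Sg n"
  shows "\<exists>x\<in>St. x = A' (cscale z x) 0 + A' 0 g
    \<and> theta_prod lam n z g = down (cscale z x) 0 0 + down 0 g 0"
proof -
  \<comment> \<open>\<open>theta_prod\<close> applies the factor of the highest weight first, so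
    signals are built from the output end; \<open>w l\<close> is the backward signal leaving stage
    l.\<close>
  define th where "th = rec_nat g (\<lambda>k. theta1 (nu (n - Suc k)) z)"
  define w where "w l = th (n - l)" for l
  have wn: "w n = g" by (simp add: w_def th_def)
  have ws: "w l = theta1 (nu l) z (w (Suc l))" if "l < n" for l
  proof -
    have "n - l = Suc (n - Suc l)" "n - Suc (n - Suc l) = l" using that by auto
    then show ?thesis by (simp add: w_def th_def)
  qed
  have wmem: "w l \<in> Sg l" if "l \<le> n" for l
    using that
  proof (induction rule: backwards_induct)
    case (step l)
    then show ?case unfolding ws[OF step(1)] Sg_Suc by (intro W.theta1_mem z)
  qed (simp add: wn g)
  have prod: "theta_prod lam m z (w m) = w 0" if "m \<le> n" for m
    using that by (induction m) (simp_all add: ws nu_def)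
  have "\<forall>l. \<exists>x. l < n \<longrightarrow> x \<in> Hs (nu l) \<and> x = W.T' l (cscale z x) + W.L' l (w (Suc l))
      \<and> w l = W.J' l (cscale z x) + W.B' l (w (Suc l))"
  proof (intro allI)
    fix l
    show "\<exists>x. l < n \<longrightarrow> x \<in> Hs (nu l) \<and> x = W.T' l (cscale z x) + W.L' l (w (Suc l))
        \<and> w l = W.J' l (cscale z x) + W.B' l (w (Suc l))"
    proof (cases "l < n")
      case True
      then have "w (Suc l) \<in> Hs (nu l + 1)" using wmem[of "Suc l"] unfolding Sg_Suc by simp
      from W.theta1_transfer[OF z this] show ?thesis unfolding ws[OF True] by blast
    qed simp
  qed
  from choice[OF this] obtain x0 where x0: "\<And>l. l < n \<Longrightarrow> x0 l \<in> Hs (nu l)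
      \<and> x0 l = W.T' l (cscale z (x0 l)) + W.L' l (w (Suc l)) \<and> w l = W.J' l (cscale z (x0 l)) + W.B' l (w (Suc l))"
    by blast
  \<comment> \<open>Each stage below \<open>n\<close> has a state of its own from
    \<open>theta1_transfer\<close>; zeros beyond make the family an element of
    \<open>St\<close>.\<close>
  define x where "x l = (if l < n then x0 l else 0)" for l
  have x: "x \<in> St" using x0 by (auto simp: x_def dsum_def)
  have zx: "cscale z x \<in> St" by (rule St.scale_mem[OF x])
  have zxl: "cscale z x l = cscale z (x l)" for l by (simp add: cscale_fun_def[of z x])
  have dw: "down (cscale z x) g l = w l" if "l \<le> n" for l
    using that
  proof (induction rule: backwards_induct)
    case (step l)
    then show ?case using x0[OF step(1)] unfolding down_step[OF step(1)] zxl by (simp add: x_def)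
  qed (simp add: down_n wn)
  have "A' (cscale z x) g = x"
  proof
    fix l
    show "A' (cscale z x) g l = x l"
    proof (cases "l < n")
      case True
      then have "A' (cscale z x) g l = W.T' l (cscale z (x l)) + W.L' l (w (Suc l))"
        by (simp add: A'_def zxl dw)
      then show ?thesis using x0[OF True] True by (simp add: x_def)
    qed (simp add: A'_def x_def)
  qed
  then have "x = A' (cscale z x) 0 + A' 0 g" using split_A'[OF zx g] by simp
  moreover have "theta_prod lam n z g = down (cscale z x) 0 0 + down 0 g 0"
    using prod[of n] dw[of 0] split_down[OF zx g] by (simp add: wn)
  ultimately show ?thesis using x by blast
qed

end

section \<open>The isomorphism with the transported space\<close>

lemma higher_deriv_scale:
  assumes "f holomorphic_on ball 0 1" "norm w < 1"
  shows "(deriv ^^ k) (cscale c f) w = c * (deriv ^^ k) f w"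
  using higher_deriv_cmult[OF assms(1), of w k c] assms(2)
  by (simp add: cscale_fun_def[of c f] cscale_complex_def)

lemma higher_deriv_plus:
  assumes "f holomorphic_on ball 0 1" "g holomorphic_on ball 0 1" "norm w < 1"
  shows "(deriv ^^ k) (f + g) w = (deriv ^^ k) f w + (deriv ^^ k) g w"
  using higher_deriv_add[OF assms(1,2), of w k] assms(3) by (simp add: plus_fun_def)

lemma higher_deriv_dop1:
  assumes "f holomorphic_on ball 0 1" "norm w < 1"
  shows "(deriv ^^ k) (dop 1 f) w = (deriv ^^ Suc k) f w"
proof -
  have "(deriv ^^ k) (dop 1 f) w = (deriv ^^ k) (deriv f) w"
  proof (rule higher_deriv_transform_within_open)
    show "dop 1 f holomorphic_on ball 0 1" using assms(1) by (rule dop_holomorphic)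
    show "deriv f holomorphic_on ball 0 1" using assms(1) by (rule holomorphic_deriv) simp
  qed (use assms(2) in \<open>auto simp: dop_def dres_def\<close>)
  then show ?thesis by (simp add: funpow_swap1)
qed

text \<open>Leibniz rule with a linear factor. At k = 0 the truncated \<open>k - 1\<close> is
  harmless because it is multiplied by k.\<close>

lemma higher_deriv_mult_id:
  assumes f: "f holomorphic_on ball 0 1" and w: "norm w < 1"
  shows "(deriv ^^ k) (\<lambda>w. w * f w) w = w * (deriv ^^ k) f w + of_nat k * (deriv ^^ (k - 1)) f w"
  using w
proof (induction k arbitrary: w)
  case (Suc k)
  have hol: "(deriv ^^ j) f holomorphic_on ball 0 1" for j using f by (rule holomorphic_higher_deriv) simp
  have d: "((deriv ^^ j) f has_field_derivative (deriv ^^ Suc j) f w) (at w)" for j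
    using holomorphic_derivI[OF hol[of j] open_ball, of w] Suc.prems by simp
  have "((\<lambda>w. w * (deriv ^^ k) f w + of_nat k * (deriv ^^ (k - 1)) f w) has_field_derivative
      1 * (deriv ^^ k) f w + (deriv ^^ Suc k) f w * w + of_nat k * (deriv ^^ Suc (k - 1)) f w) (at w)"
    by (intro DERIV_add DERIV_mult DERIV_cmult DERIV_ident d)
  then have "((deriv ^^ k) (\<lambda>w. w * f w) has_field_derivative
      1 * (deriv ^^ k) f w + (deriv ^^ Suc k) f w * w + of_nat k * (deriv ^^ Suc (k - 1)) f w) (at w)"
    by (rule has_field_derivative_transform_within_open[of _ _ _ "ball 0 1"]) (use Suc in auto)
  then have "(deriv ^^ Suc k) (\<lambda>w. w * f w) w
      = 1 * (deriv ^^ k) f w + (deriv ^^ Suc k) f w * w + of_nat k * (deriv ^^ Suc (k - 1)) f w"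
    by (simp add: DERIV_imp_deriv)
  then show ?case by (cases k) (simp_all add: algebra_simps)
qed simp

text \<open>By \<open>sqrt_poch_Suc\<close> this is the product of the norming constants of the
  first k stages.\<close>

definition sqrt_poch :: "real \<Rightarrow> nat \<Rightarrow> real" where
  "sqrt_poch lam k = sqrt (pochhammer (lam - 1) (2 * k))"

lemma sqrt_poch_pos: "1 < lam \<Longrightarrow> 0 < sqrt_poch lam k"
  by (simp add: sqrt_poch_def pochhammer_pos)

lemma sqrt_poch_sq: "1 < lam \<Longrightarrow> sqrt_poch lam k * sqrt_poch lam k = pochhammer (lam - 1) (2 * k)"
  by (simp add: sqrt_poch_def pochhammer_nonneg)

lemma sqrt_poch_Suc:
  assumes "1 < lam"
  shows "sqrt_poch lam (Suc k) = sqrt_poch lam k * weight.s (lam + 2 * real k)"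
proof -
  interpret weight "lam + 2 * real k" using assms by unfold_locales simp
  have "pochhammer (lam - 1) (2 * Suc k)
      = pochhammer (lam - 1) (2 * k) * ((lam + 2 * real k) * (lam + 2 * real k - 1))"
    by (simp add: pochhammer_Suc algebra_simps)
  then show ?thesis by (simp add: sqrt_poch_def s_def real_sqrt_mult)
qed

definition Gamma_coef :: "real \<Rightarrow> nat \<Rightarrow> nat \<Rightarrow> real" where
  "Gamma_coef lam l j = sqrt ((fact j)\<^sup>2 / pochhammer (lam - 1) (2 * j)) * real (l choose j) / pochhammer (lam + 2 * real j) (l - j)"

text \<open>The j! in the special \<open>mu\<close> cancels that of the binomial coefficient, and
  the pochhammer symbols merge into one of order l + j + 1. In this form the coefficients can be
  summed by telescoping.\<close>

lemma Gamma_coef_eq: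
  assumes lam: "1 < lam" and j: "j \<le> l"
  shows "Gamma_coef lam l j
    = sqrt_poch lam j * (fact l * (lam + 2 * real j - 1) / (fact (l - j) * pochhammer (lam - 1) (l + j + 1)))"
proof -
  let ?P = "pochhammer (lam - 1)"
  have l: "l + j + 1 = Suc (2 * j) + (l - j)" using j by simp
  have P: "?P (l + j + 1) = sqrt_poch lam j * sqrt_poch lam j * (lam + 2 * real j - 1) * pochhammer (lam + 2 * real j) (l - j)"
    unfolding l pochhammer_product' pochhammer_Suc sqrt_poch_sq[OF lam] by (simp add: algebra_simps)
  have "Gamma_coef lam l j = fact j / sqrt_poch lam j * real (l choose j) / pochhammer (lam + 2 * real j) (l - j)"
    by (simp add: Gamma_coef_def sqrt_poch_def real_sqrt_divide)
  also have "real (l choose j) = fact l / (fact j * fact (l - j))" using j by (rule binomial_fact)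
  finally have "Gamma_coef lam l j
      = fact j / sqrt_poch lam j * (fact l / (fact j * fact (l - j))) / pochhammer (lam + 2 * real j) (l - j)" .
  moreover have "F / t * (a / (F * b)) / q = t * (a * c / (b * (t * t * c * q)))"
    if "t \<noteq> 0" "c \<noteq> 0" "F \<noteq> 0" for F t a b q c :: real
    using that by simp
  ultimately show ?thesis
    unfolding P using sqrt_poch_pos[OF lam, of j] lam by simp
qed

text \<open>The summands telescope as differences of \<open>(l - j) / ((l - j)! (lam - 1)\<^bsub>l + j + 1\<^esub>)\<close>.\<close>
lemma Gamma_coef_sum:
  assumes lam: "1 < lam" and i: "i < l"
  shows "(\<Sum>j = Suc i..l. Gamma_coef lam l j * (sqrt_poch lam i / sqrt_poch lam j * (lam + 2 * real i - 1)))
    = Gamma_coef lam l i * real (l - i)"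
proof -
  let ?P = "pochhammer (lam - 1)"
  have pos: "0 < ?P k" for k using lam by (intro pochhammer_pos) simp
  define G where "G j = fact l * real (l - j) / (fact (l - j) * ?P (l + j + 1))" for j
  have step: "fact l * (lam + 2 * real j - 1) / (fact (l - j) * ?P (l + j + 1)) = - (G j - G (j - 1))"
    if j: "j \<in> {Suc i..l}" for j
  proof -
    obtain k where k: "j = Suc k" using j by (cases j) auto
    have lk: "l - k = Suc (l - j)" using j k by auto
    have "G (j - 1) = fact l / (fact (l - j) * ?P (l + j))"
      unfolding G_def using lk k by simp
    also have "\<dots> = fact l * (lam - 1 + real (l + j)) / (fact (l - j) * ?P (l + j + 1))"
    proof -
      have "lam - 1 + real (l + j) \<noteq> 0" using lam by simp
      moreover have "?P (l + j + 1) = ?P (l + j) * (lam - 1 + real (l + j))" by (simp add: pochhammer_Suc)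
      ultimately show ?thesis by simp
    qed
    finally have "- (G j - G (j - 1)) = fact l * (lam - 1 + real (l + j) - real (l - j)) / (fact (l - j) * ?P (l + j + 1))"
      unfolding G_def by (simp add: diff_divide_distrib right_diff_distrib)
    also have "lam - 1 + real (l + j) - real (l - j) = lam + 2 * real j - 1" using j by (simp add: of_nat_diff)
    finally show ?thesis ..
  qed
  have "(\<Sum>j = Suc i..l. Gamma_coef lam l j * (sqrt_poch lam i / sqrt_poch lam j * (lam + 2 * real i - 1)))
      = (\<Sum>j = Suc i..l. sqrt_poch lam i * (lam + 2 * real i - 1) * - (G j - G (j - 1)))"
  proof (rule sum.cong)
    fix j assume j: "j \<in> {Suc i..l}"
    then have "j \<le> l" by simp
    then show "Gamma_coef lam l j * (sqrt_poch lam i / sqrt_poch lam j * (lam + 2 * real i - 1))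
        = sqrt_poch lam i * (lam + 2 * real i - 1) * - (G j - G (j - 1))"
      unfolding step[OF j, symmetric] using sqrt_poch_pos[OF lam, of j] by (simp add: Gamma_coef_eq[OF lam])
  qed simp
  also have "\<dots> = sqrt_poch lam i * (lam + 2 * real i - 1) * - (\<Sum>j = Suc i..l. G j - G (j - 1))"
    by (simp only: sum_distrib_left sum_negf mult_minus_right)
  also have "(\<Sum>j = Suc i..l. G j - G (j - 1)) = G l - G i" using i by (intro sum_telescope'') simp
  \<comment> \<open>\<open>G l\<close> vanishes through its factor l - l, so only the lower end
    remains.\<close>
  also have "sqrt_poch lam i * (lam + 2 * real i - 1) * - (G l - G i) = Gamma_coef lam l i * real (l - i)"
    using i by (simp add: Gamma_coef_eq[OF lam] G_def mult_ac)
  finally show ?thesis .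
qed

section \<open>The map Gamma carries the state operator to multiplication\<close>

context cascade
begin

abbreviation mu where "mu \<equiv> \<lambda>k. (fact k)\<^sup>2 / pochhammer (lam - 1) (2 * k) :: real"
abbreviation \<Gamma> where "\<Gamma> \<equiv> Gamma_op lam mu n"

lemma Gamma_in: "l < n \<Longrightarrow> norm w < 1 \<Longrightarrow>
    \<Gamma> f w l = (\<Sum>j\<le>l. of_real (Gamma_coef lam l j) * (deriv ^^ (l - j)) (f j) w)"
  and Gamma_out: "\<not> (l < n \<and> norm w < 1) \<Longrightarrow> \<Gamma> f w l = 0"
  by (auto simp: Gamma_op_def Gamma_coef_def)

lemma St_holomorphic: "x \<in> St \<Longrightarrow> l < n \<Longrightarrow> x l holomorphic_on ball 0 1"
  by (rule Hs_holomorphic[OF St_mem])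

text \<open>Unrolling the recursion with input 0: state i enters the signal through
  \<open>W.L i\<close> and is differentiated by each later stage below l. The constants 1/s
  collected on the way have product sqrt_poch i / sqrt_poch l.\<close>

lemma higher_deriv_up:
  assumes x: "x \<in> St"
  shows "l < n \<Longrightarrow> norm w < 1 \<Longrightarrow> (deriv ^^ k) (up x 0 l) w
    = - (\<Sum>i<l. of_real (sqrt_poch lam i / sqrt_poch lam l * (lam + 2 * real i - 1)) * (deriv ^^ (k + (l - 1 - i))) (x i) w)"
proof (induction l arbitrary: k)
  case 0
  then show ?case by (simp add: zero_fun_apply)
next
  case (Suc l)
  have l: "l < n" using Suc.prems by simp
  define s where "s = W.s l"
  have s: "s > 0" by (simp add: s_def W.s_pos)
  have SS: "sqrt_poch lam (Suc l) = sqrt_poch lam l * s" using sqrt_poch_Suc[OF lam_gt_1] by (simp add: s_def nu_def)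
  have Sp: "sqrt_poch lam l > 0" by (rule sqrt_poch_pos[OF lam_gt_1])
  have hx: "x l holomorphic_on ball 0 1" by (rule St_holomorphic[OF x l])
  have hu: "up x 0 l holomorphic_on ball 0 1" using up_mem[OF x zeros(2), of l] l by (intro Hs_holomorphic) auto
  have hL: "W.L l (x l) holomorphic_on ball 0 1" by (rule Hs_holomorphic[OF W.L_mem[OF St_mem[OF x l]]])
  have hB: "W.B l (up x 0 l) holomorphic_on ball 0 1"
    using W.B_mem[OF up_mem[OF x zeros(2), of l]] l by (intro Hs_holomorphic) auto
  have "(deriv ^^ k) (up x 0 (Suc l)) w = (deriv ^^ k) (W.L l (x l)) w + (deriv ^^ k) (W.B l (up x 0 l)) w"
    using higher_deriv_plus[OF hL hB Suc.prems(2)] by simp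
  also have "(deriv ^^ k) (W.L l (x l)) w = - of_real ((nu l - 1) / s) * (deriv ^^ k) (x l) w"
    unfolding W.L_def s_def by (rule higher_deriv_scale[OF hx Suc.prems(2)])
  also have "(deriv ^^ k) (W.B l (up x 0 l)) w = of_real (1 / s) * (deriv ^^ Suc k) (up x 0 l) w"
    unfolding W.B_def s_def
    using higher_deriv_scale[OF dop_holomorphic[OF hu] Suc.prems(2)] higher_deriv_dop1[OF hu Suc.prems(2)] by simp
  also have "(deriv ^^ Suc k) (up x 0 l) w
      = - (\<Sum>i<l. of_real (sqrt_poch lam i / sqrt_poch lam l * (lam + 2 * real i - 1)) * (deriv ^^ (k + (Suc l - 1 - i))) (x i) w)"
  proof -
    have "Suc k + (l - 1 - i) = k + (Suc l - 1 - i)" if "i < l" for i using that by simp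
    then show ?thesis unfolding Suc.IH[OF l Suc.prems(2)] by (intro arg_cong[of _ _ uminus] sum.cong) auto
  qed
  also have "of_real (1 / s) * - (\<Sum>i<l. of_real (sqrt_poch lam i / sqrt_poch lam l * (lam + 2 * real i - 1)) * (deriv ^^ (k + (Suc l - 1 - i))) (x i) w)
      = - (\<Sum>i<l. of_real (sqrt_poch lam i / sqrt_poch lam (Suc l) * (lam + 2 * real i - 1)) * (deriv ^^ (k + (Suc l - 1 - i))) (x i) w)"
  proof -
    have "1 / s * (sqrt_poch lam i / sqrt_poch lam l * (lam + 2 * real i - 1)) = sqrt_poch lam i / sqrt_poch lam (Suc l) * (lam + 2 * real i - 1)" for i
      unfolding SS using s Sp by simp
    then have "of_real (1 / s) * of_real (sqrt_poch lam i / sqrt_poch lam l * (lam + 2 * real i - 1))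
        = (of_real (sqrt_poch lam i / sqrt_poch lam (Suc l) * (lam + 2 * real i - 1)) :: complex)" for i
      unfolding of_real_mult[symmetric] by (rule arg_cong)
    then show ?thesis by (simp only: mult_minus_right sum_distrib_left mult.assoc[symmetric])
  qed
  also have "of_real ((nu l - 1) / s) = (of_real (sqrt_poch lam l / sqrt_poch lam (Suc l) * (lam + 2 * real l - 1)) :: complex)"
    unfolding SS using Sp by (simp add: nu_def)
  finally show ?case by (simp add: add.commute)
qed

text \<open>The Leibniz rule leaves an extra term with factor l - j for each state, and the signals
  from earlier stages must remove it. All these terms carry the derivative of order l - 1 - i of
  state i, so only coefficients have to be compared, which \<open>Gamma_coef_sum\<close>
  does.\<close>

lemma Gamma_A:
  assumes x: "x \<in> St"
  shows "\<Gamma> (A x 0) = Mz (\<Gamma> x)"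
proof (intro ext)
  fix w l
  show "\<Gamma> (A x 0) w l = Mz (\<Gamma> x) w l"
  proof (cases "l < n \<and> norm w < 1")
    case True
    then have l: "l < n" and w: "norm w < 1" by auto
    let ?a = "\<lambda>j. complex_of_real (Gamma_coef lam l j)"
    let ?D = "\<lambda>i. (deriv ^^ (l - 1 - i)) (x i) w"
    let ?c = "\<lambda>j i. sqrt_poch lam i / sqrt_poch lam j * (lam + 2 * real i - 1)"
    have deriv: "(deriv ^^ (l - j)) (A x 0 j) w
        = w * (deriv ^^ (l - j)) (x j) w + of_nat (l - j) * ?D j - (\<Sum>i<j. of_real (?c j i) * ?D i)"
      if j: "j \<le> l" for j
    proof -
      have jn: "j < n" using j l by simp
      have hx: "x j holomorphic_on ball 0 1" by (rule St_holomorphic[OF x jn])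
      have hu: "up x 0 j holomorphic_on ball 0 1" using up_mem[OF x zeros(2), of j] jn by (intro Hs_holomorphic) auto
      have hT: "W.T (x j) holomorphic_on ball 0 1" by (rule Hs_holomorphic[OF W.T_mem[OF St_mem[OF x jn]]])
      have "(deriv ^^ (l - j)) (A x 0 j) w = (deriv ^^ (l - j)) (W.T (x j)) w + (deriv ^^ (l - j)) (up x 0 j) w"
        using higher_deriv_plus[OF hT hu w] jn by (simp add: A_def)
      moreover have "(deriv ^^ (l - j)) (W.T (x j)) w = w * (deriv ^^ (l - j)) (x j) w + of_nat (l - j) * ?D j"
        unfolding W.T_def higher_deriv_mult_id[OF hx w] by (simp add: diff_commute)
      moreover have "(deriv ^^ (l - j)) (up x 0 j) w = - (\<Sum>i<j. of_real (?c j i) * ?D i)"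
      proof -
        have "l - j + (j - 1 - i) = l - 1 - i" if "i < j" for i using that j by simp
        then show ?thesis unfolding higher_deriv_up[OF x jn w] by (intro arg_cong[of _ _ uminus] sum.cong) auto
      qed
      ultimately show ?thesis by simp
    qed
    have "\<Gamma> (A x 0) w l = (\<Sum>j\<le>l. ?a j * (w * (deriv ^^ (l - j)) (x j) w)
        + ?a j * of_nat (l - j) * ?D j - (\<Sum>i<j. ?a j * of_real (?c j i) * ?D i))"
      unfolding Gamma_in[OF l w]
      by (rule sum.cong) (simp_all add: deriv algebra_simps sum_distrib_left)
    also have "\<dots> = (\<Sum>j\<le>l. ?a j * (w * (deriv ^^ (l - j)) (x j) w))
        + (\<Sum>j\<le>l. ?a j * of_nat (l - j) * ?D j) - (\<Sum>j\<le>l. \<Sum>i<j. ?a j * of_real (?c j i) * ?D i)"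
      by (simp add: sum.distrib sum_subtractf)
    \<comment> \<open>The swap collects, for each state i, all later stages j through which its
      signal reaches row l.\<close>
    also have "(\<Sum>j\<le>l. \<Sum>i<j. ?a j * of_real (?c j i) * ?D i) = (\<Sum>i<l. \<Sum>j = Suc i..l. ?a j * of_real (?c j i) * ?D i)"
      by (rule sum.nested_swap')
    also have "\<dots> = (\<Sum>i<l. ?a i * of_nat (l - i) * ?D i)"
    proof (rule sum.cong)
      fix i assume "i \<in> {..<l}"
      then have "complex_of_real (\<Sum>j = Suc i..l. Gamma_coef lam l j * ?c j i) = of_real (Gamma_coef lam l i * real (l - i))"
        using Gamma_coef_sum[OF lam_gt_1, of i l] by simp
      then show "(\<Sum>j = Suc i..l. ?a j * of_real (?c j i) * ?D i) = ?a i * of_nat (l - i) * ?D i"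
        unfolding sum_distrib_right[symmetric] of_real_sum of_real_mult of_real_of_nat_eq by simp
    qed simp
    \<comment> \<open>The term j = l drops out, its factor being l - l.\<close>
    also have "(\<Sum>j\<le>l. ?a j * of_nat (l - j) * ?D j) = (\<Sum>i<l. ?a i * of_nat (l - i) * ?D i)"
      by (simp add: lessThan_Suc_atMost[symmetric])
    finally show ?thesis unfolding Mz_def Gamma_in[OF l w] by (simp add: sum_distrib_left mult_ac)
  qed (simp add: Gamma_out Mz_def)
qed

lemma Gamma_add:
  assumes "x \<in> St" "y \<in> St"
  shows "\<Gamma> (x + y) = \<Gamma> x + \<Gamma> y"
proof (intro ext)
  fix w l
  show "\<Gamma> (x + y) w l = (\<Gamma> x + \<Gamma> y) w l"
  proof (cases "l < n \<and> norm w < 1")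
    case True
    have "(deriv ^^ (l - j)) ((x + y) j) w = (deriv ^^ (l - j)) (x j) w + (deriv ^^ (l - j)) (y j) w" if "j \<le> l" for j
      using True that higher_deriv_plus[OF St_holomorphic[OF assms(1)] St_holomorphic[OF assms(2)], of j j w "l - j"]
      by (simp add: plus_fun_apply[of x y j])
    then show ?thesis using True
      by (simp add: Gamma_in plus_fun_apply[where x = w] plus_fun_apply[where x = l] distrib_left sum.distrib)
  qed (simp add: Gamma_out plus_fun_apply[where x = w] plus_fun_apply[where x = l])
qed

lemma Gamma_scale:
  assumes "x \<in> St"
  shows "\<Gamma> (cscale c x) = cscale c (\<Gamma> x)"
proof (intro ext)
  fix w l
  have r: "cscale c (\<Gamma> x) w l = c * \<Gamma> x w l"
    by (simp only: cscale_fun_def cscale_complex_def)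
  show "\<Gamma> (cscale c x) w l = cscale c (\<Gamma> x) w l"
  proof (cases "l < n \<and> norm w < 1")
    case True
    have "(deriv ^^ (l - j)) (cscale c x j) w = c * (deriv ^^ (l - j)) (x j) w" if "j \<le> l" for j
      using True that higher_deriv_scale[OF St_holomorphic[OF assms], of j w "l - j" c]
      by (simp add: cscale_fun_def[of c x])
    then show ?thesis
      unfolding r Gamma_in[OF conjunct1[OF True] conjunct2[OF True]] by (simp add: sum_distrib_left mult_ac)
  qed (simp add: Gamma_out r)
qed

lemma Gamma_linear: "linear_on St \<Gamma>"
  by (simp add: linear_on_def Gamma_add Gamma_scale)

text \<open>\<open>Gamma_op\<close> is lower triangular in (l, j) with positive diagonal entries, so
  the components vanish one after another.\<close>

lemma Gamma_kernel:
  assumes x: "x \<in> St" and 0: "\<Gamma> x = 0"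
  shows "x = 0"
proof
  fix l
  show "x l = 0 l"
  proof (induction l rule: less_induct)
    case (less l)
    show ?case
    proof (cases "l < n")
      case True
      have "x l w = 0" for w
      proof (cases "norm w < 1")
        case w: True
        have "0 = \<Gamma> x w l" unfolding 0 by (simp add: zero_fun_apply)
        also have "\<dots> = (\<Sum>j\<le>l. of_real (Gamma_coef lam l j) * (deriv ^^ (l - j)) (x j) w)"
          by (rule Gamma_in[OF True w])
        also have "\<dots> = of_real (Gamma_coef lam l l) * x l w"
          using less by (simp add: lessThan_Suc_atMost[symmetric] zero_fun_apply)
        finally have "of_real (Gamma_coef lam l l) * x l w = 0" by simp
        moreover have "0 < Gamma_coef lam l l"
          using sqrt_poch_pos[OF lam_gt_1, of l] pochhammer_pos[of "lam - 1" "l + l + 1"] lam_gt_1 by (simp add: Gamma_coef_eq)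
        ultimately show ?thesis by simp
      qed (use Hs_off[OF St_mem[OF x True]] in simp)
      then show ?thesis by (simp add: fun_eq_iff zero_fun_apply)
    qed (use St_off[OF x] in \<open>simp add: zero_fun_apply\<close>)
  qed
qed

lemma Gamma_inj: "inj_on \<Gamma> St"
proof (rule inj_onI)
  fix x y assume xy: "x \<in> St" "y \<in> St" "\<Gamma> x = \<Gamma> y"
  then have "\<Gamma> (x - y) = 0" by (simp add: St.linear_on_diff[OF Gamma_linear])
  then show "x = y" using Gamma_kernel[OF St.diff_mem[OF xy(1,2)]] by simp
qed

lemma Hn_eq: "Hn lam n = St"
  by (simp add: Hn_def dsum_def nu_def zero_fun_def)

lemma Gamma_inv_Gamma: "x \<in> St \<Longrightarrow> Gamma_inv lam mu n (\<Gamma> x) = x"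
  unfolding Gamma_inv_def Hn_eq using Gamma_inj by (intro the_equality) (auto dest: inj_onD)

lemma ipV_Gamma: "x \<in> St \<Longrightarrow> y \<in> St \<Longrightarrow> ipV lam mu n (\<Gamma> x) (\<Gamma> y) = ip x y"
  by (simp add: ipV_def Gamma_inv_Gamma dsum_ip_def nu_def)

lemma Gamma_holomorphic:
  assumes x: "x \<in> St"
  shows "(\<lambda>w. \<Gamma> x w l) holomorphic_on ball 0 1"
proof (cases "l < n")
  case True
  have "(deriv ^^ (l - j)) (x j) holomorphic_on ball 0 1" if "j \<le> l" for j
    using St_holomorphic[OF x, of j] that True by (intro holomorphic_higher_deriv) auto
  then have "(\<lambda>w. \<Sum>j\<le>l. of_real (Gamma_coef lam l j) * (deriv ^^ (l - j)) (x j) w) holomorphic_on ball 0 1"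
    by (intro holomorphic_on_sum holomorphic_on_mult holomorphic_on_const) auto
  then show ?thesis by (rule holomorphic_transform) (use True in \<open>simp add: Gamma_in\<close>)
qed (simp add: Gamma_out)

end

text \<open>Only the state space is replaced, by a unitary map; input and output spaces stay the
  same, and with them the transfer function.\<close>

lemma colligation_transport:
  fixes G :: "'g::cvec set" and \<psi> :: "'a::cvec \<Rightarrow> 'g"
  assumes C: "colligation H ipH E ipE F ipF T T' J J' L L' B'" and G: "hilbert G ipG"
    and lin: "linear_on H \<psi>" and im: "\<psi> ` H = G" and inv: "\<And>x. x \<in> H \<Longrightarrow> \<phi> (\<psi> x) = x"
    and ip: "\<And>x y. x \<in> H \<Longrightarrow> y \<in> H \<Longrightarrow> ipG (\<psi> x) (\<psi> y) = ipH x y"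
    and M: "\<And>x. x \<in> H \<Longrightarrow> M (\<psi> x) = \<psi> (T x)"
  shows "colligation G ipG E ipE F ipF M (\<lambda>x. \<psi> (T' (\<phi> x))) (\<lambda>e. \<psi> (J e)) (\<lambda>x. J' (\<phi> x))
    (\<lambda>x. L (\<phi> x)) (\<lambda>g. \<psi> (L' g)) B'"
proof -
  interpret C: colligation H ipH E ipE F ipF T T' J J' L L' B' by (rule C)
  have ex: "\<exists>x\<in>H. u = \<psi> x" if "u \<in> G" for u using im that by blast
  have \<psi>: "\<psi> x \<in> G" if "x \<in> H" for x using im that by blast
  have linC: "linear_on G (\<lambda>u. f (\<phi> u))" if f: "linear_on H f" for f :: "'a \<Rightarrow> 'd::cvec"
    unfolding linear_on_def
  proof (intro conjI ballI allI)
    fix u v assume "u \<in> G" "v \<in> G"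
    then obtain x y where xy: "x \<in> H" "y \<in> H" "u = \<psi> x" "v = \<psi> y" using ex by blast
    then show "f (\<phi> (u + v)) = f (\<phi> u) + f (\<phi> v)"
      by (simp add: linear_on_add[OF lin, symmetric] linear_on_add[OF f] inv C.H.add_mem)
  next
    fix u c assume "u \<in> G"
    then obtain x where x: "x \<in> H" "u = \<psi> x" using ex by blast
    then show "f (\<phi> (cscale c u)) = cscale c (f (\<phi> u))"
      by (simp add: linear_on_scale[OF lin, symmetric] linear_on_scale[OF f] inv C.H.scale_mem)
  qed
  have comp: "linear_on H (\<lambda>x. \<psi> (f x))" if "linear_on H f" "\<And>x. x \<in> H \<Longrightarrow> f x \<in> H" for f
    using that lin by (simp add: linear_on_def)
  have range: "(\<lambda>u. f (\<phi> u)) ` G = f ` H" for f :: "'a \<Rightarrow> 'd"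
    unfolding im[symmetric] image_image by (simp add: inv cong: image_cong)
  note mems = C.T_mem C.T'_mem C.J_mem C.J'_mem C.L_mem C.L'_mem
  show ?thesis
  proof (intro colligation.intro G C.E.hilbert_axioms C.F.hilbert_axioms colligation_axioms.intro)
    have "M u = \<psi> (T (\<phi> u))" if "u \<in> G" for u using ex[OF that] by (auto simp: M inv)
    moreover have "linear_on G (\<lambda>u. \<psi> (T (\<phi> u)))" by (intro linC comp C.T_lin C.T_mem)
    moreover have "u + v \<in> G" "cscale c u \<in> G" if "u \<in> G" "v \<in> G" for u v c
      using hilbert.axioms(1)[OF G] that
      by (auto simp: inner_space_def intro: semi_inner.add_mem semi_inner.scale_mem)
    ultimately show "linear_on G M" unfolding linear_on_def by metis
    show "linear_on G (\<lambda>x. \<psi> (T' (\<phi> x)))" by (intro linC comp C.T'_lin C.T'_mem)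
    show "linear_on G (\<lambda>x. J' (\<phi> x))" "linear_on G (\<lambda>x. L (\<phi> x))" by (intro linC C.J'_lin C.L_lin)+
    show "E \<subseteq> clos E ipE ((\<lambda>x. J' (\<phi> x)) ` G)" unfolding range by (rule C.J'_dense)
    show "F \<subseteq> clos F ipF ((\<lambda>x. L (\<phi> x)) ` G)" unfolding range by (rule C.L_dense)
  next
    fix u assume "u \<in> G"
    then obtain x where x: "x \<in> H" "u = \<psi> x" using ex by blast
    show "M u \<in> G" "\<psi> (T' (\<phi> u)) \<in> G" "J' (\<phi> u) \<in> E" "L (\<phi> u) \<in> F"
      using x mems by (simp_all add: M inv \<psi>)
    show "\<psi> (T' (\<phi> (M u))) + \<psi> (L' (L (\<phi> u))) = u"
      using x mems by (simp add: M inv linear_on_add[OF lin, symmetric] C.T'_T)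
    show "M (\<psi> (T' (\<phi> u))) + \<psi> (J (J' (\<phi> u))) = u"
      using x mems by (simp add: M inv linear_on_add[OF lin, symmetric] C.T_T')
    show "J' (\<phi> (M u)) + B' (L (\<phi> u)) = 0"
      using x mems by (simp add: M inv C.J'_T)
    show "ipG (\<psi> (J e)) u = ipE e (J' (\<phi> u))" if "e \<in> E" for e
      using x mems that by (simp add: ip inv C.J_adj)
    show "ipF (L (\<phi> u)) g = ipG u (\<psi> (L' g))" if "g \<in> F" for g
      using x mems that by (simp add: ip inv C.L_adj)
    fix v assume "v \<in> G"
    then obtain y where y: "y \<in> H" "v = \<psi> y" using ex by blast
    show "ipG (M u) v = ipG u (\<psi> (T' (\<phi> v)))"
      using x y mems by (simp add: M ip inv C.T_adj)
  qed (use mems \<psi> in auto)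
qed

lemma tcoef_power_mult:
  assumes g: "g holomorphic_on ball 0 1" and k: "k < m"
  shows "tcoef (\<lambda>w. w ^ m * g w) k = 0"
  using k
proof (induction m arbitrary: k)
  case (Suc m)
  have h: "(\<lambda>w. w ^ m * g w) holomorphic_on ball 0 1" by (intro holomorphic_intros g)
  have "tcoef (\<lambda>w. w ^ Suc m * g w) = (\<lambda>k. if k = 0 then 0 else tcoef (\<lambda>w. w ^ m * g w) (k - 1))"
    using tcoef_mult_id[OF h] by (simp add: mult.assoc)
  then show ?case using Suc by simp
qed simp

lemma infinite_order_zero:
  assumes h: "h holomorphic_on ball 0 1"
    and div: "\<And>m. \<exists>g. g holomorphic_on ball 0 1 \<and> (\<forall>w. h w = w ^ m * g w)" and w: "norm w < 1"
  shows "h w = 0"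
proof -
  have "tcoef h k = 0" for k
  proof -
    obtain g where g: "g holomorphic_on ball 0 1" "\<And>w. h w = w ^ Suc k * g w" using div by blast
    then have "h = (\<lambda>w. w ^ Suc k * g w)" by blast
    then show ?thesis using tcoef_power_mult[OF g(1), of k "Suc k"] by simp
  qed
  then show ?thesis using tcoef_sums[OF h w] by (simp add: sums_iff)
qed

section \<open>The colligation of multiplication by the coordinate, and complete
  non-unitarity\<close>

context cascade
begin

abbreviation V where "V \<equiv> HV lam mu n"
abbreviation ip_V where "ip_V \<equiv> ipV lam mu n"

lemma V_eq: "V = \<Gamma> ` St"
  by (simp add: HV_def Hn_eq)

lemma hilbert_V: "hilbert V ip_V"
proof (rule hilbert_transport[OF St.hilbert_axioms, where \<phi> = "Gamma_inv lam mu n"])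
  have "\<Gamma> 0 \<in> V" unfolding V_eq by (rule imageI[OF zeros(1)])
  then show "0 \<in> V" unfolding St.linear_on_zero[OF Gamma_linear] .
  show add: "x + y \<in> V" if "x \<in> V" "y \<in> V" for x y
    using that unfolding V_eq by (auto simp: Gamma_add[symmetric] St.add_mem)
  show scale: "cscale c x \<in> V" if "x \<in> V" for x c
    using that unfolding V_eq by (auto simp: Gamma_scale[symmetric] St.scale_mem)
  show "linear_on V (Gamma_inv lam mu n)"
    unfolding linear_on_def V_eq
    by (auto simp: Gamma_add[symmetric] Gamma_scale[symmetric] Gamma_inv_Gamma St.add_mem St.scale_mem)
  show "Gamma_inv lam mu n ` V = St"
    unfolding V_eq image_image by (simp add: Gamma_inv_Gamma cong: image_cong)
  show "inj_on (Gamma_inv lam mu n) V"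
    unfolding V_eq by (rule inj_onI) (auto simp: Gamma_inv_Gamma)
  show "ip_V x y = ip (Gamma_inv lam mu n x) (Gamma_inv lam mu n y)" if "x \<in> V" "y \<in> V" for x y
    using that unfolding V_eq by (auto simp: ipV_Gamma Gamma_inv_Gamma)
qed

lemma colligation_V:
  assumes "0 < n"
  shows "colligation V ip_V (Sg 0) (Hip (nu 0 - 1)) (Sg n) (Hip (nu n - 1)) Mz
    (\<lambda>F. \<Gamma> (A' (Gamma_inv lam mu n F) 0)) (\<lambda>e. \<Gamma> (A 0 e)) (\<lambda>F. down (Gamma_inv lam mu n F) 0 0)
    (\<lambda>F. up (Gamma_inv lam mu n F) 0 n) (\<lambda>g. \<Gamma> (A' 0 g)) (\<lambda>g. down 0 g 0)"
  by (rule colligation_transport[OF colligation[OF assms] hilbert_V Gamma_linear V_eq[symmetric]])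
    (simp_all add: Gamma_inv_Gamma ipV_Gamma Gamma_A)

lemma transfer_V:
  assumes z: "norm z < 1" and g: "g \<in> Sg n"
  shows "\<exists>F\<in>V. F = \<Gamma> (A' (Gamma_inv lam mu n (cscale z F)) 0) + \<Gamma> (A' 0 g)
    \<and> theta_n lam n z g = down (Gamma_inv lam mu n (cscale z F)) 0 0 + down 0 g 0"
proof -
  obtain x where x: "x \<in> St" "x = A' (cscale z x) 0 + A' 0 g"
    and th: "theta_prod lam n z g = down (cscale z x) 0 0 + down 0 g 0"
    using transfer[OF z g] by blast
  have zx: "cscale z x \<in> St" by (rule St.scale_mem[OF x(1)])
  have inv: "Gamma_inv lam mu n (cscale z (\<Gamma> x)) = cscale z x"
    using Gamma_inv_Gamma[OF zx] Gamma_scale[OF x(1), of z] by simp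
  have "\<Gamma> x = \<Gamma> (A' (cscale z x) 0) + \<Gamma> (A' 0 g)"
    using Gamma_add[OF A'_mem[OF zx zeros(2)] A'_mem[OF zeros(1) g]] x(2) by simp
  moreover have "theta_n lam n z g = down (cscale z x) 0 0 + down 0 g 0"
    using theta_n_eq_theta_prod[OF lam_gt_1 z, of g n] g th by (simp add: nu_def)
  moreover have "\<Gamma> x \<in> V" unfolding V_eq using x(1) by (rule imageI)
  ultimately show ?thesis unfolding inv[symmetric] by blast
qed

lemma completely_non_unitary_V: "completely_non_unitary V ip_V Mz"
  unfolding completely_non_unitary_def
proof (rule notI, elim exE conjE)
  fix K
  assume K: "closed_subspace V ip_V K" "K \<noteq> {0}" and MK: "Mz ` K = K"
  have sub: "K \<subseteq> V" and K0: "0 \<in> K" using K(1) by (auto simp: closed_subspace_def)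
  \<comment> \<open>Surjectivity of \<open>Mz\<close> on \<open>K\<close> permits division by the
    coordinate within \<open>K\<close>, and this can be repeated.\<close>
  have div: "\<exists>G\<in>K. \<forall>w l. F w l = w ^ m * G w l" if "F \<in> K" for F m
  proof (induction m)
    case 0
    then show ?case using that by auto
  next
    case (Suc m)
    then obtain G where G: "G \<in> K" "\<And>w l. F w l = w ^ m * G w l" by blast
    then obtain G' where "G' \<in> K" "G = Mz G'" using MK by blast
    then show ?case using G(2) by (intro bexI[of _ G']) (simp_all add: Mz_def mult_ac)
  qed
  have hol: "(\<lambda>w. F w l) holomorphic_on ball 0 1" if "F \<in> K" for F l
    using that sub Gamma_holomorphic unfolding V_eq by blast
  have "F = 0" if F: "F \<in> K" for F
  proof (intro ext)
    fix w l
    obtain x where x: "F = \<Gamma> x" using F sub unfolding V_eq by blast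
    show "F w l = 0 w l"
    proof (cases "norm w < 1")
      case True
      have "F w l = 0"
        using div[OF F] hol by (intro infinite_order_zero[OF hol[OF F] _ True]) metis
      then show ?thesis by (simp add: zero_fun_apply)
    qed (simp add: x Gamma_out zero_fun_apply)
  qed
  then show False using K(2) K0 by blast
qed

end

theorem theorem6p2:
  fixes lam :: real and n :: nat
  assumes "lam > 1" and "n \<ge> 1"
  shows "let mu = (\<lambda>k. (fact k)\<^sup>2 / pochhammer (lam - 1) (2 * k));
             H = HV lam mu n; ip = ipV lam mu n
         in is_contraction H ip Mz
          \<and> completely_non_unitary H ip Mz
          \<and> char_fun_coincides H ip Mz
               (Hs (lam + 2 * real n - 1)) (Hip (lam + 2 * real n - 1))
               (Hs (lam - 1)) (Hip (lam - 1)) (theta_n lam n)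
          \<and> (\<forall>z\<in>ball 0 1. \<forall>g\<in>Hs (lam + 2 * real n - 1). theta_n lam n z g = theta_prod lam n z g)"
proof -
  interpret cascade lam n using assms(1) by unfold_locales
  have n: "0 < n" using assms(2) by simp
  interpret C: colligation V ip_V "Sg 0" "Hip (nu 0 - 1)" "Sg n" "Hip (nu n - 1)" Mz
    "\<lambda>F. \<Gamma> (A' (Gamma_inv lam mu n F) 0)" "\<lambda>e. \<Gamma> (A 0 e)" "\<lambda>F. down (Gamma_inv lam mu n F) 0 0"
    "\<lambda>F. up (Gamma_inv lam mu n F) 0 n" "\<lambda>g. \<Gamma> (A' 0 g)" "\<lambda>g. down 0 g 0"
    by (rule colligation_V[OF n])
  have "char_fun_coincides V ip_V Mz (Sg n) (Hip (nu n - 1)) (Sg 0) (Hip (nu 0 - 1)) (theta_n lam n)"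
    by (rule C.char_fun_coincides_transfer) (rule transfer_V)
  then have "char_fun_coincides V ip_V Mz (Hs (lam + 2 * real n - 1)) (Hip (lam + 2 * real n - 1))
      (Hs (lam - 1)) (Hip (lam - 1)) (theta_n lam n)"
    by (simp add: nu_def)
  moreover have "theta_n lam n z g = theta_prod lam n z g"
    if "z \<in> ball 0 1" "g \<in> Hs (lam + 2 * real n - 1)" for z g
    using that assms(1) by (intro theta_n_eq_theta_prod) simp_all
  ultimately show ?thesis
    unfolding Let_def using C.contraction completely_non_unitary_V by blast
qed

end
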